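(* Let $n\ge 2$ and let $\psi$ be a complete Bernstein function. Suppose that the weight $a(t)$ on $(0,\infty)$ associated with $\psi(-\Delta)$ is an $A_2$ weight and that, for some $-1<\alpha<1$, $a(t)\sim t^\alpha$ for $t\gg 1$. Let $u\in L^\infty(\mathbb{R}^n)$ with $u(x)\to 0$ as $|x|\to\infty$. Then $u$ solves $\psi(-\Delta)u=\psi(1)u$ in $\mathbb{R}^n$ if and only if $-\Delta u=u$ in $\mathbb{R}^n$.
   Context: A function $\psi$ is complete Bernstein if $\psi(t)=t\,\mathcal{L}\{f\}(t)$ for $t>0$, where $\mathcal{L}$ is the Laplace transform and $f:(0,\infty)\to[0,\infty)$ is completely monotone, i.e. $(-1)^kf^{(k)}\ge 0$ for all $k\ge 0$ (e.g. $\psi(t)=t^s$, $0<s<1$). $\psi(-\Delta)$ is the operator with Fourier multiplier $\psi(|\xi|^2)$, i.e. $\widehat{\psi(-\Delta)u}(\xi)=\psi(|\xi|^2)\hat u(\xi)$ in the distributional sense: $\langle\psi(-\Delta)u,\phi\rangle=\int u\,\psi(-\Delta)\phi\,dx$ for Schwartz $\phi$. Associated weight: to $\psi$ corresponds (Kwaśnicki–Mucha, Krein's correspondence) a locally finite measure $A$ on an interval $[0,R)$, $R\in(0,\infty]$, such that $\psi(-\Delta)u=-\partial_s\dot u(\cdot,0)$, where $\dot u(x,s)$ is the extension solving $\partial_s^2\dot u+A(s)\Delta_x\dot u=0$, $\dot u(x,0)=u(x)$; when $R=\infty$ this means that, for $\lambda>0$, the non-negative non-increasing solution $\varphi_\lambda$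 of $\varphi_\lambda''=\lambda A\varphi_\lambda$, $\varphi_\lambda(0)=1$, satisfies $\varphi_\lambda'(0)=-\psi(\lambda)$. If $A$ is a non-negative $L^1_{\mathrm{loc}}$ function, the change of variables $ds=a(t)^{-1}dt$, $A(s)\,ds=a(t)\,dt$ defines the associated weight $a(t)$, and the extension problem becomes: $\nabla\cdot(a(t)\nabla\dot u)=0$ on $\mathbb{R}^{n+1}_+=\mathbb{R}^n\times(0,\infty)$, $\lim_{t\to0}a(t)\dot u_t(x,t)=-c_{n,a}\psi(-\Delta)u(x)$ on $\mathbb{R}^n$, $\dot u(x,0)=u(x)$, with $\dot u\in H^1_{\mathrm{loc}}(\mathbb{R}^{n+1}_+,a(t))$ and $c_{n,a}>0$ a normalization constant. The weight $a$ is $A_2$ on $(0,\infty)$ if there is $C$ with $\left(\frac1{q-p}\int_p^q a\,dt\right)\left(\frac1{q-p}\int_p^q a^{-1}dt\right)\le C$ for all $0\le p<q<\infty$. The notation $a(t)\sim t^\alpha$ for $t\gg1$ means there are $C\ge1$, $t_0>0$ with $C^{-1}t^\alpha\le a(t)\le Ct^\alpha$ for $t\ge t_0$. *)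

theory Defs
  imports "HOL-Analysis.Analysis"
begin

definition completely_monotone :: "(real \<Rightarrow> real) \<Rightarrow> bool" where
  "completely_monotone f \<longleftrightarrow>
     (\<forall>k. \<forall>t>0. (deriv ^^ k) f field_differentiable (at t) \<and> 0 \<le> (- 1) ^ k * (deriv ^^ k) f t)"

definition laplace_transform :: "(real \<Rightarrow> real) \<Rightarrow> real \<Rightarrow> real" where
  "laplace_transform f t = (LINT s:{0<..}|lebesgue. exp (- t * s) * f s)"

definition complete_bernstein :: "(real \<Rightarrow> real) \<Rightarrow> bool" where
  "complete_bernstein \<psi> \<longleftrightarrow>
     (\<exists>f. completely_monotone f \<and>
          (\<forall>t>0. set_integrable lebesgue {0<..} (\<lambda>s. exp (- t * s) * f s) \<and>
                 \<psi> t = t * laplace_transform f t))"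

definition partial_deriv :: "'n::finite \<Rightarrow> (real^'n \<Rightarrow> complex) \<Rightarrow> real^'n \<Rightarrow> complex" where
  "partial_deriv i f x = frechet_derivative f (at x) (axis i 1)"

definition schwartz :: "(real^'n::finite \<Rightarrow> complex) \<Rightarrow> bool" where
  "schwartz f \<longleftrightarrow>
     (\<forall>is. foldr partial_deriv is f differentiable_on UNIV \<and>
           (\<forall>k::nat. bounded (range (\<lambda>x. norm x ^ k *\<^sub>R foldr partial_deriv is f x))))"

definition laplacian :: "(real^'n::finite \<Rightarrow> complex) \<Rightarrow> real^'n \<Rightarrow> complex" where
  "laplacian f x = (\<Sum>i\<in>UNIV. partial_deriv i (partial_deriv i f) x)"

text \<open>With the kernel \<open>e\<^sup>-\<^sup>i\<^sup>x\<^sup>\<xi>\<close> (no \<open>2\<pi>\<close> in the exponent), \<open>-\<Delta>\<close> has multiplier \<open>\<bar>\<xi>\<bar>\<^sup>2\<close>.\<close>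

definition fourier :: "(real^'n::finite \<Rightarrow> complex) \<Rightarrow> real^'n \<Rightarrow> complex" where
  "fourier f \<xi> = (LINT x|lebesgue. cis (- (x \<bullet> \<xi>)) * f x)"

definition inverse_fourier :: "(real^'n::finite \<Rightarrow> complex) \<Rightarrow> real^'n \<Rightarrow> complex" where
  "inverse_fourier g x =
     complex_of_real (1 / (2 * pi) ^ CARD('n)) * (LINT \<xi>|lebesgue. cis (x \<bullet> \<xi>) * g \<xi>)"

text \<open>A complete Bernstein function is only specified on \<open>(0,\<infinity>)\<close>; the value \<open>\<psi> 0\<close> enters
  below only at the null set \<open>\<xi> = 0\<close>.\<close>

definition psi_laplacian :: "(real \<Rightarrow> real) \<Rightarrow> (real^'n::finite \<Rightarrow> complex) \<Rightarrow> real^'n \<Rightarrow> complex" where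
  "psi_laplacian \<psi> \<phi> =
     inverse_fourier (\<lambda>\<xi>. complex_of_real (\<psi> ((norm \<xi>)\<^sup>2)) * fourier \<phi> \<xi>)"

definition distribution_of :: "(real^'n::finite \<Rightarrow> complex) \<Rightarrow> (real^'n \<Rightarrow> complex) \<Rightarrow> complex" where
  "distribution_of u \<phi> = (LINT x|lebesgue. u x * \<phi> x)"

text \<open>For \<open>\<psi>\<close> complete Bernstein and \<open>\<phi>\<close> Schwartz, \<open>\<psi>(-\<Delta>)\<phi>\<close> is in \<open>L\<^sup>1\<close>, so the following
  pairing is an absolutely convergent integral whenever \<open>u\<close> is in \<open>L\<^sup>\<infinity>\<close>.\<close>

definition psi_laplacian_distr ::
    "(real \<Rightarrow> real) \<Rightarrow> (real^'n::finite \<Rightarrow> complex) \<Rightarrow> (real^'n \<Rightarrow> complex) \<Rightarrow> complex" where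
  "psi_laplacian_distr \<psi> u \<phi> = distribution_of u (psi_laplacian \<psi> \<phi>)"

definition neg_laplacian_distr ::
    "(real^'n::finite \<Rightarrow> complex) \<Rightarrow> (real^'n \<Rightarrow> complex) \<Rightarrow> complex" where
  "neg_laplacian_distr u \<phi> = distribution_of u (\<lambda>x. - laplacian \<phi> x)"

definition solves_psi_eigen :: "(real \<Rightarrow> real) \<Rightarrow> (real^'n::finite \<Rightarrow> complex) \<Rightarrow> bool" where
  "solves_psi_eigen \<psi> u \<longleftrightarrow>
     (\<forall>\<phi>. schwartz \<phi> \<longrightarrow>
        psi_laplacian_distr \<psi> u \<phi> = complex_of_real (\<psi> 1) * distribution_of u \<phi>)"

definition solves_helmholtz :: "(real^'n::finite \<Rightarrow> complex) \<Rightarrow> bool" where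
  "solves_helmholtz u \<longleftrightarrow>
     (\<forall>\<phi>. schwartz \<phi> \<longrightarrow> neg_laplacian_distr u \<phi> = distribution_of u \<phi>)"

definition L1_loc_half_line :: "(real \<Rightarrow> real) \<Rightarrow> bool" where
  "L1_loc_half_line g \<longleftrightarrow> (\<forall>r\<ge>0. g absolutely_integrable_on {0..r})"

text \<open>Since \<open>A\<close> is merely locally integrable, \<open>\<phi>'' = \<mu> A \<phi>\<close> on \<open>[0,\<infinity>)\<close> is understood in the
  Caratheodory sense: \<open>\<phi>\<close> is \<open>C\<^sup>1\<close> (one-sided at \<open>0\<close>) and \<open>\<phi>'\<close> is the indefinite integral of
  \<open>\<mu> A \<phi>\<close>.\<close>

definition string_solution ::
    "(real \<Rightarrow> real) \<Rightarrow> real \<Rightarrow> (real \<Rightarrow> real) \<Rightarrow> (real \<Rightarrow> real) \<Rightarrow> bool" where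
  "string_solution A \<mu> \<phi> \<phi>' \<longleftrightarrow>
     (\<forall>s\<ge>0. (\<phi> has_real_derivative \<phi>' s) (at s within {0..})) \<and>
     (\<forall>s\<ge>0. \<phi>' s = \<phi>' 0 + \<mu> * integral {0..s} (\<lambda>r. A r * \<phi> r))"

text \<open>Krein's correspondence on the infinite interval (\<open>R = \<infinity>\<close>), for a measure with density \<open>A\<close>.
  The non-negative non-increasing solution is unique.\<close>

definition krein_corresponds :: "(real \<Rightarrow> real) \<Rightarrow> (real \<Rightarrow> real) \<Rightarrow> bool" where
  "krein_corresponds \<psi> A \<longleftrightarrow>
     (AE s in lebesgue. 0 \<le> s \<longrightarrow> 0 \<le> A s) \<and> L1_loc_half_line A \<and>
     (\<forall>\<mu>>0. \<exists>\<phi> \<phi>'. string_solution A \<mu> \<phi> \<phi>' \<and> \<phi> 0 = 1 \<and>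
        (\<forall>s\<ge>0. 0 \<le> \<phi> s) \<and> antimono_on {0..} \<phi> \<and> \<phi>' 0 = - \<psi> \<mu>)"

text \<open>The change of variables \<open>ds = a(t)\<^sup>-\<^sup>1 dt\<close>, \<open>A(s) ds = a(t) dt\<close> is stated in integrated form,
  with \<open>s = \<sigma>(t)\<close>, the integral of \<open>1/a\<close> over \<open>[0,t]\<close>. Requiring \<open>\<sigma>(t) \<rightarrow> \<infinity>\<close> says \<open>R = \<infinity>\<close>; this is
  automatic if \<open>a(t) \<sim> t\<^sup>\<alpha>\<close> for \<open>t \<ggreater> 1\<close> with \<open>\<alpha> < 1\<close>. Positivity of \<open>a\<close> almost everywhere is needed
  for \<open>1/a\<close> to be meaningful, as \<open>inverse 0 = 0\<close>.\<close>

definition associated_weight :: "(real \<Rightarrow> real) \<Rightarrow> (real \<Rightarrow> real) \<Rightarrow> bool" where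
  "associated_weight \<psi> a \<longleftrightarrow>
     (AE t in lebesgue. 0 < t \<longrightarrow> 0 < a t) \<and>
     L1_loc_half_line a \<and> L1_loc_half_line (\<lambda>t. inverse (a t)) \<and>
     (\<exists>A. krein_corresponds \<psi> A \<and>
        (let \<sigma> = (\<lambda>t. integral {0..t} (\<lambda>\<tau>. inverse (a \<tau>))) in
           filterlim \<sigma> at_top at_top \<and>
           (\<forall>t\<ge>0. integral {0..\<sigma> t} A = integral {0..t} a)))"

definition A2_weight :: "(real \<Rightarrow> real) \<Rightarrow> bool" where
  "A2_weight a \<longleftrightarrow>
     (\<exists>C. \<forall>p q. 0 \<le> p \<and> p < q \<longrightarrow>
        a absolutely_integrable_on {p..q} \<and> (\<lambda>t. inverse (a t)) absolutely_integrable_on {p..q} \<and>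
        (1 / (q - p) * integral {p..q} a) * (1 / (q - p) * integral {p..q} (\<lambda>t. inverse (a t))) \<le> C)"

definition power_like_at_infinity :: "(real \<Rightarrow> real) \<Rightarrow> real \<Rightarrow> bool" where
  "power_like_at_infinity a \<alpha> \<longleftrightarrow>
     (\<exists>C t\<^sub>0. 1 \<le> C \<and> 0 < t\<^sub>0 \<and>
        (AE t in lebesgue. t\<^sub>0 \<le> t \<longrightarrow> inverse C * t powr \<alpha> \<le> a t \<and> a t \<le> C * t powr \<alpha>))"

definition L_infinity :: "(real^'n::finite \<Rightarrow> complex) \<Rightarrow> bool" where
  "L_infinity u \<longleftrightarrow> u \<in> borel_measurable lebesgue \<and> (\<exists>C. AE x in lebesgue. norm (u x) \<le> C)"

text \<open>As \<open>u\<close> represents an almost-everywhere class, \<open>u(x) \<rightarrow> 0\<close> is also read up to null sets.\<close>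

definition vanishes_at_infinity :: "(real^'n::finite \<Rightarrow> complex) \<Rightarrow> bool" where
  "vanishes_at_infinity u \<longleftrightarrow>
     (\<forall>\<epsilon>>0. \<exists>r. AE x in lebesgue. r \<le> norm x \<longrightarrow> norm (u x) < \<epsilon>)"

end

theory Submission
  imports Defs "HOL-Probability.Probability"
begin

text \<open>
  Write \<open>P\<^sub>s\<close> for the heat semigroup, the operator with Fourier multiplier \<open>exp (- s\<bar>\<xi>\<bar>\<^sup>2)\<close>. Each of
  the two equations says that \<open>P\<^sub>s u = exp (- s) u\<close> for all \<open>s \<ge> 0\<close>; in weak form this is
  \<open>heat_eigenfunction\<close> below.

  For the Helmholtz equation this is the heat equation: \<open>\<partial>\<^sub>s P\<^sub>s u = \<Delta> P\<^sub>s u = - P\<^sub>s u\<close>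
  (\<open>solves_helmholtz_iff\<close>).

  For the other equation, let \<open>\<psi> t\<close> be \<open>t\<close> times the Laplace transform of the completely monotone
  function \<open>f\<close>, and put \<open>p = - f'\<close> and \<open>c = lim f\<close> at infinity. Integration by parts gives
  \<open>\<psi> t = c + \<integral> (1 - exp (- t s)) p s ds\<close> with \<open>p \<ge> 0\<close> decreasing (\<open>complete_bernstein_levy\<close>), so that
  \<open>\<psi>(-\<Delta>) = c + \<integral> (1 - P\<^sub>s) p s ds\<close> (\<open>psi_laplacian_eq_heat\<close>). Inserting \<open>P\<^sub>s u = exp (- s) u\<close> yields
  \<open>\<psi>(-\<Delta>) u = \<psi> 1 u\<close>.

  Conversely, test \<open>\<psi>(-\<Delta>) u = \<psi> 1 u\<close> with Gaussians, which the heat flow maps to Gaussians. For a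
  fixed centre \<open>x\<close> and \<open>t > 0\<close> the function \<open>F s = P\<^bsub>t+s\<^esub> u (x)\<close> then satisfies
  \<open>\<integral> (F (r + s) - exp (- s) F r) p s ds = 0\<close> for all \<open>r \<ge> 0\<close>, and so does \<open>F'\<close>: the problem has become
  one-dimensional. As \<open>u\<close> vanishes at infinity, \<open>F\<close> and \<open>F'\<close> tend to \<open>0\<close>. If \<open>h = F + F'\<close> took a
  positive value, it would have a last maximum point \<open>t\<close>, and comparing the values of \<open>h\<close> after \<open>t\<close> with
  its value at \<open>t\<close> contradicts the equation for \<open>F'\<close>, since \<open>p\<close> decreases (\<open>maximum_principle\<close>).
  Applied to the real and imaginary parts with both signs, this gives \<open>F' = - F\<close>.

  The maximum principle needs \<open>p\<close> to be non-trivial, that is, \<open>\<psi>\<close> to be non-constant. This is what the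
  string associated with the weight provides: a constant symbol would force the string to have no
  mass, while its mass equals the integral of a positive weight (\<open>associated_weight_not_constant\<close>).
\<close>

section \<open>Integration on Euclidean space\<close>

lemma lborel_affine_integrable_iff:
  fixes f :: "'a::euclidean_space \<Rightarrow> 'b::{banach, second_countable_topology}"
  assumes "c \<noteq> 0" and [measurable]: "f \<in> borel_measurable borel"
  shows "integrable lborel (\<lambda>x. f (t + c *\<^sub>R x)) \<longleftrightarrow> integrable lborel f"
proof -
  have "integrable lborel f \<longleftrightarrow>
      integrable (density (distr lborel borel (\<lambda>x. t + c *\<^sub>R x)) (\<lambda>_. ennreal (\<bar>c\<bar> ^ DIM('a)))) f"
    using lborel_affine[OF assms(1), of t] by (simp add: ennreal_power)
  also have "\<dots> \<longleftrightarrow> integrable lborel (\<lambda>x. \<bar>c\<bar> ^ DIM('a) *\<^sub>R f (t + c *\<^sub>R x))"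
    by (simp add: integrable_density integrable_distr_eq)
  also have "\<dots> \<longleftrightarrow> integrable lborel (\<lambda>x. f (t + c *\<^sub>R x))"
    using assms(1) integrable_scaleR_right[of "inverse (\<bar>c\<bar> ^ DIM('a))" lborel "\<lambda>x. \<bar>c\<bar> ^ DIM('a) *\<^sub>R f (t + c *\<^sub>R x)"]
    by auto
  finally show ?thesis ..
qed

lemma lborel_affine_integral:
  fixes f :: "'a::euclidean_space \<Rightarrow> 'b::{banach, second_countable_topology}"
  assumes "c \<noteq> 0" and [measurable]: "f \<in> borel_measurable borel"
  shows "(LINT x|lborel. f x) = \<bar>c\<bar> ^ DIM('a) *\<^sub>R (LINT x|lborel. f (t + c *\<^sub>R x))"
proof -
  have "(LINT x|lborel. f x) =
      integral\<^sup>L (density (distr lborel borel (\<lambda>x. t + c *\<^sub>R x)) (\<lambda>_. ennreal (\<bar>c\<bar> ^ DIM('a)))) f"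
    using lborel_affine[OF assms(1), of t] by (simp add: ennreal_power)
  also have "\<dots> = (LINT x|lborel. \<bar>c\<bar> ^ DIM('a) *\<^sub>R f (t + c *\<^sub>R x))"
    by (simp add: integral_density integral_distr)
  finally show ?thesis by simp
qed

text \<open>Lebesgue measure on \<open>\<real>\<^sup>n\<close> is the image of a product measure on functions \<open>Basis \<rightarrow> \<real>\<close>; the basis
  vectors \<open>axis i 1\<close> are in bijection with the indices \<open>i\<close>.\<close>

lemma
  fixes f :: "'n::finite \<Rightarrow> real \<Rightarrow> 'b::{real_normed_field, banach, second_countable_topology}"
  assumes f: "\<And>i. integrable lborel (f i)"
  shows integrable_prod_vec: "integrable lborel (\<lambda>x::real^'n. \<Prod>i\<in>UNIV. f i (x $ i))"
    and integral_prod_vec: "(LINT x::real^'n|lborel. (\<Prod>i\<in>UNIV. f i (x $ i))) = (\<Prod>i\<in>UNIV. (LINT x|lborel. f i x))"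
proof -
  interpret product_sigma_finite "\<lambda>_::real^'n. lborel :: real measure"
    by standard
  have [measurable]: "f i \<in> borel_measurable borel" for i
    using borel_measurable_integrable[OF f] by simp
  define g where "g b = f (THE i. b = axis i (1::real))" for b :: "real^'n"
  have inj: "inj_on (\<lambda>i::'n. axis i (1::real)) UNIV"
    by (auto simp: inj_on_def axis_eq_axis)
  have B: "(Basis :: (real^'n) set) = (\<lambda>i. axis i 1) ` UNIV"
    by (auto simp: Basis_vec_def)
  have g: "g (axis i 1) = f i" for i
    unfolding g_def by (rule arg_cong[where f=f]) (auto simp: axis_eq_axis)
  have eq: "(\<Prod>i\<in>UNIV. f i ((\<Sum>b\<in>Basis. h b *\<^sub>R b :: real^'n) $ i)) = (\<Prod>b\<in>Basis. g b (h b))" for h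
  proof -
    have "(\<Sum>b\<in>Basis. h b *\<^sub>R b :: real^'n) $ i = h (axis i 1)" for i
    proof -
      have "(\<Sum>b\<in>Basis. h b *\<^sub>R b :: real^'n) $ i = (\<Sum>b\<in>Basis. h b *\<^sub>R b) \<bullet> axis i 1"
        by (simp add: inner_axis)
      also have "\<dots> = h (axis i 1)"
        by (subst inner_sum_left_Basis) (auto simp: B)
      finally show ?thesis .
    qed
    then show ?thesis
      unfolding B by (simp add: prod.reindex[OF inj] g)
  qed
  have gi: "integrable lborel (g b)" if "b \<in> Basis" for b :: "real^'n"
    using that f by (auto simp: B g)
  have meas: "(\<lambda>h. \<Sum>b\<in>Basis. h b *\<^sub>R b :: real^'n) \<in> (\<Pi>\<^sub>M b\<in>Basis. lborel) \<rightarrow>\<^sub>M borel"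
    by measurable
  show "integrable lborel (\<lambda>x::real^'n. \<Prod>i\<in>UNIV. f i (x $ i))"
    apply (subst lborel_eq)
    apply (subst integrable_distr_eq[OF meas], measurable)
    apply (simp only: eq)
    by (rule product_integrable_prod) (auto intro: gi)
  show "(LINT x::real^'n|lborel. (\<Prod>i\<in>UNIV. f i (x $ i))) = (\<Prod>i\<in>UNIV. (LINT x|lborel. f i x))"
    apply (subst lborel_eq)
    apply (subst integral_distr[OF meas], measurable)
    apply (simp only: eq)
    apply (subst product_integral_prod)
    apply (auto intro: gi)
    unfolding B by (simp add: prod.reindex[OF inj] g)
qed

lemma integrable_1_div_plus_square: "integrable lborel (\<lambda>x::real. 1 / (1 + x\<^sup>2))"
proof -
  have pos: "set_integrable lborel {0<..} (\<lambda>x::real. 1 / (1 + x\<^sup>2))"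
    using integrable_I0i_1_div_plus_square
    by (simp add: interval_lebesgue_integrable_def einterval_def greaterThan_def)
  have "integrable lborel (\<lambda>x::real. indicator {0<..} (0 + (-1) * x) *\<^sub>R (1 / (1 + (0 + (-1) * x)\<^sup>2)))"
    by (rule lborel_integrable_real_affine[OF pos[unfolded set_integrable_def]]) simp
  then have "integrable lborel (\<lambda>x::real. indicator {0<..} x *\<^sub>R (1 / (1 + x\<^sup>2)) +
       indicator {0<..} (0 + (-1) * x) *\<^sub>R (1 / (1 + (0 + (-1) * x)\<^sup>2)))"
    using pos[unfolded set_integrable_def] by (rule Bochner_Integration.integrable_add[rotated])
  then show ?thesis
    by (rule integrable_cong_AE_imp)
       (auto intro!: AE_I[where N="{0}"] simp: indicator_def not_less)
qed

text \<open>The integrable majorant is \<open>\<Prod>\<^sub>i 1 / (1 + x\<^sub>i\<^sup>2)\<close>, each factor of the denominator being at most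
  \<open>1 + \<bar>x\<bar>\<^sup>2\<close>.\<close>

lemma integrable_if_decay:
  fixes f :: "real^'n::finite \<Rightarrow> 'b::{banach, second_countable_topology}"
  assumes [measurable]: "f \<in> borel_measurable borel"
    and C: "\<And>x. (1 + (norm x)\<^sup>2) ^ CARD('n) * norm (f x) \<le> C"
  shows "integrable lborel f"
proof (rule Bochner_Integration.integrable_bound)
  have "integrable lborel (\<lambda>x::real^'n. \<Prod>i\<in>UNIV. 1 / (1 + (x $ i)\<^sup>2))"
    by (rule integrable_prod_vec) (rule integrable_1_div_plus_square)
  then show "integrable lborel (\<lambda>x::real^'n. C * (\<Prod>i\<in>UNIV. 1 / (1 + (x $ i)\<^sup>2)))"
    by simp
  show "AE x in lborel. norm (f x) \<le> norm (C * (\<Prod>i\<in>UNIV. 1 / (1 + (x $ i)\<^sup>2)))"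
  proof (rule AE_I2)
    fix x :: "real^'n"
    have "0 \<le> (1 + (norm (0::real^'n))\<^sup>2) ^ CARD('n) * norm (f 0)" by simp
    then have C0: "0 \<le> C" using C[of 0] by linarith
    have *: "(\<Prod>i\<in>UNIV. 1 + (x $ i)\<^sup>2) \<le> (1 + (norm x)\<^sup>2) ^ CARD('n)"
      by (rule order_trans[OF prod_mono[where g="\<lambda>_. 1 + (norm x)\<^sup>2"]])
         (auto intro!: power_mono simp: component_le_norm_cart abs_le_square_iff[symmetric])
    have pos: "0 < (\<Prod>i\<in>UNIV. 1 + (x $ i)\<^sup>2)"
      by (intro prod_pos ballI) (simp add: add_pos_nonneg)
    have "(\<Prod>i\<in>UNIV. 1 + (x $ i)\<^sup>2) * norm (f x) \<le> (1 + (norm x)\<^sup>2) ^ CARD('n) * norm (f x)"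
      by (rule mult_right_mono[OF *]) simp
    also note C[of x]
    finally have "norm (f x) \<le> C / (\<Prod>i\<in>UNIV. 1 + (x $ i)\<^sup>2)"
      using pos by (simp add: field_simps)
    then show "norm (f x) \<le> norm (C * (\<Prod>i\<in>UNIV. 1 / (1 + (x $ i)\<^sup>2)))"
      using C0 pos by (simp add: prod_dividef abs_mult abs_of_pos)
  qed
qed simp

lemma integrable_if_slices:
  fixes h :: "'a::euclidean_space \<Rightarrow> 'b::euclidean_space \<Rightarrow> 'c::{banach, second_countable_topology}"
  assumes [measurable]: "case_prod h \<in> borel_measurable (lborel \<Otimes>\<^sub>M lborel)"
    and hi: "\<And>x. integrable lborel (h x)"
    and g: "integrable lborel g" and le: "\<And>x. (LINT y|lborel. norm (h x y)) \<le> g x"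
  shows "integrable (lborel \<Otimes>\<^sub>M lborel) (case_prod h)"
proof (rule lborel_pair.Fubini_integrable)
  show "integrable lborel (\<lambda>x. LINT y|lborel. norm (case (x, y) of (x, y) \<Rightarrow> h x y))"
  proof (rule Bochner_Integration.integrable_bound[OF g])
    have "0 \<le> (LINT y|lborel. norm (h x y))" for x by simp
    then show "AE x in lborel. norm (LINT y|lborel. norm (case (x, y) of (x, y) \<Rightarrow> h x y)) \<le> norm (g x)"
      using le by (auto intro!: AE_I2 order_trans[OF _ abs_ge_self])
  qed measurable
qed (use hi in auto)

lemma integrable_if_product_majorant:
  fixes h :: "'a::euclidean_space \<Rightarrow> 'b::euclidean_space \<Rightarrow> 'c::{banach, second_countable_topology}"
  assumes meas: "case_prod h \<in> borel_measurable (lborel \<Otimes>\<^sub>M lborel)"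
    and f: "integrable lborel f" and g: "integrable lborel g"
    and le: "\<And>x y. norm (h x y) \<le> f x * g y"
  shows "integrable (lborel \<Otimes>\<^sub>M lborel) (case_prod h)"
proof (rule integrable_if_slices[OF meas])
  show hi: "integrable lborel (h x)" for x
  proof (rule Bochner_Integration.integrable_bound)
    show "integrable lborel (\<lambda>y. f x * g y)" using g by (rule integrable_mult_right)
    show "h x \<in> borel_measurable lborel" using measurable_Pair2[OF meas, of x] by simp
    show "AE y in lborel. norm (h x y) \<le> norm (f x * g y)"
      by (intro AE_I2 order_trans[OF le]) simp
  qed
  show "integrable lborel (\<lambda>x. f x * (LINT y|lborel. g y))" using f by (rule integrable_mult_left)
  show "(LINT y|lborel. norm (h x y)) \<le> f x * (LINT y|lborel. g y)" for x
    using integral_mono[OF integrable_norm[OF hi] integrable_mult_right[OF g] le] by simp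
qed

text \<open>Bounds on \<open>\<bar>x\<bar>\<^sup>2\<^sup>k f x\<close>, which Schwartz seminorms and powers of the Laplacian control, become bounds on
  \<open>(1 + \<bar>x\<bar>\<^sup>2)\<^sup>k f x\<close> by this inequality with \<open>a = \<bar>x\<bar>\<^sup>2\<close>.\<close>

lemma one_plus_sq_power_le: "(1 + a) ^ N \<le> 2 ^ N * (1 + a ^ N)" if "0 \<le> a" for a :: real
proof -
  have "(1 + a) ^ N \<le> (2 * max 1 a) ^ N"
    using that by (intro power_mono) auto
  also have "\<dots> = 2 ^ N * (max 1 a) ^ N" by (simp add: power_mult_distrib)
  also have "(max 1 a) ^ N \<le> 1 + a ^ N"
    using that by (auto simp: max_def)
  finally show ?thesis by simp
qed

lemma borel_measurable_cis [measurable]: "cis \<in> borel_measurable borel"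
  by (intro borel_measurable_continuous_onI continuous_intros)

text \<open>The integrand factorizes over the coordinates; each factor is the characteristic function of the
  standard normal distribution, after the substitution \<open>x \<mapsto> x / sqrt (2 s)\<close>.\<close>

lemma gaussian_char_vec:
  fixes w :: "real^'n::finite"
  assumes s: "0 < s"
  shows "integrable lborel (\<lambda>x::real^'n. cis (x \<bullet> w) * exp (- s * (norm x)\<^sup>2))"
    and "(LINT x|lborel. cis ((x::real^'n) \<bullet> w) * complex_of_real (exp (- s * (norm x)\<^sup>2)))
      = complex_of_real (sqrt (pi / s) ^ CARD('n) * exp (- (norm w)\<^sup>2 / (4 * s)))"
proof -
  define r where "r = sqrt (2 * s)"
  have r: "0 < r" "r\<^sup>2 = 2 * s" using s by (auto simp: r_def)
  define f where "f b x = cis (x * b) * complex_of_real (exp (- s * x\<^sup>2))" for b x :: real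
  have nd: "integrable lborel (\<lambda>x. complex_of_real (std_normal_density x) * cis (x * b))" for b
    by (rule Bochner_Integration.integrable_bound[of _ std_normal_density])
       (auto simp: norm_mult)
  have fa: "f b (0 + (1/r) * x) = sqrt (2 * pi) * (complex_of_real (std_normal_density x) * cis (x * (b / r)))" for b x
  proof -
    have "s * ((1 / r) * x)\<^sup>2 = x\<^sup>2 / 2"
      using r s by (simp add: power_mult_distrib power_divide)
    then show ?thesis
      by (simp add: f_def std_normal_density_def)
  qed
  have fi: "integrable lborel (f b)" for b
  proof -
    have "integrable lborel (\<lambda>x. f b (0 + (1/r) * x))"
      unfolding fa using nd by (rule integrable_mult_right)
    then show ?thesis
      using r by (subst (asm) lborel_integrable_real_affine_iff) auto
  qed
  have fI: "(LINT x|lborel. f b x) = complex_of_real (sqrt (pi / s) * exp (- b\<^sup>2 / (4 * s)))" for b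
  proof -
    have "(LINT x|lborel. f b x) = (1/r) *\<^sub>R (LINT x|lborel. f b (0 + (1/r) * x))"
      using lborel_integral_real_affine[of "1/r" "f b" 0] r by simp
    also have "(LINT x|lborel. f b (0 + (1/r) * x)) =
        sqrt (2 * pi) * (LINT x|lborel. complex_of_real (std_normal_density x) * cis (x * (b / r)))"
      unfolding fa by simp
    also have "(LINT x|lborel. complex_of_real (std_normal_density x) * cis (x * (b / r))) = char std_normal_distribution (b / r)"
      unfolding char_def
      by (subst integral_density)
         (auto simp: cis_conv_exp scaleR_conv_of_real mult_ac normal_density_nonneg)
    also have "\<dots> = complex_of_real (exp (- b\<^sup>2 / (4 * s)))"
      using r by (simp add: char_std_normal_distribution power_divide)
    also have "(1/r) *\<^sub>R (complex_of_real (sqrt (2 * pi)) * complex_of_real (exp (- b\<^sup>2 / (4 * s)))) =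
        complex_of_real (sqrt (pi / s) * exp (- b\<^sup>2 / (4 * s)))"
    proof -
      have "sqrt (2 * pi) / r = sqrt (pi / s)"
        using s by (simp add: r_def real_sqrt_divide[symmetric] real_sqrt_mult)
      then have "(1/r) * (sqrt (2 * pi) * exp (- b\<^sup>2 / (4 * s))) = sqrt (pi / s) * exp (- b\<^sup>2 / (4 * s))"
        by (metis mult.assoc mult.commute mult_1 times_divide_eq_left)
      then show ?thesis
        by (metis of_real_mult scaleR_conv_of_real)
    qed
    finally show ?thesis .
  qed
  have prod: "cis (x \<bullet> w) * complex_of_real (exp (- s * (norm x)\<^sup>2)) = (\<Prod>i\<in>UNIV. f (w $ i) (x $ i))" for x
  proof -
    have "cis (x \<bullet> w) = (\<Prod>i\<in>UNIV. cis (x $ i * w $ i))"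
      by (simp add: inner_vec_def cis_conv_exp exp_sum sum_distrib_left)
    moreover have "exp (- s * (norm x)\<^sup>2) = (\<Prod>i\<in>UNIV. exp (- s * (x $ i)\<^sup>2))"
      by (simp add: norm_vec_def L2_set_def sum_nonneg exp_sum sum_distrib_left flip: sum_negf)
    ultimately show ?thesis
      by (simp add: f_def prod.distrib)
  qed
  show "integrable lborel (\<lambda>x::real^'n. cis (x \<bullet> w) * exp (- s * (norm x)\<^sup>2))"
    unfolding prod by (rule integrable_prod_vec) (rule fi)
  have "(\<Prod>i\<in>UNIV. complex_of_real (sqrt (pi / s) * exp (- (w $ i)\<^sup>2 / (4 * s)))) =
     complex_of_real (sqrt (pi / s) ^ CARD('n) * exp (- (norm w)\<^sup>2 / (4 * s)))"
    by (simp add: prod.distrib norm_vec_def L2_set_def sum_nonneg exp_sum sum_divide_distrib flip: sum_negf of_real_prod)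
  then show "(LINT x|lborel. cis ((x::real^'n) \<bullet> w) * complex_of_real (exp (- s * (norm x)\<^sup>2)))
      = complex_of_real (sqrt (pi / s) ^ CARD('n) * exp (- (norm w)\<^sup>2 / (4 * s)))"
    unfolding prod by (subst integral_prod_vec) (auto simp: fi fI)
qed

abbreviation L1_norm :: "('a::euclidean_space \<Rightarrow> complex) \<Rightarrow> real" where
  "L1_norm f \<equiv> LINT x|lborel. norm (f x)"

section \<open>Schwartz functions and their Fourier transform\<close>

lemma partial_deriv_eqI: "(f has_derivative f') (at x) \<Longrightarrow> partial_deriv i f x = f' (axis i 1)"
  unfolding partial_deriv_def by (simp flip: frechet_derivative_at)

lemma partial_deriv_add:
  "f differentiable (at x) \<Longrightarrow> g differentiable (at x) \<Longrightarrow>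
    partial_deriv i (\<lambda>x. f x + g x) x = partial_deriv i f x + partial_deriv i g x"
  unfolding frechet_derivative_works
  by (subst partial_deriv_eqI[OF has_derivative_add]) (auto simp: partial_deriv_def)

lemma schwartz_foldr_differentiable: "schwartz f \<Longrightarrow> foldr partial_deriv is f differentiable (at x)"
  by (auto simp: schwartz_def differentiable_on_def)

lemma schwartz_differentiable: "schwartz f \<Longrightarrow> f differentiable (at x)"
  using schwartz_foldr_differentiable[of f "[]"] by simp

lemma schwartz_partial_deriv: "schwartz f \<Longrightarrow> schwartz (partial_deriv i f)"
  unfolding schwartz_def
proof (rule allI)
  fix "is"
  assume "\<forall>is. foldr partial_deriv is f differentiable_on UNIV \<and>
           (\<forall>k::nat. bounded (range (\<lambda>x. norm x ^ k *\<^sub>R foldr partial_deriv is f x)))"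
  from spec[OF this, of "is @ [i]"]
  show "foldr partial_deriv is (partial_deriv i f) differentiable_on UNIV \<and>
           (\<forall>k::nat. bounded (range (\<lambda>x. norm x ^ k *\<^sub>R foldr partial_deriv is (partial_deriv i f) x)))"
    by simp
qed

lemma foldr_partial_deriv_add:
  "schwartz f \<Longrightarrow> schwartz g \<Longrightarrow> foldr partial_deriv is (\<lambda>x. f x + g x) =
    (\<lambda>x. foldr partial_deriv is f x + foldr partial_deriv is g x)"
  by (induction "is") (auto simp: partial_deriv_add schwartz_foldr_differentiable)

lemma schwartz_add:
  assumes "schwartz f" "schwartz g"
  shows "schwartz (\<lambda>x. f x + g x)"
  unfolding schwartz_def foldr_partial_deriv_add[OF assms]
  using assms by (auto simp: schwartz_def scaleR_add_right intro!: bounded_plus_comp differentiable_on_add)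

lemma partial_deriv_zero: "partial_deriv i (\<lambda>x. 0) = (\<lambda>x. 0)"
  by (rule ext, subst partial_deriv_eqI[OF has_derivative_const]) simp

lemma schwartz_zero: "schwartz (\<lambda>x::real^'n::finite. 0)"
proof -
  have "foldr partial_deriv is (\<lambda>x::real^'n. 0) = (\<lambda>x. 0)" for "is"
    by (induction "is") (auto simp: partial_deriv_zero)
  then show ?thesis unfolding schwartz_def by simp
qed

lemma schwartz_sum: "(\<And>i. i \<in> I \<Longrightarrow> schwartz (f i)) \<Longrightarrow> schwartz (\<lambda>x. \<Sum>i\<in>I. f i x)"
  by (induction I rule: infinite_finite_induct) (auto simp: schwartz_zero schwartz_add)

lemma schwartz_laplacian: "schwartz f \<Longrightarrow> schwartz (laplacian f)"
  unfolding laplacian_def[abs_def] by (intro schwartz_sum schwartz_partial_deriv)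

lemma schwartz_continuous: "schwartz f \<Longrightarrow> continuous_on UNIV f"
  using differentiable_imp_continuous_on[of f UNIV]
  by (auto simp: differentiable_on_def schwartz_differentiable)

lemma schwartz_measurable: "schwartz f \<Longrightarrow> f \<in> borel_measurable borel"
  by (intro borel_measurable_continuous_onI schwartz_continuous)

lemma schwartz_decay:
  assumes "schwartz f"
  obtains C where "\<And>x. (1 + (norm x)\<^sup>2) ^ N * norm (f x) \<le> C"
proof -
  have *: "bounded (range (\<lambda>x. norm x ^ k *\<^sub>R f x))" for k
    using assms unfolding schwartz_def by (metis foldr.simps(1) id_apply)
  obtain A where A: "\<And>x. norm (f x) \<le> A"
    using *[of 0] by (auto simp: bounded_iff)
  obtain B where B: "\<And>x. norm x ^ (2 * N) * norm (f x) \<le> B"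
    using *[of "2 * N"] by (auto simp: bounded_iff)
  have "(1 + (norm x)\<^sup>2) ^ N * norm (f x) \<le> 2 ^ N * (A + B)" for x
  proof -
    have "(1 + (norm x)\<^sup>2) ^ N * norm (f x) \<le> 2 ^ N * (1 + norm x ^ (2 * N)) * norm (f x)"
      using one_plus_sq_power_le[of "(norm x)\<^sup>2" N]
      by (intro mult_right_mono) (auto simp: power_mult)
    also have "\<dots> = 2 ^ N * (norm (f x) + norm x ^ (2 * N) * norm (f x))"
      by (simp add: algebra_simps)
    also have "\<dots> \<le> 2 ^ N * (A + B)"
      by (intro mult_left_mono add_mono A B) simp
    finally show ?thesis .
  qed
  then show thesis by (rule that)
qed

lemma schwartz_bounded:
  assumes "schwartz f"
  obtains C where "\<And>x. norm (f x) \<le> C"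
  using schwartz_decay[OF assms, of 0] by auto

lemma schwartz_integrable: "schwartz f \<Longrightarrow> integrable lborel f"
  using integrable_if_decay[OF schwartz_measurable] schwartz_decay by metis

text \<open>Averaging the fundamental theorem of calculus over all translates: \<open>g (x + e) - g x\<close> has
  integral zero, and it is the mean of \<open>\<partial>\<^sub>e g\<close> along a segment.\<close>

lemma integral_directional_derivative_zero:
  fixes g g' :: "real^'n::finite \<Rightarrow> complex"
  assumes der: "\<And>x t. ((\<lambda>t. g (x + t *\<^sub>R e)) has_vector_derivative g' (x + t *\<^sub>R e)) (at t)"
    and cont: "continuous_on UNIV g'"
    and g: "integrable lborel g" and g': "integrable lborel g'"
  shows "(LINT x|lborel. g' x) = 0"
proof -
  have [measurable]: "g \<in> borel_measurable borel" "g' \<in> borel_measurable borel"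
    using g g' by (auto dest: borel_measurable_integrable)
  have shift: "integrable lborel (\<lambda>x. h (x + t))" "(LINT x|lborel. h (x + t)) = (LINT x|lborel. h x)"
    if "integrable lborel h" for h :: "real^'n \<Rightarrow> complex" and t
  proof -
    have [measurable]: "h \<in> borel_measurable borel" using that by auto
    show "integrable lborel (\<lambda>x. h (x + t))"
      using lborel_affine_integrable_iff[of 1 h t] that by (simp add: add.commute)
    show "(LINT x|lborel. h (x + t)) = (LINT x|lborel. h x)"
      using lborel_affine_integral[of 1 h t] by (simp add: add.commute)
  qed
  have shift_norm: "(LINT x|lborel. norm (g' (x + t))) = (LINT x|lborel. norm (g' x))" for t
    using lborel_affine_integral[of 1 "\<lambda>x. norm (g' x)" t] by (simp add: add.commute)
  define G where "G x t = indicator {0..1::real} t *\<^sub>R g' (x + t *\<^sub>R e)" for x t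
  have G_int: "integrable (lborel \<Otimes>\<^sub>M lborel) (case_prod G)"
  proof -
    have "integrable (lborel \<Otimes>\<^sub>M lborel) (\<lambda>(t, x). G x t)"
    proof (rule lborel_pair.Fubini_integrable)
      have "(LINT x|lborel. norm (G x t)) = indicator {0..1} t * (LINT x|lborel. norm (g' x))" for t
        by (simp add: G_def shift_norm split: split_indicator)
      then show "integrable lborel (\<lambda>t. LINT x|lborel. norm (case (t, x) of (t, x) \<Rightarrow> G x t))"
        by simp
      show "AE t in lborel. integrable lborel (\<lambda>x. case (t, x) of (t, x) \<Rightarrow> G x t)"
        by (rule AE_I2) (simp add: G_def shift(1)[OF g'])
    qed (unfold G_def, measurable)
    then show ?thesis
      using lborel_pair.integrable_product_swap_iff[of "case_prod G"] by (simp add: split_beta')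
  qed
  have FTC: "(LINT t|lborel. G x t) = g (x + e) - g x" for x
  proof -
    have "(LINT t|lborel. indicator {0..1} t *\<^sub>R g' (x + t *\<^sub>R e)) = g (x + 1 *\<^sub>R e) - g (x + 0 *\<^sub>R e)"
    proof (rule integral_FTC_Icc)
      show "continuous_on {0..1} (\<lambda>t. g' (x + t *\<^sub>R e))"
        by (intro continuous_on_compose2[OF cont] continuous_intros) auto
    qed (auto intro: has_vector_derivative_at_within der)
    then show ?thesis by (simp add: G_def)
  qed
  have "0 = (LINT x|lborel. g (x + e) - g x)"
    by (simp add: shift[OF g] g)
  also have "\<dots> = (LINT x|lborel. (LINT t|lborel. G x t))"
    by (simp add: FTC)
  also have "\<dots> = (LINT t|lborel. (LINT x|lborel. G x t))"
    by (rule lborel_pair.Fubini_integral[OF G_int, symmetric])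
  also have "(\<lambda>t. LINT x|lborel. G x t) = (\<lambda>t. indicator {0..1} t *\<^sub>R (LINT x|lborel. g' x))"
    by (auto simp: G_def shift(2)[OF g'])
  also have "(LINT t|lborel. indicator {0..1::real} t *\<^sub>R (LINT x|lborel. g' x)) = (LINT x|lborel. g' x)"
    by simp
  finally show ?thesis ..
qed

lemma fourier_lborel:
  assumes [measurable]: "f \<in> borel_measurable borel"
  shows "fourier f \<xi> = (LINT x|lborel. cis (- (x \<bullet> \<xi>)) * f x)"
  unfolding fourier_def by (rule integral_completion) simp

lemma inverse_fourier_lborel:
  fixes g :: "real^'n::finite \<Rightarrow> complex"
  assumes [measurable]: "g \<in> borel_measurable borel"
  shows "inverse_fourier g x =
    complex_of_real (1 / (2 * pi) ^ CARD('n)) * (LINT \<xi>|lborel. cis (x \<bullet> \<xi>) * g \<xi>)"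
  unfolding inverse_fourier_def by (subst integral_completion) simp_all

lemma integrable_cis_mult:
  fixes f :: "real^'n::finite \<Rightarrow> complex"
  assumes "integrable lborel f" and [measurable]: "h \<in> borel_measurable borel"
  shows "integrable lborel (\<lambda>x. cis (h x) * f x)"
  by (rule Bochner_Integration.integrable_bound[OF assms(1)])
     (use assms(1) in \<open>auto simp: norm_mult\<close>)

lemma fourier_measurable [measurable]:
  assumes [measurable]: "f \<in> borel_measurable borel"
  shows "fourier f \<in> borel_measurable borel"
  unfolding fourier_lborel[OF assms, abs_def] by measurable

lemma norm_fourier_le:
  assumes "integrable lborel f"
  shows "norm (fourier f \<xi>) \<le> L1_norm f"
proof -
  have [measurable]: "f \<in> borel_measurable borel" using assms by auto
  have "norm (fourier f \<xi>) \<le> (LINT x|lborel. norm (cis (- (x \<bullet> \<xi>)) * f x))"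
    by (simp add: fourier_lborel integral_norm_bound)
  then show ?thesis by (simp add: norm_mult)
qed

text \<open>Integration by parts: the difference of the two sides is the integral of the directional derivative
  of \<open>cis (- (x \<bullet> \<xi>)) * f x\<close>.\<close>

lemma fourier_partial_deriv:
  assumes f: "schwartz f"
  shows "fourier (partial_deriv i f) \<xi> = \<i> * complex_of_real (\<xi> $ i) * fourier f \<xi>"
proof -
  note f' = schwartz_partial_deriv[OF f, of i]
  note [measurable] = schwartz_measurable[OF f] schwartz_measurable[OF f']
  define g' where "g' x = cis (- (x \<bullet> \<xi>)) * partial_deriv i f x - \<i> * (\<xi> $ i) * (cis (- (x \<bullet> \<xi>)) * f x)" for x
  have i1: "integrable lborel (\<lambda>x. cis (- (x \<bullet> \<xi>)) * f x)"
    and i2: "integrable lborel (\<lambda>x. cis (- (x \<bullet> \<xi>)) * partial_deriv i f x)"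
    by (intro integrable_cis_mult schwartz_integrable f f'; measurable)+
  have "(LINT x|lborel. g' x) = 0"
  proof (rule integral_directional_derivative_zero[where e="axis i 1"])
    show "integrable lborel (\<lambda>x. cis (- (x \<bullet> \<xi>)) * f x)" by (rule i1)
    show "integrable lborel g'"
      unfolding g'_def by (intro Bochner_Integration.integrable_diff integrable_mult_right i1 i2)
    show "continuous_on UNIV g'"
      unfolding g'_def by (intro continuous_intros schwartz_continuous f f')
    fix x :: "real^'a" and t :: real
    have "(f has_derivative frechet_derivative f (at (x + t *\<^sub>R axis i 1))) (at (x + t *\<^sub>R axis i 1))"
      using schwartz_differentiable[OF f] unfolding frechet_derivative_works .
    then have 1: "((\<lambda>t. f (x + t *\<^sub>R axis i 1)) has_derivative
        (\<lambda>h. frechet_derivative f (at (x + t *\<^sub>R axis i 1)) (h *\<^sub>R axis i 1))) (at t)"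
      by (rule has_derivative_compose[rotated]) (auto intro!: derivative_eq_intros)
    have lin: "linear (frechet_derivative f (at (x + t *\<^sub>R axis i 1)))"
      by (rule linear_frechet_derivative[OF schwartz_differentiable[OF f]])
    have 2: "((\<lambda>t. f (x + t *\<^sub>R axis i 1)) has_vector_derivative
        partial_deriv i f (x + t *\<^sub>R axis i 1)) (at t)"
      unfolding has_vector_derivative_def
      by (rule has_derivative_eq_rhs[OF 1]) (auto simp: partial_deriv_def linear_scale[OF lin])
    have ip: "(x + t *\<^sub>R axis i 1) \<bullet> \<xi> = x \<bullet> \<xi> + t * \<xi> $ i" for t
      by (simp add: inner_add_left inner_axis')
    have 3: "((\<lambda>t. cis (- ((x + t *\<^sub>R axis i 1) \<bullet> \<xi>))) has_vector_derivative
       - \<i> * (\<xi> $ i) * cis (- ((x + t *\<^sub>R axis i 1) \<bullet> \<xi>))) (at t)"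
      unfolding has_vector_derivative_def ip
      by (auto intro!: derivative_eq_intros simp: scaleR_conv_of_real algebra_simps)
    show "((\<lambda>t. cis (- ((x + t *\<^sub>R axis i 1) \<bullet> \<xi>)) * f (x + t *\<^sub>R axis i 1)) has_vector_derivative
       g' (x + t *\<^sub>R axis i 1)) (at t)"
      using has_vector_derivative_mult[OF 3 2] by (simp add: g'_def algebra_simps)
  qed
  then show ?thesis
    unfolding g'_def using i1 i2 by (simp add: fourier_lborel)
qed

lemma fourier_sum:
  assumes "\<And>i. i \<in> I \<Longrightarrow> integrable lborel (f i)"
  shows "fourier (\<lambda>x. \<Sum>i\<in>I. f i x) \<xi> = (\<Sum>i\<in>I. fourier (f i) \<xi>)"
proof -
  have [measurable]: "\<And>i. i \<in> I \<Longrightarrow> f i \<in> borel_measurable borel" using assms by auto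
  have "fourier (\<lambda>x. \<Sum>i\<in>I. f i x) \<xi> = (LINT x|lborel. (\<Sum>i\<in>I. cis (- (x \<bullet> \<xi>)) * f i x))"
    by (subst fourier_lborel) (auto simp: sum_distrib_left)
  also have "\<dots> = (\<Sum>i\<in>I. (LINT x|lborel. cis (- (x \<bullet> \<xi>)) * f i x))"
    by (intro Bochner_Integration.integral_sum integrable_cis_mult assms) auto
  finally show ?thesis by (simp add: fourier_lborel)
qed

lemma fourier_laplacian:
  assumes f: "schwartz f"
  shows "fourier (laplacian f) \<xi> = - complex_of_real ((norm \<xi>)\<^sup>2) * fourier f \<xi>"
proof -
  have "fourier (laplacian f) \<xi> = (\<Sum>i\<in>UNIV. \<i> * (\<xi> $ i) * (\<i> * (\<xi> $ i) * fourier f \<xi>))"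
    unfolding laplacian_def[abs_def]
    by (subst fourier_sum) (auto intro!: schwartz_integrable schwartz_partial_deriv f simp: fourier_partial_deriv f schwartz_partial_deriv)
  also have "\<dots> = - (\<Sum>i\<in>UNIV. complex_of_real ((\<xi> $ i)\<^sup>2)) * fourier f \<xi>"
  proof -
    have "\<i> * (\<xi> $ i) * (\<i> * (\<xi> $ i) * fourier f \<xi>) = - (complex_of_real ((\<xi> $ i)\<^sup>2) * fourier f \<xi>)" for i
      by (simp add: complex_eq_iff power2_eq_square)
    then show ?thesis by (simp add: sum_distrib_right sum_negf)
  qed
  also have "(\<Sum>i\<in>UNIV. complex_of_real ((\<xi> $ i)\<^sup>2)) = complex_of_real ((norm \<xi>)\<^sup>2)"
    by (simp add: norm_vec_def L2_set_def sum_nonneg)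
  finally show ?thesis .
qed

text \<open>Up to sign, \<open>\<bar>\<xi>\<bar>\<^sup>2\<^sup>k\<close> times the transform of \<open>f\<close> is the transform of \<open>\<Delta>\<^sup>k f\<close>, hence bounded by
  the \<open>L\<^sup>1\<close> norm of \<open>\<Delta>\<^sup>k f\<close>.\<close>

lemma fourier_decay:
  fixes f :: "real^'n::finite \<Rightarrow> complex"
  assumes f: "schwartz f"
  obtains C where "\<And>\<xi>. (1 + (norm \<xi>)\<^sup>2) ^ N * norm (fourier f \<xi>) \<le> C"
proof -
  have S: "schwartz ((laplacian ^^ k) f)" for k
    by (induction k) (auto intro: f schwartz_laplacian)
  have F: "norm (fourier ((laplacian ^^ k) f) \<xi>) = norm \<xi> ^ (2 * k) * norm (fourier f \<xi>)" for k \<xi>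
    by (induction k) (auto simp: fourier_laplacian S norm_mult norm_power power2_eq_square)
  define A where "A k = L1_norm ((laplacian ^^ k) f)" for k
  have A: "norm \<xi> ^ (2 * k) * norm (fourier f \<xi>) \<le> A k" for k \<xi>
    unfolding A_def F[symmetric] by (rule norm_fourier_le[OF schwartz_integrable[OF S]])
  have "(1 + (norm \<xi>)\<^sup>2) ^ N * norm (fourier f \<xi>) \<le> 2 ^ N * (A 0 + A N)" for \<xi>
  proof -
    have "(1 + (norm \<xi>)\<^sup>2) ^ N * norm (fourier f \<xi>) \<le> 2 ^ N * (1 + norm \<xi> ^ (2 * N)) * norm (fourier f \<xi>)"
      using one_plus_sq_power_le[of "(norm \<xi>)\<^sup>2" N]
      by (intro mult_right_mono) (auto simp: power_mult)
    also have "\<dots> = 2 ^ N * (norm (fourier f \<xi>) + norm \<xi> ^ (2 * N) * norm (fourier f \<xi>))"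
      by (simp add: algebra_simps)
    also have "\<dots> \<le> 2 ^ N * (A 0 + A N)"
      using A[of \<xi> 0] A[of \<xi> N] by (intro mult_left_mono add_mono) auto
    finally show ?thesis .
  qed
  then show thesis by (rule that)
qed

text \<open>The weight \<open>1 + \<bar>\<xi>\<bar>\<^sup>2\<close> dominates the growth of every complete Bernstein symbol \<open>\<psi> (\<bar>\<xi>\<bar>\<^sup>2)\<close> and also
  the derivative in \<open>s\<close> of \<open>exp (- s\<bar>\<xi>\<bar>\<^sup>2)\<close>.\<close>

lemma integrable_fourier:
  fixes f :: "real^'n::finite \<Rightarrow> complex"
  assumes f: "schwartz f"
  shows "integrable lborel (\<lambda>\<xi>. (1 + (norm \<xi>)\<^sup>2) * norm (fourier f \<xi>))"
    and "integrable lborel (fourier f)"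
proof -
  note [measurable] = schwartz_measurable[OF f]
  obtain C where C: "\<And>\<xi>. (1 + (norm \<xi>)\<^sup>2) ^ Suc CARD('n) * norm (fourier f \<xi>) \<le> C"
    using fourier_decay[OF f] by blast
  show 1: "integrable lborel (\<lambda>\<xi>. (1 + (norm \<xi>)\<^sup>2) * norm (fourier f \<xi>))"
  proof (rule integrable_if_decay)
    show "(1 + (norm \<xi>)\<^sup>2) ^ CARD('n) * norm ((1 + (norm \<xi>)\<^sup>2) * norm (fourier f \<xi>)) \<le> C" for \<xi>
      using C[of \<xi>] by (simp add: abs_mult mult_ac)
  qed measurable
  have "1 * norm (fourier f \<xi>) \<le> (1 + (norm \<xi>)\<^sup>2) * norm (fourier f \<xi>)" for \<xi>
    by (intro mult_right_mono) auto
  then show "integrable lborel (fourier f)"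
    by (intro Bochner_Integration.integrable_bound[OF 1]) (auto simp: abs_mult intro!: AE_I2)
qed

section \<open>The heat semigroup\<close>

text \<open>The semigroup \<open>exp (s \<Delta>)\<close> as a multiplier operator. For \<open>s = 0\<close> it is the Fourier transform followed
  by its inverse, so Fourier inversion reads \<open>heat 0 \<phi> = \<phi>\<close>.\<close>

definition heat :: "real \<Rightarrow> (real^'n::finite \<Rightarrow> complex) \<Rightarrow> real^'n \<Rightarrow> complex" where
  "heat s = psi_laplacian (\<lambda>r. exp (- s * r))"

text \<open>This is \<open>(4 \<pi> t)\<close> to the power \<open>- n/2\<close> times \<open>exp (- \<bar>w\<bar>\<^sup>2 / (4 t))\<close>, with the constant split as it comes
  out of the inverse Fourier transform of \<open>exp (- t\<bar>\<xi>\<bar>\<^sup>2)\<close>.\<close>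

definition heat_kernel :: "real \<Rightarrow> real^'n::finite \<Rightarrow> real" where
  "heat_kernel t w = 1 / (2 * pi) ^ CARD('n) * (sqrt (pi / t) ^ CARD('n) * exp (- (norm w)\<^sup>2 / (4 * t)))"

lemma heat_lborel:
  fixes \<phi> :: "real^'n::finite \<Rightarrow> complex"
  assumes [measurable]: "\<phi> \<in> borel_measurable borel"
  shows "heat s \<phi> x = complex_of_real (1 / (2 * pi) ^ CARD('n)) *
    (LINT \<xi>|lborel. cis (x \<bullet> \<xi>) * (complex_of_real (exp (- s * (norm \<xi>)\<^sup>2)) * fourier \<phi> \<xi>))"
  unfolding heat_def psi_laplacian_def by (subst inverse_fourier_lborel) simp_all

lemma heat_measurable [measurable]:
  fixes \<phi> :: "real^'n::finite \<Rightarrow> complex"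
  assumes [measurable]: "\<phi> \<in> borel_measurable borel" "f \<in> borel_measurable M" "g \<in> borel_measurable M"
  shows "(\<lambda>z. heat (f z) \<phi> (g z)) \<in> borel_measurable M"
  unfolding heat_lborel[OF assms(1)] by measurable

lemma heat_kernel_measurable [measurable]:
  "(heat_kernel t :: real^'n::finite \<Rightarrow> real) \<in> borel_measurable borel"
  unfolding heat_kernel_def[abs_def] by measurable

lemma heat_kernel_nonneg: "0 \<le> t \<Longrightarrow> 0 \<le> heat_kernel t w"
  by (auto simp: heat_kernel_def)

lemma integrable_gaussian:
  "0 < s \<Longrightarrow> integrable lborel (\<lambda>x::real^'n::finite. exp (- s * (norm x)\<^sup>2))"
  using gaussian_char_vec(1)[of s 0, THEN integrable_Re] by simp

lemma heat_kernel_fourier: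
  fixes w :: "real^'n::finite"
  assumes "0 < t"
  shows "complex_of_real (heat_kernel t w) = complex_of_real (1 / (2 * pi) ^ CARD('n)) *
    (LINT \<xi>|lborel. cis (\<xi> \<bullet> w) * complex_of_real (exp (- t * (norm \<xi>)\<^sup>2)))"
  using gaussian_char_vec(2)[OF assms, of w] by (simp add: heat_kernel_def)

lemma heat_kernel_constant:
  assumes t: "0 < t"
  shows "1 / (2 * pi) * sqrt (pi / t) * sqrt (pi / (1 / (4 * t))) = 1"
proof -
  have "sqrt (pi / t) * sqrt (pi / (1 / (4 * t))) = sqrt ((2 * pi)\<^sup>2)"
    unfolding real_sqrt_mult[symmetric] using t by (simp add: power2_eq_square)
  also have "\<dots> = 2 * pi" by (rule real_sqrt_abs[THEN trans]) simp
  finally show ?thesis by (simp add: mult.assoc)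
qed

lemma
  assumes t: "0 < t"
  shows heat_kernel_integrable: "integrable lborel (heat_kernel t :: real^'n::finite \<Rightarrow> real)"
    and heat_kernel_integral: "(LINT w|lborel. heat_kernel t (w :: real^'n)) = 1"
proof -
  have eq: "heat_kernel t w =
      (1 / (2 * pi) ^ CARD('n) * sqrt (pi / t) ^ CARD('n)) * exp (- (1 / (4 * t)) * (norm w)\<^sup>2)" for w :: "real^'n"
    by (simp add: heat_kernel_def)
  show "integrable lborel (heat_kernel t :: real^'n \<Rightarrow> real)"
    unfolding eq using integrable_gaussian[of "1 / (4 * t)", where 'n='n] t by simp
  have "complex_of_real (LINT w|lborel. exp (- (1 / (4 * t)) * (norm (w::real^'n))\<^sup>2)) =
      complex_of_real (sqrt (pi / (1 / (4 * t))) ^ CARD('n))"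
    using gaussian_char_vec(2)[of "1 / (4 * t)" "0::real^'n"] t by (simp flip: integral_complex_of_real)
  then have "(LINT w|lborel. heat_kernel t (w :: real^'n)) =
     (1 / (2 * pi) * sqrt (pi / t) * sqrt (pi / (1 / (4 * t)))) ^ CARD('n)"
    unfolding eq of_real_eq_iff by (simp add: power_mult_distrib power_divide)
  also have "\<dots> = 1" by (simp only: heat_kernel_constant[OF t] power_one)
  finally show "(LINT w|lborel. heat_kernel t (w :: real^'n)) = 1" by simp
qed

lemma heat_kernel_shift:
  fixes x :: "real^'n::finite"
  assumes t: "0 < t"
  shows "integrable lborel (\<lambda>y. heat_kernel t (y - x))" "(LINT y|lborel. heat_kernel t (y - x)) = 1"
  using lborel_affine_integrable_iff[of 1 "heat_kernel t" "-x"]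
    lborel_affine_integral[of 1 "heat_kernel t" "-x"] heat_kernel_integrable[OF t, where 'n='n]
    heat_kernel_integral[OF t, where 'n='n]
  by (simp_all add: add.commute)

text \<open>Fubini's theorem: the Gaussian factor makes the double integral in \<open>\<xi>\<close> and \<open>y\<close> absolutely convergent
  for \<open>s > 0\<close>, and the \<open>\<xi>\<close>-integral is the kernel.\<close>

lemma heat_eq_convolution:
  fixes \<phi> :: "real^'n::finite \<Rightarrow> complex"
  assumes \<phi>: "integrable lborel \<phi>" and s: "0 < s"
  shows "heat s \<phi> x = (LINT y|lborel. complex_of_real (heat_kernel s (x - y)) * \<phi> y)"
proof -
  have [measurable]: "\<phi> \<in> borel_measurable borel" using \<phi> by auto
  define c where "c = complex_of_real (1 / (2 * pi) ^ CARD('n))"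
  define h where "h \<xi> y = c * (cis (\<xi> \<bullet> (x - y)) * complex_of_real (exp (- s * (norm \<xi>)\<^sup>2)) * \<phi> y)" for \<xi> y
  have h_eq: "h \<xi> y = c * (cis (x \<bullet> \<xi>) * (complex_of_real (exp (- s * (norm \<xi>)\<^sup>2)) * (cis (- (y \<bullet> \<xi>)) * \<phi> y)))" for \<xi> y
  proof -
    have "cis (\<xi> \<bullet> (x - y)) = cis (x \<bullet> \<xi>) * cis (- (y \<bullet> \<xi>))"
      by (simp add: cis_mult inner_diff_right inner_commute)
    then show ?thesis by (simp add: h_def)
  qed
  have h_int: "integrable (lborel \<Otimes>\<^sub>M lborel) (case_prod h)"
  proof (rule integrable_if_product_majorant[OF _ integrable_gaussian[OF s]])
    show "integrable lborel (\<lambda>y. norm c * norm (\<phi> y))" using \<phi> by simp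
  qed (unfold h_def, measurable, simp add: norm_mult)
  have "heat s \<phi> x = (LINT \<xi>|lborel. (LINT y|lborel. h \<xi> y))"
    by (simp add: heat_lborel fourier_lborel h_eq c_def)
  also have "\<dots> = (LINT y|lborel. (LINT \<xi>|lborel. h \<xi> y))"
    by (rule lborel_pair.Fubini_integral[OF h_int, symmetric])
  also have "(\<lambda>y. LINT \<xi>|lborel. h \<xi> y) = (\<lambda>y. complex_of_real (heat_kernel s (x - y)) * \<phi> y)"
    unfolding h_def heat_kernel_fourier[OF s] c_def by (simp add: mult_ac)
  finally show ?thesis .
qed

text \<open>Let \<open>s \<rightarrow> 0\<close> in both descriptions of \<open>heat s \<phi> x\<close>. The multiplier form tends to \<open>heat 0 \<phi> x\<close>, and the
  convolution with the approximate identity \<open>heat_kernel s\<close> tends to \<open>\<phi> x\<close>.\<close>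

lemma fourier_inversion:
  fixes \<phi> :: "real^'n::finite \<Rightarrow> complex"
  assumes \<phi>: "schwartz \<phi>"
  shows "heat 0 \<phi> x = \<phi> x"
proof -
  note [measurable] = schwartz_measurable[OF \<phi>]
  obtain C where C: "\<And>x. norm (\<phi> x) \<le> C" using schwartz_bounded[OF \<phi>] by blast
  define s where "s k = 1 / real (Suc k)" for k
  have s: "0 < s k" for k by (simp add: s_def)
  have s0: "s \<longlonglongrightarrow> 0"
    unfolding s_def[abs_def] using LIMSEQ_inverse_real_of_nat by (simp add: inverse_eq_divide)
  have L1: "(\<lambda>k. heat (s k) \<phi> x) \<longlonglongrightarrow> heat 0 \<phi> x"
    unfolding heat_lborel[OF schwartz_measurable[OF \<phi>]]
  proof (intro tendsto_mult_left integral_dominated_convergence)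
    show "integrable lborel (\<lambda>\<xi>. norm (fourier \<phi> \<xi>))"
      using integrable_fourier(2)[OF \<phi>] by simp
    show "AE \<xi> in lborel. (\<lambda>k. cis (x \<bullet> \<xi>) * (complex_of_real (exp (- s k * (norm \<xi>)\<^sup>2)) * fourier \<phi> \<xi>))
        \<longlonglongrightarrow> cis (x \<bullet> \<xi>) * (complex_of_real (exp (- 0 * (norm \<xi>)\<^sup>2)) * fourier \<phi> \<xi>)"
      by (intro AE_I2 tendsto_intros s0)
    show "AE \<xi> in lborel. norm (cis (x \<bullet> \<xi>) * (complex_of_real (exp (- s k * (norm \<xi>)\<^sup>2)) * fourier \<phi> \<xi>))
        \<le> norm (fourier \<phi> \<xi>)" for k
      using s[of k] by (auto simp: norm_mult intro!: mult_left_le_one_le)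
  qed measurable
  have E: "heat (s k) \<phi> x = (LINT z|lborel. complex_of_real (heat_kernel 1 z) * \<phi> (x - sqrt (s k) *\<^sub>R z))" for k
  proof -
    \<comment> \<open>The substitution \<open>y = x - sqrt s z\<close> turns all kernels into the one at time \<open>1\<close>.\<close>
    have K: "sqrt (s k) ^ CARD('n) * heat_kernel (s k) (sqrt (s k) *\<^sub>R z) = heat_kernel 1 z" for z :: "real^'n"
    proof -
      have 1: "(norm (sqrt (s k) *\<^sub>R z))\<^sup>2 / (4 * s k) = (norm z)\<^sup>2 / 4"
        using s[of k] by (simp add: power_mult_distrib)
      have 2: "sqrt (s k) ^ CARD('n) * sqrt (pi / s k) ^ CARD('n) = sqrt pi ^ CARD('n)"
        unfolding power_mult_distrib[symmetric] real_sqrt_mult[symmetric] using s[of k] by simp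
      show ?thesis
      proof -
        have "- (norm (sqrt (s k) *\<^sub>R z))\<^sup>2 / (4 * s k) = - (norm z)\<^sup>2 / (4 * 1)"
          using 1 by simp
        then have e: "exp (- (norm (sqrt (s k) *\<^sub>R z))\<^sup>2 / (4 * s k)) = exp (- (norm z)\<^sup>2 / (4 * 1))"
          by (simp only:)
        have A: "S * (c * (P * e)) = c * ((S * P) * e)" for S c P e :: real
          by simp
        show ?thesis
          unfolding heat_kernel_def e by (subst A) (simp only: 2 div_by_1)
      qed
    qed
    have "heat (s k) \<phi> x = (LINT y|lborel. complex_of_real (heat_kernel (s k) (x - y)) * \<phi> y)"
      by (rule heat_eq_convolution[OF schwartz_integrable[OF \<phi>] s])
    also have "\<dots> = \<bar>- sqrt (s k)\<bar> ^ DIM(real^'n) *\<^sub>R (LINT z|lborel. complex_of_real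
        (heat_kernel (s k) (x - (x + (- sqrt (s k)) *\<^sub>R z))) * \<phi> (x + (- sqrt (s k)) *\<^sub>R z))"
      using s[of k] by (intro lborel_affine_integral) auto
    also have "\<dots> = (LINT z|lborel. complex_of_real (sqrt (s k) ^ CARD('n) * heat_kernel (s k) (sqrt (s k) *\<^sub>R z))
         * \<phi> (x - sqrt (s k) *\<^sub>R z))"
      using s[of k] by (simp add: scaleR_conv_of_real mult.assoc)
    also have "\<dots> = (LINT z|lborel. complex_of_real (heat_kernel 1 z) * \<phi> (x - sqrt (s k) *\<^sub>R z))"
      by (simp only: K)
    finally show ?thesis .
  qed
  have L2: "(\<lambda>k. LINT z|lborel. complex_of_real (heat_kernel 1 z) * \<phi> (x - sqrt (s k) *\<^sub>R z))
      \<longlonglongrightarrow> (LINT z|lborel. complex_of_real (heat_kernel 1 (z :: real^'n)) * \<phi> x)"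
  proof (rule integral_dominated_convergence)
    show "integrable lborel (\<lambda>z::real^'n. heat_kernel 1 z * C)"
      using heat_kernel_integrable[of 1, where 'n='n] by simp
    have "isCont \<phi> x" using schwartz_continuous[OF \<phi>] by (simp add: continuous_on_eq_continuous_at)
    moreover have "(\<lambda>k. x - sqrt (s k) *\<^sub>R z) \<longlonglongrightarrow> x - sqrt 0 *\<^sub>R z" for z :: "real^'n"
      by (intro tendsto_intros s0)
    ultimately have "(\<lambda>k. \<phi> (x - sqrt (s k) *\<^sub>R z)) \<longlonglongrightarrow> \<phi> x" for z :: "real^'n"
      using isCont_tendsto_compose[of x \<phi> "\<lambda>k. x - sqrt (s k) *\<^sub>R z"] by simp
    then show "AE z in lborel. (\<lambda>k. complex_of_real (heat_kernel 1 z) * \<phi> (x - sqrt (s k) *\<^sub>R z))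
      \<longlonglongrightarrow> complex_of_real (heat_kernel 1 z) * \<phi> x"
      by (intro AE_I2 tendsto_mult_left)
    show "AE z in lborel. norm (complex_of_real (heat_kernel 1 z) * \<phi> (x - sqrt (s k) *\<^sub>R z)) \<le> heat_kernel 1 z * C" for k
      using C by (auto simp: norm_mult heat_kernel_nonneg intro!: mult_left_mono)
  qed measurable
  have V: "(LINT z|lborel. complex_of_real (heat_kernel 1 (z :: real^'n)) * \<phi> x) = \<phi> x"
    using heat_kernel_integrable[of 1, where 'n='n] heat_kernel_integral[of 1, where 'n='n] by simp
  show ?thesis
    using L1 L2 unfolding V E by (rule LIMSEQ_unique)
qed

text \<open>The heat kernel is non-negative with total mass one.\<close>

lemma heat_L1_contraction:
  fixes \<phi> :: "real^'n::finite \<Rightarrow> complex"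
  assumes \<phi>: "schwartz \<phi>" and s: "0 \<le> s"
  shows "integrable lborel (heat s \<phi>)"
    and "L1_norm (heat s \<phi>) \<le> L1_norm \<phi>"
proof -
  have "integrable lborel (heat s \<phi>) \<and> L1_norm (heat s \<phi>) \<le> L1_norm \<phi>"
  proof (cases "s = 0")
    case True
    then have "heat s \<phi> = \<phi>" by (auto simp: fourier_inversion[OF \<phi>])
    then show ?thesis by (simp add: schwartz_integrable[OF \<phi>])
  next
    case False
    then have s: "0 < s" using s by simp
    note [measurable] = schwartz_measurable[OF \<phi>]
    define h where "h y x = complex_of_real (heat_kernel s (x - y)) * \<phi> y" for x y
    have k: "(LINT x|lborel. norm (h y x)) = norm (\<phi> y)" for y
      using heat_kernel_shift[OF s, of y] by (simp add: h_def norm_mult heat_kernel_nonneg s less_imp_le)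
    have h_int: "integrable (lborel \<Otimes>\<^sub>M lborel) (case_prod h)"
    proof (rule lborel_pair.Fubini_integrable)
      show "integrable lborel (\<lambda>y. LINT x|lborel. norm (case (y, x) of (y, x) \<Rightarrow> h y x))"
        using schwartz_integrable[OF \<phi>] by (simp add: k)
      show "AE y in lborel. integrable lborel (\<lambda>x. case (y, x) of (y, x) \<Rightarrow> h y x)"
        using heat_kernel_shift(1)[OF s]
        by (auto simp: h_def intro!: AE_I2 integrable_mult_left integrable_of_real)
    qed (unfold h_def, measurable)
    have eq: "heat s \<phi> x = (LINT y|lborel. h y x)" for x
      by (simp add: heat_eq_convolution[OF schwartz_integrable[OF \<phi>] s] h_def)
    have "integrable lborel (\<lambda>x. LINT y|lborel. h y x)"
      by (rule lborel_pair.integrable_snd[OF h_int])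
    moreover have "(LINT x|lborel. norm (LINT y|lborel. h y x)) \<le> (LINT x|lborel. (LINT y|lborel. norm (h y x)))"
    proof (rule integral_mono)
      show "integrable lborel (\<lambda>x. norm (LINT y|lborel. h y x))"
        using lborel_pair.integrable_snd[OF h_int] by simp
      show "integrable lborel (\<lambda>x. LINT y|lborel. norm (h y x))"
        using integrable_norm[OF h_int] by (intro lborel_pair.integrable_snd) (simp add: split_beta')
    qed (rule integral_norm_bound)
    moreover have "(LINT x|lborel. (LINT y|lborel. norm (h y x))) = (LINT y|lborel. (LINT x|lborel. norm (h y x)))"
      using integrable_norm[OF h_int] by (intro lborel_pair.Fubini_integral) (simp add: split_beta')
    ultimately show ?thesis
      by (simp add: eq[abs_def] k)
  qed
  then show "integrable lborel (heat s \<phi>)"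
    and "L1_norm (heat s \<phi>) \<le> L1_norm \<phi>" by auto
qed

text \<open>The heat equation \<open>\<partial>\<^sub>q P\<^sub>q \<phi> = P\<^sub>q \<Delta>\<phi>\<close> in integrated form. On the Fourier side it is the fundamental theorem of
  calculus for \<open>q \<mapsto> exp (- q\<bar>\<xi>\<bar>\<^sup>2)\<close>, with Fubini's theorem to integrate in \<open>\<xi>\<close>.\<close>

lemma heat_diff_eq_integral:
  fixes \<phi> :: "real^'n::finite \<Rightarrow> complex"
  assumes \<phi>: "schwartz \<phi>" and rs: "0 \<le> r" "r \<le> s"
  shows "heat s \<phi> x - heat r \<phi> x = (LINT q|lborel. indicator {r..s} q *\<^sub>R heat q (laplacian \<phi>) x)"
proof -
  note [measurable] = schwartz_measurable[OF \<phi>] schwartz_measurable[OF schwartz_laplacian[OF \<phi>]]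
  define c where "c = complex_of_real (1 / (2 * pi) ^ CARD('n))"
  define h where "h q \<xi> = (indicator {r..s} q *\<^sub>R (- (norm \<xi>)\<^sup>2 * exp (- q * (norm \<xi>)\<^sup>2))) *\<^sub>R (c * (cis (x \<bullet> \<xi>) * fourier \<phi> \<xi>))"
    for q and \<xi> :: "real^'n"
  have h_int: "integrable (lborel \<Otimes>\<^sub>M lborel) (case_prod h)"
  proof (rule integrable_if_product_majorant)
    show "case_prod h \<in> borel_measurable (lborel \<Otimes>\<^sub>M lborel)"
      unfolding h_def by measurable
    show "integrable lborel (indicator {r..s} :: real \<Rightarrow> real)"
      by (intro integrable_real_indicator) (auto simp: rs)
    show "integrable lborel (\<lambda>\<xi>. norm c * ((1 + (norm \<xi>)\<^sup>2) * norm (fourier \<phi> \<xi>)))"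
      by (rule integrable_mult_right[OF integrable_fourier(1)[OF \<phi>]])
    show "norm (h q \<xi>) \<le> indicator {r..s} q * (norm c * ((1 + (norm \<xi>)\<^sup>2) * norm (fourier \<phi> \<xi>)))" for q \<xi>
    proof (cases "q \<in> {r..s}")
      case True
      then have "exp (- q * (norm \<xi>)\<^sup>2) \<le> 1" using rs by simp
      then have "(norm \<xi>)\<^sup>2 * exp (- q * (norm \<xi>)\<^sup>2) \<le> (norm \<xi>)\<^sup>2 * 1"
        by (rule mult_left_mono) simp
      then have "norm c * ((norm \<xi>)\<^sup>2 * exp (- q * (norm \<xi>)\<^sup>2) * norm (fourier \<phi> \<xi>))
          \<le> norm c * ((1 + (norm \<xi>)\<^sup>2) * norm (fourier \<phi> \<xi>))"
        by (intro mult_left_mono mult_right_mono) auto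
      then show ?thesis using True by (simp add: h_def norm_mult abs_mult mult_ac)
    qed (simp add: h_def)
  qed
  have I: "integrable lborel (\<lambda>\<xi>. cis (x \<bullet> \<xi>) * (complex_of_real (exp (- t * (norm \<xi>)\<^sup>2)) * fourier \<phi> \<xi>))"
    if "0 \<le> t" for t
    by (rule Bochner_Integration.integrable_bound[OF integrable_fourier(2)[OF \<phi>]])
       (use that in \<open>auto simp: norm_mult intro!: mult_left_le_one_le\<close>)
  have FTC: "(LINT q|lborel. indicator {r..s} q *\<^sub>R (- (norm \<xi>)\<^sup>2 * exp (- q * (norm \<xi>)\<^sup>2))) =
      exp (- s * (norm \<xi>)\<^sup>2) - exp (- r * (norm \<xi>)\<^sup>2)" for \<xi> :: "real^'n"
  proof (rule integral_FTC_Icc)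
    fix q
    show "((\<lambda>q. exp (- q * (norm \<xi>)\<^sup>2)) has_vector_derivative - (norm \<xi>)\<^sup>2 * exp (- q * (norm \<xi>)\<^sup>2)) (at q within {r..s})"
      unfolding has_real_derivative_iff_has_vector_derivative[symmetric]
      by (auto intro!: derivative_eq_intros)
    show "continuous_on {r..s} (\<lambda>q. - (norm \<xi>)\<^sup>2 * exp (- q * (norm \<xi>)\<^sup>2))"
      by (intro continuous_intros)
  qed (use rs in auto)
  have "(LINT q|lborel. indicator {r..s} q *\<^sub>R heat q (laplacian \<phi>) x) = (LINT q|lborel. (LINT \<xi>|lborel. h q \<xi>))"
  proof (rule Bochner_Integration.integral_cong[OF refl])
    fix q
    have "indicator {r..s} q *\<^sub>R heat q (laplacian \<phi>) x =
       (LINT \<xi>|lborel. indicator {r..s} q *\<^sub>R (c * (cis (x \<bullet> \<xi>) * (complex_of_real (exp (- q * (norm \<xi>)\<^sup>2)) *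
        (- complex_of_real ((norm \<xi>)\<^sup>2) * fourier \<phi> \<xi>)))))"
      unfolding heat_lborel[OF schwartz_measurable[OF schwartz_laplacian[OF \<phi>]]] fourier_laplacian[OF \<phi>] c_def
      by simp
    also have "(\<lambda>\<xi>. indicator {r..s} q *\<^sub>R (c * (cis (x \<bullet> \<xi>) * (complex_of_real (exp (- q * (norm \<xi>)\<^sup>2)) *
        (- complex_of_real ((norm \<xi>)\<^sup>2) * fourier \<phi> \<xi>))))) = h q"
      by (auto simp: h_def scaleR_conv_of_real mult_ac)
    finally show "indicator {r..s} q *\<^sub>R heat q (laplacian \<phi>) x = (LINT \<xi>|lborel. h q \<xi>)" .
  qed
  also have "\<dots> = (LINT \<xi>|lborel. (LINT q|lborel. h q \<xi>))"
    by (rule lborel_pair.Fubini_integral[OF h_int, symmetric])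
  also have "(\<lambda>\<xi>. LINT q|lborel. h q \<xi>) =
      (\<lambda>\<xi>. (exp (- s * (norm \<xi>)\<^sup>2) - exp (- r * (norm \<xi>)\<^sup>2)) *\<^sub>R (c * (cis (x \<bullet> \<xi>) * fourier \<phi> \<xi>)))"
  proof
    fix \<xi> :: "real^'n"
    have "integrable lborel (\<lambda>q. indicator {r..s} q *\<^sub>R (- (norm \<xi>)\<^sup>2 * exp (- q * (norm \<xi>)\<^sup>2)))"
      using borel_integrable_compact[of "{r..s}" "\<lambda>q. - (norm \<xi>)\<^sup>2 * exp (- q * (norm \<xi>)\<^sup>2)"]
      by (simp add: continuous_intros)
    then have "(LINT q|lborel. h q \<xi>) = (LINT q|lborel. indicator {r..s} q *\<^sub>R (- (norm \<xi>)\<^sup>2 * exp (- q * (norm \<xi>)\<^sup>2))) *\<^sub>R (c * (cis (x \<bullet> \<xi>) * fourier \<phi> \<xi>))"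
      unfolding h_def by (intro integral_scaleR_left) blast
    then show "(LINT q|lborel. h q \<xi>) = (exp (- s * (norm \<xi>)\<^sup>2) - exp (- r * (norm \<xi>)\<^sup>2)) *\<^sub>R (c * (cis (x \<bullet> \<xi>) * fourier \<phi> \<xi>))"
      unfolding FTC .
  qed
  also have "(LINT \<xi>|lborel. (exp (- s * (norm \<xi>)\<^sup>2) - exp (- r * (norm \<xi>)\<^sup>2)) *\<^sub>R (c * (cis (x \<bullet> \<xi>) * fourier \<phi> \<xi>))) =
     (LINT \<xi>|lborel. c * (cis (x \<bullet> \<xi>) * (complex_of_real (exp (- s * (norm \<xi>)\<^sup>2)) * fourier \<phi> \<xi>)) -
        c * (cis (x \<bullet> \<xi>) * (complex_of_real (exp (- r * (norm \<xi>)\<^sup>2)) * fourier \<phi> \<xi>)))"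
    by (intro Bochner_Integration.integral_cong) (auto simp: scaleR_conv_of_real algebra_simps)
  also have "\<dots> = heat s \<phi> x - heat r \<phi> x"
    using I[of r] I[of s] rs
    by (subst Bochner_Integration.integral_diff)
       (auto simp: heat_lborel[OF schwartz_measurable[OF \<phi>]] c_def intro!: integrable_mult_right)
  finally show ?thesis ..
qed

text \<open>Up to a constant factor, the supremum is at most the \<open>L\<^sup>1\<close> norm of \<open>exp (- s\<bar>\<xi>\<bar>\<^sup>2)\<close> times the Fourier transform of \<open>\<phi>\<close>, and the
  exponential tends to \<open>0\<close> for \<open>\<xi> \<noteq> 0\<close>.\<close>

lemma heat_sup_tendsto_zero:
  fixes \<phi> :: "real^'n::finite \<Rightarrow> complex"
  assumes \<phi>: "schwartz \<phi>"
  obtains B where "\<And>s x. 0 \<le> s \<Longrightarrow> norm (heat s \<phi> x) \<le> B s" "(B \<longlongrightarrow> 0) at_top"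
proof
  note [measurable] = schwartz_measurable[OF \<phi>]
  define c where "c = 1 / (2 * pi) ^ CARD('n)"
  have c: "0 \<le> c" by (simp add: c_def)
  define b where "b s = (LINT \<xi>|lborel. exp (- s * (norm \<xi>)\<^sup>2) * norm (fourier \<phi> \<xi>))" for s :: real
  show "norm (heat s \<phi> x) \<le> c * b s" for s x
  proof -
    have "norm (heat s \<phi> x) \<le> c * (LINT \<xi>|lborel. norm (cis (x \<bullet> \<xi>) * (complex_of_real (exp (- s * (norm \<xi>)\<^sup>2)) * fourier \<phi> \<xi>)))"
      unfolding heat_lborel[OF schwartz_measurable[OF \<phi>]] norm_mult c_def[symmetric] norm_of_real abs_of_nonneg[OF c]
      by (intro mult_left_mono c order_trans[OF integral_norm_bound]) (simp add: norm_mult)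
    then show ?thesis by (simp add: b_def norm_mult)
  qed
  have "((\<lambda>s. LINT \<xi>|lborel. exp (- s * (norm \<xi>)\<^sup>2) * norm (fourier \<phi> \<xi>)) \<longlongrightarrow> (LINT \<xi>|(lborel :: (real^'n) measure). 0)) at_top"
  proof (rule integral_dominated_convergence_at_top)
    show "integrable lborel (\<lambda>\<xi>. norm (fourier \<phi> \<xi>))" using integrable_fourier(2)[OF \<phi>] by simp
    show "\<forall>\<^sub>F s in at_top. AE \<xi> in lborel. norm (exp (- s * (norm \<xi>)\<^sup>2) * norm (fourier \<phi> \<xi>)) \<le> norm (fourier \<phi> \<xi>)"
      using eventually_ge_at_top[of 0] by eventually_elim (auto intro!: mult_left_le_one_le)
    have "((\<lambda>s. exp (- s * (norm \<xi>)\<^sup>2) * norm (fourier \<phi> \<xi>)) \<longlongrightarrow> 0) at_top" if "\<xi> \<noteq> 0" for \<xi> :: "real^'n"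
    proof -
      have "filterlim (\<lambda>s. s * (norm \<xi>)\<^sup>2) at_top at_top"
        using that by (intro filterlim_at_top_mult_tendsto_pos[OF tendsto_const]) (auto intro: filterlim_ident)
      then have "((\<lambda>s. exp (- (s * (norm \<xi>)\<^sup>2))) \<longlongrightarrow> 0) at_top"
        by (intro filterlim_compose[OF exp_at_bot] filterlim_compose[OF filterlim_uminus_at_bot_at_top])
      then show ?thesis by (auto intro: tendsto_mult_left_zero)
    qed
    then show "AE \<xi> in lborel. ((\<lambda>s. exp (- s * (norm \<xi>)\<^sup>2) * norm (fourier \<phi> \<xi>)) \<longlongrightarrow> 0) at_top"
      using AE_lborel_singleton[of 0] by auto
  qed measurable
  then have "(b \<longlongrightarrow> 0) at_top" by (simp add: b_def[abs_def])
  then show "((\<lambda>s. c * b s) \<longlongrightarrow> 0) at_top" by (rule tendsto_mult_right_zero)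
qed

section \<open>Gaussian test functions\<close>

text \<open>Polynomials, to describe all iterated derivatives of a Gaussian at once: the products of a polynomial
  with a fixed Gaussian are closed under partial derivatives.\<close>

inductive polynomial_map :: "(real^'n::finite \<Rightarrow> complex) \<Rightarrow> bool" where
  const: "polynomial_map (\<lambda>y. c)"
| coord: "polynomial_map (\<lambda>y. complex_of_real (y $ i))"
| add: "polynomial_map p \<Longrightarrow> polynomial_map q \<Longrightarrow> polynomial_map (\<lambda>y. p y + q y)"
| mult: "polynomial_map p \<Longrightarrow> polynomial_map q \<Longrightarrow> polynomial_map (\<lambda>y. p y * q y)"

lemma polynomial_map_derivative:
  "polynomial_map p \<Longrightarrow> \<exists>p'. (\<forall>y. (p has_derivative p' y) (at y)) \<and> (\<forall>i. polynomial_map (\<lambda>y. p' y (axis i 1)))"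
proof (induction rule: polynomial_map.induct)
  case (const c)
  then show ?case by (intro exI[of _ "\<lambda>y h. 0"]) (auto intro: polynomial_map.const)
next
  case (coord i)
  show ?case
    by (intro exI[of _ "\<lambda>y h. complex_of_real (h $ i)"])
       (auto intro!: polynomial_map.const bounded_linear_imp_has_derivative
          bounded_linear_compose[OF bounded_linear_of_real bounded_linear_vec_nth])
next
  case (add p q)
  then obtain p' q' where *: "\<forall>y. (p has_derivative p' y) (at y)" "\<forall>i. polynomial_map (\<lambda>y. p' y (axis i 1))"
    "\<forall>y. (q has_derivative q' y) (at y)" "\<forall>i. polynomial_map (\<lambda>y. q' y (axis i 1))" by auto
  then show ?case
    by (intro exI[of _ "\<lambda>y h. p' y h + q' y h"]) (auto intro: has_derivative_add polynomial_map.add)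
next
  case (mult p q)
  then obtain p' q' where *: "\<forall>y. (p has_derivative p' y) (at y)" "\<forall>i. polynomial_map (\<lambda>y. p' y (axis i 1))"
    "\<forall>y. (q has_derivative q' y) (at y)" "\<forall>i. polynomial_map (\<lambda>y. q' y (axis i 1))" by auto
  with mult.hyps show ?case
    by (intro exI[of _ "\<lambda>y h. p y * q' y h + p' y h * q y"])
       (auto intro!: has_derivative_mult polynomial_map.intros)
qed

lemma le_one_plus_square: "z \<le> 1 + z\<^sup>2" for z :: real
proof -
  have "0 \<le> (z - 1)\<^sup>2" "0 \<le> (z + 1)\<^sup>2" by auto
  then show ?thesis by (simp add: power2_diff power2_sum)
qed

lemma polynomial_map_growth:
  "polynomial_map p \<Longrightarrow> \<exists>C N. 0 \<le> C \<and> (\<forall>y. norm (p y) \<le> C * (1 + (norm y)\<^sup>2) ^ N)"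
proof (induction rule: polynomial_map.induct)
  case (const c)
  show ?case by (intro exI[of _ "norm c"] exI[of _ 0]) auto
next
  case (coord i)
  have "\<bar>y $ i\<bar> \<le> 1 * (1 + (norm y)\<^sup>2) ^ 1" for y :: "real^'a"
  proof -
    have "\<bar>y $ i\<bar> \<le> norm y" by (rule component_le_norm_cart)
    also have "\<dots> \<le> 1 + (norm y)\<^sup>2" by (rule le_one_plus_square)
    finally show ?thesis by simp
  qed
  then show ?case by (intro exI[of _ 1] exI[of _ 1]) auto
next
  case (add p q)
  then obtain C N D K where *: "0 \<le> C" "\<And>y. norm (p y) \<le> C * (1 + (norm y)\<^sup>2) ^ N"
    "0 \<le> D" "\<And>y. norm (q y) \<le> D * (1 + (norm y)\<^sup>2) ^ K" by auto
  have "norm (p y + q y) \<le> (C + D) * (1 + (norm y)\<^sup>2) ^ (N + K)" for y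
  proof -
    have "(1 + (norm y)\<^sup>2) ^ N \<le> (1 + (norm y)\<^sup>2) ^ (N + K)" "(1 + (norm y)\<^sup>2) ^ K \<le> (1 + (norm y)\<^sup>2) ^ (N + K)"
      by (auto intro!: power_increasing)
    then have "C * (1 + (norm y)\<^sup>2) ^ N + D * (1 + (norm y)\<^sup>2) ^ K \<le> (C + D) * (1 + (norm y)\<^sup>2) ^ (N + K)"
      using * by (simp add: distrib_right add_mono mult_left_mono)
    then show ?thesis using *(2)[of y] *(4)[of y] norm_triangle_ineq[of "p y" "q y"] by linarith
  qed
  then show ?case using * by (intro exI[of _ "C + D"] exI[of _ "N + K"]) auto
next
  case (mult p q)
  then obtain C N D K where *: "0 \<le> C" "\<And>y. norm (p y) \<le> C * (1 + (norm y)\<^sup>2) ^ N"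
    "0 \<le> D" "\<And>y. norm (q y) \<le> D * (1 + (norm y)\<^sup>2) ^ K" by auto
  have "norm (p y * q y) \<le> (C * D) * (1 + (norm y)\<^sup>2) ^ (N + K)" for y
  proof -
    have "norm (p y) * norm (q y) \<le> (C * (1 + (norm y)\<^sup>2) ^ N) * (D * (1 + (norm y)\<^sup>2) ^ K)"
      using * by (intro mult_mono) auto
    then show ?thesis by (simp add: norm_mult power_add mult_ac)
  qed
  then show ?case using * by (intro exI[of _ "C * D"] exI[of _ "N + K"]) auto
qed

text \<open>Take the \<open>N\<close>-th power of \<open>z / N \<le> exp (z / N)\<close> for \<open>z = c (1 + a)\<close>.\<close>

lemma exp_dominates_power:
  fixes c :: real
  assumes c: "0 < c"
  obtains K where "0 \<le> K" "\<And>a. 0 \<le> a \<Longrightarrow> (1 + a) ^ N * exp (- c * a) \<le> K"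
proof (cases "N = 0")
  case True
  then show thesis using c by (intro that[of 1]) auto
next
  case False
  have "(1 + a) ^ N * exp (- c * a) \<le> (N / c) ^ N * exp c" if a: "0 \<le> a" for a
  proof -
    have "c * (1 + a) / N \<le> exp (c * (1 + a) / N)"
      using exp_ge_add_one_self[of "c * (1 + a) / N"] by linarith
    then have "(c * (1 + a) / N) ^ N \<le> exp (c * (1 + a) / N) ^ N"
      using a c by (intro power_mono) auto
    also have "\<dots> = exp (c * (1 + a))"
      using False by (simp flip: exp_of_nat_mult)
    also have "\<dots> = exp c * exp (c * a)"
      by (simp add: distrib_left exp_add)
    also have "(c * (1 + a) / N) ^ N = (c / N) ^ N * (1 + a) ^ N"
      by (simp flip: power_mult_distrib)
    finally have 1: "(c / N) ^ N * (1 + a) ^ N \<le> exp c * exp (c * a)" .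
    have "(1 + a) ^ N = (N / c) ^ N * ((c / N) ^ N * (1 + a) ^ N)"
      using c False by (simp flip: power_mult_distrib mult.assoc)
    also have "\<dots> \<le> (N / c) ^ N * (exp c * exp (c * a))"
      using c by (intro mult_left_mono 1) auto
    finally have "(1 + a) ^ N * exp (- c * a) \<le> (N / c) ^ N * (exp c * exp (c * a)) * exp (- c * a)"
      by (rule mult_right_mono) simp
    then show ?thesis by (simp add: exp_minus mult.assoc)
  qed
  then show thesis using c by (intro that[of "(N / c) ^ N * exp c"]) auto
qed

lemma gaussian_moment_bounded:
  fixes x :: "real^'n::finite"
  assumes c: "0 < c"
  obtains K where "0 \<le> K" "\<And>y. (1 + (norm y)\<^sup>2) ^ N * exp (- c * (norm (y - x))\<^sup>2) \<le> K"
proof -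
  obtain K where K: "0 \<le> K" "\<And>a. 0 \<le> a \<Longrightarrow> (1 + a) ^ N * exp (- c * a) \<le> K"
    using exp_dominates_power[OF c] by metis
  define L where "L = (2 * (1 + (norm x)\<^sup>2)) ^ N"
  have "(1 + (norm y)\<^sup>2) ^ N * exp (- c * (norm (y - x))\<^sup>2) \<le> L * K" for y
  proof -
    have "norm y \<le> norm x + norm (y - x)"
      using norm_triangle_ineq[of x "y - x"] by simp
    then have "(norm y)\<^sup>2 \<le> (norm x + norm (y - x))\<^sup>2" by (intro power_mono) auto
    also have "\<dots> \<le> 2 * (norm x)\<^sup>2 + 2 * (norm (y - x))\<^sup>2"
      using zero_le_power2[of "norm x - norm (y - x)"] by (simp add: power2_sum power2_diff)
    finally have le: "(norm y)\<^sup>2 \<le> 2 * (norm x)\<^sup>2 + 2 * (norm (y - x))\<^sup>2" .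
    have "1 + (norm y)\<^sup>2 \<le> 2 * (1 + (norm x)\<^sup>2) * (1 + (norm (y - x))\<^sup>2)"
    proof -
      have eq: "2 * (1 + A) * (1 + B) = 2 + 2 * A + 2 * B + 2 * (A * B)" for A B :: real
        by (simp add: algebra_simps)
      have "0 \<le> (norm x)\<^sup>2 * (norm (y - x))\<^sup>2" by simp
      then show ?thesis using le unfolding eq by linarith
    qed
    then have "(1 + (norm y)\<^sup>2) ^ N \<le> (2 * (1 + (norm x)\<^sup>2) * (1 + (norm (y - x))\<^sup>2)) ^ N"
      by (intro power_mono) auto
    also have "\<dots> = L * (1 + (norm (y - x))\<^sup>2) ^ N"
      by (simp add: L_def power_mult_distrib)
    finally have "(1 + (norm y)\<^sup>2) ^ N * exp (- c * (norm (y - x))\<^sup>2) \<le>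
        L * (1 + (norm (y - x))\<^sup>2) ^ N * exp (- c * (norm (y - x))\<^sup>2)"
      by (rule mult_right_mono) simp
    also have "\<dots> \<le> L * K"
      unfolding mult.assoc by (intro mult_left_mono K(2)) (auto simp: L_def)
    finally show ?thesis .
  qed
  then show thesis using K(1) by (intro that[of "L * K"]) (auto simp: L_def)
qed

lemma schwartz_polynomial_times_gaussian:
  fixes x :: "real^'n::finite"
  assumes c: "0 < c" and p: "polynomial_map p"
  shows "schwartz (\<lambda>y. p y * complex_of_real (exp (- c * (norm (y - x))\<^sup>2)))"
proof -
  define g where "g y = complex_of_real (exp (- c * (norm (y - x))\<^sup>2))" for y
  have g: "(g has_derivative (\<lambda>h. - complex_of_real (2 * c * ((y - x) \<bullet> h)) * g y)) (at y)" for y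
  proof -
    have "((\<lambda>y. exp (- c * ((y - x) \<bullet> (y - x)))) has_derivative
        (\<lambda>h. exp (- c * ((y - x) \<bullet> (y - x))) * (- c * ((y - x) \<bullet> h + h \<bullet> (y - x))))) (at y)"
      by (auto intro!: derivative_eq_intros)
    then have "((\<lambda>y. exp (- c * ((y - x) \<bullet> (y - x)))) has_derivative
        (\<lambda>h. - (2 * c * ((y - x) \<bullet> h)) * exp (- c * ((y - x) \<bullet> (y - x))))) (at y)"
      by (rule has_derivative_eq_rhs) (auto simp: inner_commute algebra_simps)
    from bounded_linear.has_derivative[OF bounded_linear_of_real this] show ?thesis
      by (simp add: g_def[abs_def] power2_norm_eq_inner)
  qed
  have step: "\<exists>q. polynomial_map q \<and> partial_deriv i (\<lambda>y. p y * g y) = (\<lambda>y. q y * g y)"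
    if p: "polynomial_map p" for p i
  proof -
    obtain p' where p': "\<And>y. (p has_derivative p' y) (at y)" "\<And>i. polynomial_map (\<lambda>y. p' y (axis i 1))"
      using polynomial_map_derivative[OF p] by blast
    have D: "((\<lambda>y. p y * g y) has_derivative (\<lambda>h. p y * (- complex_of_real (2 * c * ((y - x) \<bullet> h)) * g y) + p' y h * g y)) (at y)" for y
      by (rule has_derivative_mult[OF p'(1) g])
    have "partial_deriv i (\<lambda>y. p y * g y) = (\<lambda>y. (p' y (axis i 1) + p y * (complex_of_real (- 2 * c) * (complex_of_real (y $ i) + complex_of_real (- x $ i)))) * g y)"
      by (intro ext, subst partial_deriv_eqI[OF D]) (simp add: inner_axis algebra_simps)
    moreover have "polynomial_map (\<lambda>y. p' y (axis i 1) + p y * (complex_of_real (- 2 * c) * (complex_of_real (y $ i) + complex_of_real (- x $ i))))"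
      by (intro polynomial_map.intros p'(2) p)
    ultimately show ?thesis by blast
  qed
  have iter: "\<exists>q. polynomial_map q \<and> foldr partial_deriv is (\<lambda>y. p y * g y) = (\<lambda>y. q y * g y)" for "is"
  proof (induction "is")
    case Nil
    then show ?case using p by auto
  next
    case (Cons i "is")
    then show ?case using step by auto
  qed
  have "foldr partial_deriv is (\<lambda>y. p y * g y) differentiable_on UNIV \<and>
           (\<forall>k::nat. bounded (range (\<lambda>x. norm x ^ k *\<^sub>R foldr partial_deriv is (\<lambda>y. p y * g y) x)))" for "is"
  proof -
    obtain q where q: "polynomial_map q" "foldr partial_deriv is (\<lambda>y. p y * g y) = (\<lambda>y. q y * g y)"
      using iter by blast
    obtain q' where q': "\<And>y. (q has_derivative q' y) (at y)" using polynomial_map_derivative[OF q(1)] by blast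
    have "(\<lambda>y. q y * g y) differentiable_on UNIV"
      using has_derivative_mult[OF q' g] unfolding differentiable_on_def differentiable_def by blast
    moreover have "bounded (range (\<lambda>y. norm y ^ k *\<^sub>R (q y * g y)))" for k
    proof -
      obtain C N where C: "0 \<le> C" "\<And>y. norm (q y) \<le> C * (1 + (norm y)\<^sup>2) ^ N"
        using polynomial_map_growth[OF q(1)] by blast
      obtain K where K: "0 \<le> K" "\<And>y. (1 + (norm y)\<^sup>2) ^ (k + N) * exp (- c * (norm (y - x))\<^sup>2) \<le> K"
        using gaussian_moment_bounded[OF c] by metis
      have "norm (norm y ^ k *\<^sub>R (q y * g y)) \<le> C * K" for y
      proof -
        have "norm y ^ k \<le> (1 + (norm y)\<^sup>2) ^ k" by (intro power_mono le_one_plus_square) auto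
        then have "norm y ^ k * norm (q y) \<le> (1 + (norm y)\<^sup>2) ^ k * (C * (1 + (norm y)\<^sup>2) ^ N)"
          by (intro mult_mono C) auto
        then have "norm y ^ k * norm (q y) * exp (- c * (norm (y - x))\<^sup>2) \<le>
            (1 + (norm y)\<^sup>2) ^ k * (C * (1 + (norm y)\<^sup>2) ^ N) * exp (- c * (norm (y - x))\<^sup>2)"
          by (rule mult_right_mono) simp
        also have "\<dots> = C * ((1 + (norm y)\<^sup>2) ^ (k + N) * exp (- c * (norm (y - x))\<^sup>2))"
          by (simp add: power_add)
        also have "\<dots> \<le> C * K" by (intro mult_left_mono K C)
        finally show ?thesis by (simp add: norm_mult g_def mult.assoc)
      qed
      then show ?thesis by (auto simp: bounded_iff)
    qed
    ultimately show ?thesis unfolding q(2) by blast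
  qed
  then have "schwartz (\<lambda>y. p y * g y)" unfolding schwartz_def by blast
  then show ?thesis by (simp add: g_def)
qed

text \<open>The centre is the first vector argument, so \<open>gauss t x\<close> is a test function of \<open>y\<close>: pairing it with \<open>u\<close> gives the
  heat extension of \<open>u\<close> at the point \<open>x\<close> and time \<open>t\<close>.\<close>

definition gauss :: "real \<Rightarrow> real^'n::finite \<Rightarrow> real^'n \<Rightarrow> complex" where
  "gauss t x y = complex_of_real (heat_kernel t (y - x))"

lemma schwartz_gauss: "0 < t \<Longrightarrow> schwartz (gauss t x)"
  using schwartz_polynomial_times_gaussian[OF _ polynomial_map.const, of "1 / (4 * t)"
      "complex_of_real (1 / (2 * pi) ^ CARD('a) * sqrt (pi / t) ^ CARD('a))" x]
  by (simp add: gauss_def[abs_def] heat_kernel_def mult.assoc)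

lemma fourier_gauss:
  fixes x :: "real^'n::finite"
  assumes t: "0 < t"
  shows "fourier (gauss t x) \<xi> = cis (- (x \<bullet> \<xi>)) * complex_of_real (exp (- t * (norm \<xi>)\<^sup>2))"
proof -
  note [measurable] = schwartz_measurable[OF schwartz_gauss[OF t, of x]]
  have "fourier (gauss t x) \<xi> = (LINT y|lborel. cis (- ((x + 1 *\<^sub>R y) \<bullet> \<xi>)) * gauss t x (x + 1 *\<^sub>R y))"
    using lborel_affine_integral[of 1 "\<lambda>y. cis (- (y \<bullet> \<xi>)) * gauss t x y" x]
    by (simp add: fourier_lborel)
  also have "\<dots> = (LINT y|lborel. (cis (- (x \<bullet> \<xi>)) * complex_of_real (1 / (2 * pi) ^ CARD('n) * sqrt (pi / t) ^ CARD('n))) *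
      (cis (y \<bullet> (- \<xi>)) * complex_of_real (exp (- (1 / (4 * t)) * (norm y)\<^sup>2))))"
  proof (rule Bochner_Integration.integral_cong[OF refl])
    fix y :: "real^'n"
    have 1: "cis (- ((x + 1 *\<^sub>R y) \<bullet> \<xi>)) = cis (- (x \<bullet> \<xi>)) * cis (y \<bullet> (- \<xi>))"
      by (simp add: cis_mult inner_add_left)
    have 2: "gauss t x (x + 1 *\<^sub>R y) = complex_of_real (1 / (2 * pi) ^ CARD('n) * sqrt (pi / t) ^ CARD('n)) *
        complex_of_real (exp (- (1 / (4 * t)) * (norm y)\<^sup>2))"
      by (simp add: gauss_def heat_kernel_def)
    show "cis (- ((x + 1 *\<^sub>R y) \<bullet> \<xi>)) * gauss t x (x + 1 *\<^sub>R y) =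
      (cis (- (x \<bullet> \<xi>)) * complex_of_real (1 / (2 * pi) ^ CARD('n) * sqrt (pi / t) ^ CARD('n))) *
      (cis (y \<bullet> (- \<xi>)) * complex_of_real (exp (- (1 / (4 * t)) * (norm y)\<^sup>2)))"
      unfolding 1 2 by (simp only: mult_ac)
  qed
  also have "\<dots> = cis (- (x \<bullet> \<xi>)) * complex_of_real ((1 / (2 * pi) ^ CARD('n) * sqrt (pi / t) ^ CARD('n)) *
       (sqrt (pi / (1 / (4 * t))) ^ CARD('n) * exp (- (norm (- \<xi>))\<^sup>2 / (4 * (1 / (4 * t))))))"
  proof -
    have t4: "0 < 1 / (4 * t)" using t by simp
    show ?thesis
      unfolding integral_mult_right_zero gaussian_char_vec(2)[OF t4] of_real_mult mult.assoc by (rule refl)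
  qed
  also have "(1 / (2 * pi) ^ CARD('n) * sqrt (pi / t) ^ CARD('n)) *
       (sqrt (pi / (1 / (4 * t))) ^ CARD('n) * exp (- (norm (- \<xi>))\<^sup>2 / (4 * (1 / (4 * t))))) = exp (- t * (norm \<xi>)\<^sup>2)"
  proof -
    have "(1 / (2 * pi) * sqrt (pi / t) * sqrt (pi / (1 / (4 * t)))) ^ CARD('n) = 1"
      by (simp only: heat_kernel_constant[OF t] power_one)
    then have P: "1 / (2 * pi) ^ CARD('n) * (sqrt (pi / t) ^ CARD('n) * sqrt (pi / (1 / (4 * t))) ^ CARD('n)) = 1"
      unfolding power_one_over[symmetric] mult.assoc[symmetric] power_mult_distrib[symmetric] .
    have e: "- (norm (- \<xi>))\<^sup>2 / (4 * (1 / (4 * t))) = - t * (norm \<xi>)\<^sup>2" by simp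
    have ring: "(Q * A) * (B * e) = (Q * (A * B)) * e" for Q A B e :: real by simp
    show ?thesis unfolding e by (rule trans[OF ring]) (simp only: P mult_1)
  qed
  finally show ?thesis .
qed

lemma exp_split:
  "complex_of_real (exp (- (t + s) * n)) = complex_of_real (exp (- s * n)) * complex_of_real (exp (- t * n))"
proof -
  have "- (t + s) * n = - s * n + - t * n" by (simp add: algebra_simps)
  then show ?thesis by (simp only: exp_add of_real_mult)
qed

text \<open>The semigroup law, read off from the multipliers. It keeps the heat orbit of a Gaussian, and likewise of its
  Laplacian, inside the Schwartz space, so that an equation tested on Schwartz functions can be tested at every
  time of the orbit.\<close>

lemma heat_gauss:
  fixes x :: "real^'n::finite"
  assumes t: "0 < t" and s: "0 \<le> s"
  shows "heat s (gauss t x) = gauss (t + s) x"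
proof
  fix y
  have ts: "0 < t + s" using t s by simp
  note m = schwartz_measurable[OF schwartz_gauss]
  have "heat s (gauss t x) y = heat 0 (gauss (t + s) x) y"
    unfolding heat_lborel[OF m[OF t]] heat_lborel[OF m[OF ts]] fourier_gauss[OF t] fourier_gauss[OF ts]
    by (simp only: exp_split minus_zero mult_zero_left exp_zero of_real_1 mult_1 mult_ac)
  then show "heat s (gauss t x) y = gauss (t + s) x y"
    by (simp add: fourier_inversion[OF schwartz_gauss[OF ts]])
qed

lemma heat_laplacian_gauss:
  fixes x :: "real^'n::finite"
  assumes t: "0 < t" and s: "0 \<le> s"
  shows "heat s (laplacian (gauss t x)) = laplacian (gauss (t + s) x)"
proof
  fix y
  have ts: "0 < t + s" using t s by simp
  note S = schwartz_laplacian[OF schwartz_gauss]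
  note m = schwartz_measurable[OF S]
  have "heat s (laplacian (gauss t x)) y = heat 0 (laplacian (gauss (t + s) x)) y"
    unfolding heat_lborel[OF m[OF t]] heat_lborel[OF m[OF ts]]
      fourier_laplacian[OF schwartz_gauss[OF t]] fourier_laplacian[OF schwartz_gauss[OF ts]]
      fourier_gauss[OF t] fourier_gauss[OF ts]
    by (simp only: exp_split minus_zero mult_zero_left exp_zero of_real_1 mult_1 mult_ac)
  then show "heat s (laplacian (gauss t x)) y = laplacian (gauss (t + s) x) y"
    by (simp add: fourier_inversion[OF S[OF ts]])
qed

section \<open>Pairing a bounded function with the heat flow\<close>

lemma heat_strip_integrable:
  fixes \<phi> :: "real^'n::finite \<Rightarrow> complex"
  assumes \<phi>: "schwartz \<phi>" and rs: "0 \<le> r" "r \<le> s"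
  shows "integrable (lborel \<Otimes>\<^sub>M lborel) (\<lambda>(q, x). indicator {r..s} q *\<^sub>R heat q \<phi> x)"
proof (rule integrable_if_slices)
  note [measurable] = schwartz_measurable[OF \<phi>]
  show "(\<lambda>(q, x). indicator {r..s} q *\<^sub>R heat q \<phi> x) \<in> borel_measurable (lborel \<Otimes>\<^sub>M lborel)"
    by measurable
  show "integrable lborel (\<lambda>x. indicator {r..s} q *\<^sub>R heat q \<phi> x)" for q
    using heat_L1_contraction(1)[OF \<phi>, of q] rs by (cases "q \<in> {r..s}") auto
  show "integrable lborel (\<lambda>q. indicator {r..s} q * L1_norm \<phi>)"
    by (intro integrable_mult_left integrable_real_indicator) (auto simp: rs)
  show "(LINT x|lborel. norm (indicator {r..s} q *\<^sub>R heat q \<phi> x)) \<le> indicator {r..s} q * L1_norm \<phi>" for q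
    using heat_L1_contraction(2)[OF \<phi>, of q] rs by (cases "q \<in> {r..s}") auto
qed

lemma heat_L1_difference:
  fixes \<phi> :: "real^'n::finite \<Rightarrow> complex"
  assumes \<phi>: "schwartz \<phi>" and rs: "0 \<le> r" "r \<le> s"
  shows "(LINT x|lborel. norm (heat s \<phi> x - heat r \<phi> x)) \<le> (s - r) * L1_norm (laplacian \<phi>)"
proof -
  define h where "h q x = indicator {r..s} q *\<^sub>R heat q (laplacian \<phi>) x" for q x
  define K where "K = L1_norm (laplacian \<phi>)"
  have h: "integrable (lborel \<Otimes>\<^sub>M lborel) (case_prod h)"
    unfolding h_def by (rule heat_strip_integrable[OF schwartz_laplacian[OF \<phi>] rs])
  have hn: "integrable (lborel \<Otimes>\<^sub>M lborel) (\<lambda>(q, x). norm (h q x))"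
    using integrable_norm[OF h] by (simp add: split_beta')
  have "(LINT x|lborel. norm (heat s \<phi> x - heat r \<phi> x)) = (LINT x|lborel. norm (LINT q|lborel. h q x))"
    by (simp add: heat_diff_eq_integral[OF \<phi> rs] h_def)
  also have "\<dots> \<le> (LINT x|lborel. (LINT q|lborel. norm (h q x)))"
    by (intro integral_mono integrable_norm lborel_pair.integrable_snd[OF h] lborel_pair.integrable_snd[OF hn]
        integral_norm_bound)
  also have "\<dots> = (LINT q|lborel. (LINT x|lborel. norm (h q x)))"
    by (rule lborel_pair.Fubini_integral[OF hn])
  also have "\<dots> \<le> (LINT q|lborel. indicator {r..s} q * K)"
  proof (rule integral_mono)
    show "integrable lborel (\<lambda>q. LINT x|lborel. norm (h q x))" by (rule lborel_pair.integrable_fst[OF hn])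
    show "integrable lborel (\<lambda>q. indicator {r..s} q * K)"
      by (intro integrable_mult_left integrable_real_indicator) (auto simp: rs)
    show "(LINT x|lborel. norm (h q x)) \<le> indicator {r..s} q * K" for q
      using heat_L1_contraction(2)[OF schwartz_laplacian[OF \<phi>], of q] rs
      by (cases "q \<in> {r..s}") (auto simp: K_def h_def)
  qed
  also have "\<dots> = (s - r) * K" using rs by simp
  finally show ?thesis by (simp add: K_def)
qed

text \<open>A representative, Borel measurable and bounded everywhere, of a class in \<open>L\<^sup>\<infinity>\<close> that vanishes at
  infinity.\<close>

locale vanishing_function =
  fixes u :: "real^'n::finite \<Rightarrow> complex" and M :: real
  assumes u_measurable [measurable]: "u \<in> borel_measurable borel"
    and u_bound: "\<And>x. norm (u x) \<le> M"
    and u_vanishes: "\<And>\<epsilon>. 0 < \<epsilon> \<Longrightarrow> \<exists>r. AE x in lborel. r \<le> norm x \<longrightarrow> norm (u x) < \<epsilon>"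
begin

definition pairing :: "(real^'n \<Rightarrow> complex) \<Rightarrow> real \<Rightarrow> complex" where
  "pairing \<phi> s = (LINT x|lborel. u x * heat s \<phi> x)"

lemma M_nonneg: "0 \<le> M"
  using u_bound[of 0] norm_ge_zero[of "u 0"] by linarith

lemma integrable_u_mult:
  assumes "integrable lborel f"
  shows "integrable lborel (\<lambda>x. u x * f x)"
proof (rule Bochner_Integration.integrable_bound)
  show "integrable lborel (\<lambda>x. M * norm (f x))" using assms by simp
  show "AE x in lborel. norm (u x * f x) \<le> norm (M * norm (f x))"
    using u_bound M_nonneg by (auto simp: norm_mult intro!: AE_I2 mult_right_mono)
qed (use assms in measurable)

lemma norm_integral_u_mult_le:
  assumes f: "integrable lborel f"
  shows "norm (LINT x|lborel. u x * f x) \<le> M * L1_norm f"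
proof -
  have "norm (LINT x|lborel. u x * f x) \<le> (LINT x|lborel. norm (u x * f x))"
    by (rule integral_norm_bound)
  also have "\<dots> \<le> (LINT x|lborel. M * norm (f x))"
    using f u_bound by (intro integral_mono integrable_norm integrable_u_mult) (auto simp: norm_mult intro!: mult_right_mono)
  finally show ?thesis by simp
qed

lemma pairing_bound:
  "schwartz \<phi> \<Longrightarrow> 0 \<le> s \<Longrightarrow> norm (pairing \<phi> s) \<le> M * L1_norm \<phi>"
  unfolding pairing_def
  by (rule order_trans[OF norm_integral_u_mult_le])
     (auto intro: heat_L1_contraction mult_left_mono M_nonneg)

lemma pairing_0: "schwartz \<phi> \<Longrightarrow> pairing \<phi> 0 = (LINT x|lborel. u x * \<phi> x)"
  by (simp add: pairing_def fourier_inversion)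

lemma distribution_of_eq_pairing: "schwartz \<phi> \<Longrightarrow> distribution_of u \<phi> = pairing \<phi> 0"
proof -
  assume \<phi>: "schwartz \<phi>"
  note [measurable] = schwartz_measurable[OF \<phi>]
  show ?thesis
    unfolding distribution_of_def pairing_0[OF \<phi>] by (rule integral_completion) measurable
qed

lemma pairing_diff:
  assumes \<phi>: "schwartz \<phi>" and rs: "0 \<le> r" "r \<le> s"
  shows "pairing \<phi> s - pairing \<phi> r = (LINT q|lborel. indicator {r..s} q *\<^sub>R pairing (laplacian \<phi>) q)"
proof -
  define h where "h q x = indicator {r..s} q *\<^sub>R heat q (laplacian \<phi>) x" for q x
  have h: "integrable (lborel \<Otimes>\<^sub>M lborel) (case_prod h)"
    unfolding h_def by (rule heat_strip_integrable[OF schwartz_laplacian[OF \<phi>] rs])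
  have uh: "integrable (lborel \<Otimes>\<^sub>M lborel) (\<lambda>(q, x). u x * h q x)"
  proof (rule Bochner_Integration.integrable_bound)
    show "integrable (lborel \<Otimes>\<^sub>M lborel) (\<lambda>z. M * norm (case_prod h z))"
      using h by simp
    show "(\<lambda>(q, x). u x * h q x) \<in> borel_measurable (lborel \<Otimes>\<^sub>M lborel)"
      using borel_measurable_integrable[OF h] by (simp add: split_beta')
    show "AE z in lborel \<Otimes>\<^sub>M lborel. norm (case z of (q, x) \<Rightarrow> u x * h q x) \<le> norm (M * norm (case_prod h z))"
      using u_bound M_nonneg by (auto simp: norm_mult intro!: AE_I2 mult_right_mono)
  qed
  have "pairing \<phi> s - pairing \<phi> r = (LINT x|lborel. u x * heat s \<phi> x - u x * heat r \<phi> x)"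
    unfolding pairing_def using rs
    by (intro Bochner_Integration.integral_diff[symmetric] integrable_u_mult heat_L1_contraction \<phi>) auto
  also have "\<dots> = (LINT x|lborel. (LINT q|lborel. u x * h q x))"
    unfolding right_diff_distrib[symmetric] heat_diff_eq_integral[OF \<phi> rs] h_def[symmetric]
    by (simp only: integral_mult_right_zero)
  also have "\<dots> = (LINT q|lborel. (LINT x|lborel. u x * h q x))"
    by (rule lborel_pair.Fubini_integral[OF uh])
  also have "\<dots> = (LINT q|lborel. indicator {r..s} q *\<^sub>R pairing (laplacian \<phi>) q)"
    by (simp add: pairing_def h_def)
  finally show ?thesis .
qed

lemma pairing_lipschitz:
  assumes \<phi>: "schwartz \<phi>" and rs: "0 \<le> r" "r \<le> s"
  shows "norm (pairing \<phi> s - pairing \<phi> r) \<le> M * ((s - r) * L1_norm (laplacian \<phi>))"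
proof -
  have i: "integrable lborel (heat s \<phi>)" "integrable lborel (heat r \<phi>)"
    using heat_L1_contraction(1)[OF \<phi>] rs by auto
  then have "pairing \<phi> s - pairing \<phi> r = (LINT x|lborel. u x * (heat s \<phi> x - heat r \<phi> x))"
    unfolding pairing_def
    by (subst Bochner_Integration.integral_diff[symmetric]) (auto intro: integrable_u_mult simp: right_diff_distrib)
  also have "norm \<dots> \<le> M * (LINT x|lborel. norm (heat s \<phi> x - heat r \<phi> x))"
    using i by (intro norm_integral_u_mult_le) auto
  also have "\<dots> \<le> M * ((s - r) * L1_norm (laplacian \<phi>))"
    by (intro mult_left_mono heat_L1_difference \<phi> rs M_nonneg)
  finally show ?thesis .
qed

lemma pairing_continuous:
  assumes \<phi>: "schwartz \<phi>"
  shows "continuous_on {0..} (pairing \<phi>)"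
proof -
  define L where "L = M * L1_norm (laplacian \<phi>)"
  have "L-lipschitz_on {0..} (pairing \<phi>)"
  proof (rule lipschitz_onI)
    show "0 \<le> L" by (simp add: L_def M_nonneg)
    have *: "norm (pairing \<phi> s - pairing \<phi> r) \<le> L * (s - r)" if "0 \<le> r" "r \<le> s" for r s
      using pairing_lipschitz[OF \<phi> that] by (simp add: L_def mult_ac)
    show "dist (pairing \<phi> s) (pairing \<phi> r) \<le> L * dist s r" if "s \<in> {0..}" "r \<in> {0..}" for s r
      using *[of r s] *[of s r] that
      by (cases "r \<le> s") (auto simp: dist_norm dist_real_def norm_minus_commute abs_if)
  qed
  then show ?thesis by (rule lipschitz_on_continuous_on)
qed

lemma pairing_derivative:
  assumes \<phi>: "schwartz \<phi>" and s: "0 \<le> s"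
  shows "(pairing \<phi> has_vector_derivative pairing (laplacian \<phi>) s) (at s within {0..})"
proof -
  have c: "continuous_on {0..b} (pairing (laplacian \<phi>))" for b
    by (rule continuous_on_subset[OF pairing_continuous[OF schwartz_laplacian[OF \<phi>]]]) auto
  have eq: "pairing \<phi> q = pairing \<phi> 0 + integral {0..q} (pairing (laplacian \<phi>))" if "0 \<le> q" for q
  proof -
    have si: "set_integrable lborel {0..q} (pairing (laplacian \<phi>))"
      unfolding set_integrable_def by (rule borel_integrable_compact[OF _ c]) auto
    have "integral {0..q} (pairing (laplacian \<phi>)) = (LINT r|lborel. indicator {0..q} r *\<^sub>R pairing (laplacian \<phi>) r)"
      using set_borel_integral_eq_integral(2)[OF si] unfolding set_lebesgue_integral_def by (rule sym)
    then show ?thesis using pairing_diff[OF \<phi> order_refl that] by (simp add: algebra_simps)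
  qed
  have "((\<lambda>q. pairing \<phi> 0 + integral {0..q} (pairing (laplacian \<phi>))) has_vector_derivative pairing (laplacian \<phi>) s) (at s within {0..s+1})"
    using has_vector_derivative_add[OF has_vector_derivative_const integral_has_vector_derivative[OF c, of s "s + 1"]] s
    by simp
  then have "(pairing \<phi> has_vector_derivative pairing (laplacian \<phi>) s) (at s within {0..s+1})"
  proof (rule has_vector_derivative_transform[rotated 2])
    show "pairing \<phi> q = pairing \<phi> 0 + integral {0..q} (pairing (laplacian \<phi>))" if "q \<in> {0..s + 1}" for q
      using that by (intro eq) simp
  qed (use s in simp)
  moreover have "at s within {0..s+1} = at s within {0..}"
    by (rule at_within_nhd[where S="{..<s+1}"]) auto
  ultimately show ?thesis by simp
qed

text \<open>Outside a large ball \<open>u\<close> is small and the \<open>L\<^sup>1\<close> norm of \<open>heat s \<phi>\<close> stays bounded; on the ball \<open>heat s \<phi>\<close> is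
  uniformly small for large \<open>s\<close>. This is where the decay of \<open>u\<close> enters.\<close>

lemma pairing_tendsto_zero:
  assumes \<phi>: "schwartz \<phi>"
  shows "(pairing \<phi> \<longlongrightarrow> 0) at_top"
proof (rule tendstoI)
  fix e :: real assume e: "0 < e"
  obtain B where B: "\<And>s x. 0 \<le> s \<Longrightarrow> norm (heat s \<phi> x) \<le> B s" "(B \<longlongrightarrow> 0) at_top"
    using heat_sup_tendsto_zero[OF \<phi>] by metis
  define K where "K = L1_norm \<phi>"
  have K: "0 \<le> K" by (simp add: K_def)
  define \<epsilon> where "\<epsilon> = e / (2 * (K + 1))"
  have \<epsilon>: "0 < \<epsilon>" "\<epsilon> * K < e / 2"
    using e K by (auto simp: \<epsilon>_def field_simps)
  obtain R where R: "AE x in lborel. R \<le> norm x \<longrightarrow> norm (u x) < \<epsilon>" using u_vanishes[OF \<epsilon>(1)] by blast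
  define V where "V = measure lborel (cball (0 :: real^'n) R)"
  have "((\<lambda>s. M * B s * V) \<longlongrightarrow> M * 0 * V) at_top" by (intro tendsto_intros B)
  then have "\<forall>\<^sub>F s in at_top. M * B s * V < e / 2"
    using e by (intro order_tendstoD) auto
  then show "\<forall>\<^sub>F s in at_top. dist (pairing \<phi> s) 0 < e"
    using eventually_ge_at_top[of 0]
  proof eventually_elim
    case (elim s)
    note hi = heat_L1_contraction[OF \<phi> elim(2)]
    have fin: "emeasure lborel (cball (0 :: real^'n) R) < \<infinity>" by (rule emeasure_lborel_cball_finite)
    have ci: "integrable lborel (\<lambda>x. M * B s * indicator (cball (0::real^'n) R) x)"
      using fin by (intro integrable_mult_right integrable_real_indicator) auto
    have "norm (pairing \<phi> s) \<le> (LINT x|lborel. norm (u x * heat s \<phi> x))"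
      unfolding pairing_def by (rule integral_norm_bound)
    also have "\<dots> \<le> (LINT x|lborel. M * B s * indicator (cball 0 R) x + \<epsilon> * norm (heat s \<phi> x))"
    proof (rule integral_mono_AE)
      show "integrable lborel (\<lambda>x. norm (u x * heat s \<phi> x))" by (intro integrable_norm integrable_u_mult hi)
      show "integrable lborel (\<lambda>x. M * B s * indicator (cball 0 R) x + \<epsilon> * norm (heat s \<phi> x))"
        by (intro Bochner_Integration.integrable_add ci integrable_mult_right integrable_norm hi)
      show "AE x in lborel. norm (u x * heat s \<phi> x) \<le> M * B s * indicator (cball 0 R) x + \<epsilon> * norm (heat s \<phi> x)"
        using R
      proof eventually_elim
        case (elim x)
        have b: "norm (u x) * norm (heat s \<phi> x) \<le> M * B s"
          using u_bound[of x] B(1)[OF \<open>0 \<le> s\<close>, of x] M_nonneg by (intro mult_mono) auto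
        show ?case
        proof (cases "norm x \<le> R")
          case True
          then show ?thesis using b \<epsilon>(1) by (simp add: norm_mult add_increasing2)
        next
          case False
          then have "norm (u x) * norm (heat s \<phi> x) \<le> \<epsilon> * norm (heat s \<phi> x)"
            using elim by (intro mult_right_mono) auto
          then show ?thesis using False by (simp add: norm_mult)
        qed
      qed
    qed
    also have "\<dots> = M * B s * V + \<epsilon> * L1_norm (heat s \<phi>)"
      using ci hi fin by (subst Bochner_Integration.integral_add) (auto simp: V_def)
    also have "\<dots> \<le> M * B s * V + \<epsilon> * K"
      using hi(2) \<epsilon>(1) by (auto simp: K_def intro!: mult_left_mono)
    finally show ?case using elim(1) \<epsilon>(2) by simp
  qed
qed

lemma pairing_gauss:
  "0 < t \<Longrightarrow> 0 \<le> s \<Longrightarrow> pairing (gauss t x) s = pairing (gauss (t + s) x) 0"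
  by (simp add: pairing_def heat_gauss)

lemma pairing_laplacian_gauss:
  "0 < t \<Longrightarrow> 0 \<le> s \<Longrightarrow> pairing (laplacian (gauss t x)) s = pairing (laplacian (gauss (t + s) x)) 0"
  by (simp add: pairing_def heat_laplacian_gauss)

text \<open>By the symmetry of the heat kernel, the flow may be moved from \<open>\<phi>\<close> to \<open>u\<close>. Hence what is known for all
  Gaussians transfers to every Schwartz function.\<close>

lemma pairing_eq_gauss:
  assumes \<phi>: "schwartz \<phi>" and s: "0 < s"
  shows "pairing \<phi> s = (LINT x|lborel. \<phi> x * pairing (gauss s x) 0)"
proof -
  note [measurable] = schwartz_measurable[OF \<phi>]
  define h where "h x y = \<phi> x * (u y * complex_of_real (heat_kernel s (y - x)))" for x y
  have gi: "integrable lborel (\<lambda>y. complex_of_real (heat_kernel s (y - x)))" for x :: "real^'n"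
    using heat_kernel_shift(1)[OF s] by (rule integrable_of_real)
  have h: "integrable (lborel \<Otimes>\<^sub>M lborel) (case_prod h)"
  proof (rule integrable_if_slices)
    show "case_prod h \<in> borel_measurable (lborel \<Otimes>\<^sub>M lborel)"
      unfolding h_def by measurable
    show hi: "integrable lborel (h x)" for x
      unfolding h_def[abs_def] by (intro integrable_mult_right integrable_u_mult gi)
    show "integrable lborel (\<lambda>x. norm (\<phi> x) * M)"
      using schwartz_integrable[OF \<phi>] by simp
    show "(LINT y|lborel. norm (h x y)) \<le> norm (\<phi> x) * M" for x
    proof -
      have "(LINT y|lborel. norm (h x y)) \<le> (LINT y|lborel. norm (\<phi> x) * M * heat_kernel s (y - x))"
      proof (rule integral_mono)
        show "integrable lborel (\<lambda>y. norm (h x y))" by (rule integrable_norm[OF hi])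
        show "integrable lborel (\<lambda>y. norm (\<phi> x) * M * heat_kernel s (y - x))"
          by (rule integrable_mult_right[OF heat_kernel_shift(1)[OF s]])
        fix y
        have k: "0 \<le> heat_kernel s (y - x)" using s by (intro heat_kernel_nonneg) simp
        then have "norm (\<phi> x) * (norm (u y) * heat_kernel s (y - x)) \<le> norm (\<phi> x) * (M * heat_kernel s (y - x))"
          by (intro mult_left_mono mult_right_mono u_bound) auto
        then show "norm (h x y) \<le> norm (\<phi> x) * M * heat_kernel s (y - x)"
          using k by (simp add: h_def norm_mult mult.assoc)
      qed
      then show ?thesis using heat_kernel_shift(2)[OF s, of x] by simp
    qed
  qed
  have "pairing \<phi> s = (LINT y|lborel. (LINT x|lborel. h x y))"
    unfolding pairing_def
  proof (rule Bochner_Integration.integral_cong[OF refl])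
    fix y
    have "(LINT x|lborel. h x y) = (LINT x|lborel. u y * (complex_of_real (heat_kernel s (y - x)) * \<phi> x))"
      by (intro Bochner_Integration.integral_cong) (simp_all add: h_def)
    then show "u y * heat s \<phi> y = (LINT x|lborel. h x y)"
      by (simp only: integral_mult_right_zero heat_eq_convolution[OF schwartz_integrable[OF \<phi>] s])
  qed
  also have "\<dots> = (LINT x|lborel. (LINT y|lborel. h x y))"
    by (rule lborel_pair.Fubini_integral[OF h])
  also have "\<dots> = (LINT x|lborel. \<phi> x * pairing (gauss s x) 0)"
    unfolding pairing_0[OF schwartz_gauss[OF s]] h_def gauss_def integral_mult_right_zero by (rule refl)
  finally show ?thesis .
qed

text \<open>The weak form of \<open>P\<^sub>s u = exp (- s) u\<close>.\<close>

definition heat_eigenfunction :: bool where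
  "heat_eigenfunction \<longleftrightarrow> (\<forall>\<phi>. schwartz \<phi> \<longrightarrow> (\<forall>s\<ge>0. pairing \<phi> s = exp (- s) *\<^sub>R pairing \<phi> 0))"

text \<open>Superposing Gaussians of width \<open>t\<close> gives the relation between the times \<open>t + s\<close> and \<open>t\<close> on the orbit of an
  arbitrary \<open>\<phi>\<close>; then let \<open>t \<rightarrow> 0\<close>.\<close>

lemma heat_eigenfunction_if_gauss:
  assumes "\<And>t x s. 0 < t \<Longrightarrow> 0 \<le> s \<Longrightarrow> pairing (gauss t x) s = exp (- s) *\<^sub>R pairing (gauss t x) 0"
  shows heat_eigenfunction
  unfolding heat_eigenfunction_def
proof (intro allI impI)
  fix \<phi> :: "real^'n \<Rightarrow> complex" and s :: real assume \<phi>: "schwartz \<phi>" and s: "0 \<le> s"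
  have eq: "pairing \<phi> (t + s) = exp (- s) *\<^sub>R pairing \<phi> t" if t: "0 < t" for t
  proof -
    have ts: "0 < t + s" using t s by simp
    have "\<phi> x * pairing (gauss (t + s) x) 0 = complex_of_real (exp (- s)) * (\<phi> x * pairing (gauss t x) 0)" for x
      unfolding pairing_gauss[OF t s, symmetric] assms[OF t s] by (simp add: scaleR_conv_of_real)
    then show ?thesis
      unfolding pairing_eq_gauss[OF \<phi> t] pairing_eq_gauss[OF \<phi> ts] scaleR_conv_of_real
      by (simp only: integral_mult_right_zero)
  qed
  have lim: "((\<lambda>t. pairing \<phi> (t + r)) \<longlongrightarrow> pairing \<phi> r) (at_right 0)" if "0 \<le> r" for r
  proof -
    have "continuous_on {0..} (\<lambda>t. pairing \<phi> (t + r))"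
      by (rule continuous_on_compose2[OF pairing_continuous[OF \<phi>]]) (use that in \<open>auto intro!: continuous_intros\<close>)
    then have "((\<lambda>t. pairing \<phi> (t + r)) \<longlongrightarrow> pairing \<phi> (0 + r)) (at 0 within {0..})"
      unfolding continuous_on_def by (rule bspec) simp
    then show ?thesis by (simp add: at_within_Ici_at_right)
  qed
  have "((\<lambda>t. exp (- s) *\<^sub>R pairing \<phi> t) \<longlongrightarrow> pairing \<phi> s) (at_right 0)"
    using lim[OF s] by (rule Lim_transform_eventually) (auto simp: eventually_at_filter eq)
  moreover have "((\<lambda>t. exp (- s) *\<^sub>R pairing \<phi> t) \<longlongrightarrow> exp (- s) *\<^sub>R pairing \<phi> 0) (at_right 0)"
    using lim[of 0] by (intro tendsto_intros) auto
  ultimately show "pairing \<phi> s = exp (- s) *\<^sub>R pairing \<phi> 0"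
    by (rule tendsto_unique[rotated]) simp
qed

lemma pairing_eq_exp_if_derivative:
  assumes \<phi>: "schwartz \<phi>" and eq: "\<And>s. 0 \<le> s \<Longrightarrow> pairing (laplacian \<phi>) s = - pairing \<phi> s" and s: "0 \<le> s"
  shows "pairing \<phi> s = exp (- s) *\<^sub>R pairing \<phi> 0"
proof -
  have "((\<lambda>q. exp q *\<^sub>R pairing \<phi> q) has_vector_derivative 0) (at q within {0..})" if "q \<in> {0..}" for q
  proof -
    have "((\<lambda>q. exp q *\<^sub>R pairing \<phi> q) has_vector_derivative exp q *\<^sub>R pairing (laplacian \<phi>) q + exp q *\<^sub>R pairing \<phi> q) (at q within {0..})"
      using that by (intro has_vector_derivative_scaleR pairing_derivative \<phi>) (auto intro!: derivative_eq_intros)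
    then show ?thesis using that eq by simp
  qed
  then obtain c where c: "\<And>q. q \<in> {0..} \<Longrightarrow> exp q *\<^sub>R pairing \<phi> q = c"
    using has_vector_derivative_zero_constant[of "{0::real..}" "\<lambda>q. exp q *\<^sub>R pairing \<phi> q"] by (metis convex_real_interval(1))
  from c[of 0] c[of s] s have "exp s *\<^sub>R pairing \<phi> s = pairing \<phi> 0" by simp
  then have "exp (- s) *\<^sub>R pairing \<phi> 0 = (exp (- s) * exp s) *\<^sub>R pairing \<phi> s" by (metis scaleR_scaleR)
  then show ?thesis by (simp flip: exp_add)
qed

lemma neg_laplacian_distr_eq_pairing: "schwartz \<phi> \<Longrightarrow> neg_laplacian_distr u \<phi> = - pairing (laplacian \<phi>) 0"
  using distribution_of_eq_pairing[OF schwartz_laplacian]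
  by (simp add: neg_laplacian_distr_def distribution_of_def)

text \<open>Along the orbit of a Gaussian every time gives an admissible test function, so the Helmholtz equation becomes the
  differential equation \<open>G' = - G\<close>. Conversely, differentiate \<open>exp (- s)\<close> at \<open>s = 0\<close>.\<close>

theorem solves_helmholtz_iff: "solves_helmholtz u \<longleftrightarrow> heat_eigenfunction"
proof
  assume H: "solves_helmholtz u"
  have eq: "pairing (laplacian \<phi>) 0 = - pairing \<phi> 0" if "schwartz \<phi>" for \<phi>
    using H that unfolding solves_helmholtz_def
    by (metis neg_laplacian_distr_eq_pairing distribution_of_eq_pairing minus_equation_iff)
  show heat_eigenfunction
  proof (rule heat_eigenfunction_if_gauss)
    fix t s :: real and x :: "real^'n" assume t: "0 < t" and s: "0 \<le> s"
    show "pairing (gauss t x) s = exp (- s) *\<^sub>R pairing (gauss t x) 0"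
    proof (rule pairing_eq_exp_if_derivative[OF schwartz_gauss[OF t] _ s])
      fix q :: real assume q: "0 \<le> q"
      then have "schwartz (gauss (t + q) x)" using t by (intro schwartz_gauss) simp
      then show "pairing (laplacian (gauss t x)) q = - pairing (gauss t x) q"
        unfolding pairing_gauss[OF t q] pairing_laplacian_gauss[OF t q] by (rule eq)
    qed
  qed
next
  assume H: heat_eigenfunction
  have eq: "pairing (laplacian \<phi>) 0 = - pairing \<phi> 0" if \<phi>: "schwartz \<phi>" for \<phi>
  proof -
    have "((\<lambda>s. exp (- s) *\<^sub>R pairing \<phi> 0) has_vector_derivative - pairing \<phi> 0) (at 0 within {0..})"
      by (auto intro!: derivative_eq_intros)
    then have "(pairing \<phi> has_vector_derivative - pairing \<phi> 0) (at 0 within {0..})"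
    proof (rule has_vector_derivative_transform[rotated 2])
      show "pairing \<phi> s = exp (- s) *\<^sub>R pairing \<phi> 0" if "s \<in> {0..}" for s
        using H \<phi> that unfolding heat_eigenfunction_def by blast
    qed simp
    with pairing_derivative[OF \<phi> order_refl] show ?thesis
      by (intro vector_derivative_unique_within[of 0 "{0..}" "pairing \<phi>"]) (auto simp: at_within_Ici_at_right)
  qed
  then show "solves_helmholtz u"
    unfolding solves_helmholtz_def by (simp add: neg_laplacian_distr_eq_pairing distribution_of_eq_pairing)
qed

end

section \<open>A maximum principle for decreasing Levy densities\<close>

text \<open>The density of a Levy measure on \<open>(0,\<infinity>)\<close> that decreases, extended by \<open>0\<close>. It need not be integrable near \<open>0\<close>, nor
  need \<open>s p s\<close> be bounded there: for \<open>\<psi> t = t\<^sup>\<sigma>\<close> with \<open>0 < \<sigma> < 1\<close> it is a multiple of \<open>s\<close> to the power \<open>- 1 - \<sigma>\<close>.\<close>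

locale levy_density =
  fixes p p' :: "real \<Rightarrow> real"
  assumes p_measurable [measurable]: "p \<in> borel_measurable borel"
    and p_nonneg: "\<And>s. 0 \<le> p s"
    and p_nonpos: "\<And>s. s \<le> 0 \<Longrightarrow> p s = 0"
    and p_deriv: "\<And>s. 0 < s \<Longrightarrow> (p has_real_derivative p' s) (at s)"
    and p'_nonpos: "\<And>s. 0 < s \<Longrightarrow> p' s \<le> 0"
    and p'_continuous: "continuous_on {0<..} p'"
    and p_integrable: "integrable lborel (\<lambda>s. min 1 s * p s)"
begin

lemma p_antimono: "0 < r \<Longrightarrow> r \<le> s \<Longrightarrow> p s \<le> p r"
  by (rule DERIV_nonpos_imp_nonincreasing[of r s p])
     (auto intro!: exI p_deriv p'_nonpos)

lemma integrable_times_density: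
  fixes g :: "real \<Rightarrow> 'b::{banach, second_countable_topology}"
  assumes [measurable]: "(\<lambda>s. indicator {0..} s *\<^sub>R g s) \<in> borel_measurable borel"
    and bound: "\<And>s. 0 \<le> s \<Longrightarrow> norm (g s) \<le> C * min 1 s"
  shows "integrable lborel (\<lambda>s. p s *\<^sub>R g s)"
proof (rule Bochner_Integration.integrable_bound)
  show "integrable lborel (\<lambda>s. C * (min 1 s * p s))" using p_integrable by (rule integrable_mult_right)
  have eq: "p s *\<^sub>R g s = p s *\<^sub>R (indicator {0..} s *\<^sub>R g s)" for s
    using p_nonpos[of s] by (cases "0 \<le> s") auto
  show "(\<lambda>s. p s *\<^sub>R g s) \<in> borel_measurable lborel"
    unfolding eq by measurable
  have "norm (p s *\<^sub>R g s) \<le> C * (min 1 s * p s)" for s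
  proof (cases "0 \<le> s")
    case True
    then have "p s * norm (g s) \<le> p s * (C * min 1 s)"
      by (intro mult_left_mono bound p_nonneg)
    then show ?thesis using p_nonneg[of s] by (simp add: mult_ac)
  qed (simp add: p_nonpos)
  then show "AE s in lborel. norm (p s *\<^sub>R g s) \<le> norm (C * (min 1 s * p s))"
    by (auto intro!: AE_I2 order_trans[OF _ abs_ge_self])
qed

text \<open>On \<open>[e/2, e]\<close> the monotone function \<open>p\<close> is at least \<open>p e\<close>. As the right-hand side tends to \<open>0\<close> with \<open>e\<close>, so does
  \<open>p e * e\<^sup>2\<close>, which controls the boundary term in the integration by parts below.\<close>

lemma density_near_zero:
  assumes e: "0 < e" "e \<le> 1"
  shows "p e * e\<^sup>2 \<le> 4 * (LINT s|lborel. indicator {..e} s *\<^sub>R (min 1 s * p s))"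
proof -
  have "p e * e\<^sup>2 / 4 = (LINT s|lborel. indicator {e/2..e} s *\<^sub>R ((e / 2) * p e))"
    using e by (simp add: power2_eq_square)
  also have "\<dots> \<le> (LINT s|lborel. indicator {..e} s *\<^sub>R (min 1 s * p s))"
  proof (rule integral_mono)
    show "integrable lborel (\<lambda>s. indicator {e/2..e} s *\<^sub>R ((e / 2) * p e))"
      by (intro integrable_scaleR_left integrable_real_indicator) (use e in auto)
    show "integrable lborel (\<lambda>s. indicator {..e} s *\<^sub>R (min 1 s * p s))"
      by (rule integrable_mult_indicator[OF _ p_integrable]) simp
    fix s
    show "indicator {e/2..e} s *\<^sub>R ((e / 2) * p e) \<le> indicator {..e} s *\<^sub>R (min 1 s * p s)"
    proof (cases "s \<in> {e/2..e}")
      case True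
      then have "p e \<le> p s" "e / 2 \<le> min 1 s" using e by (auto intro!: p_antimono)
      then have "(e / 2) * p e \<le> min 1 s * p s" using e p_nonneg by (intro mult_mono) auto
      then show ?thesis using True by simp
    next
      case False
      have "0 \<le> min 1 s * p s" using p_nonneg[of s] p_nonpos[of s] by (cases "0 \<le> s") auto
      then show ?thesis using False by (auto simp: indicator_def)
    qed
  qed
  finally show ?thesis by simp
qed

text \<open>Suppose that \<open>h = F + F1\<close> takes a positive value and let \<open>t\<close> be its last maximum point. The function
  \<open>Y s = F (t + s) - exp (- s) F t - h t (1 - exp (- s))\<close> solves \<open>Y' + Y = h (t + s) - h t\<close> with \<open>Y 0 = 0\<close>; the
  right-hand side is negative, hence \<open>Y s < 0\<close> for \<open>s > 0\<close>. Moreover \<open>Y' s = F1 (t + s) - exp (- s) F1 t\<close>, so the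
  hypothesis says that \<open>\<integral> p Y' = 0\<close>. But integrating by parts, \<open>\<integral> p Y' = - \<integral> p' Y\<close>, and this is strictly negative
  because \<open>p' \<le> 0\<close> and \<open>p\<close> drops on \<open>[a, b]\<close>.

  The boundary term at \<open>0\<close> vanishes because \<open>Y\<close> is quadratically small there, which is the reason for the bound on
  the second derivative \<open>F2\<close>.\<close>

lemma maximum_principle:
  fixes F F1 F2 :: "real \<Rightarrow> real"
  assumes F: "\<And>t. 0 \<le> t \<Longrightarrow> (F has_real_derivative F1 t) (at t within {0..})"
    and F1: "\<And>t. 0 \<le> t \<Longrightarrow> (F1 has_real_derivative F2 t) (at t within {0..})"
    and B1: "\<And>t. 0 \<le> t \<Longrightarrow> \<bar>F1 t\<bar> \<le> B" and B2: "\<And>t. 0 \<le> t \<Longrightarrow> \<bar>F2 t\<bar> \<le> B"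
    and limF: "(F \<longlongrightarrow> 0) at_top" and limF1: "(F1 \<longlongrightarrow> 0) at_top"
    and eqn: "\<And>t. 0 \<le> t \<Longrightarrow> (LINT s|lborel. p s *\<^sub>R (F1 (t + s) - exp (- s) * F1 t)) = 0"
    and ab: "0 < a" "a < b" "p b < p a"
    and \<tau>: "0 \<le> \<tau>"
  shows "F \<tau> + F1 \<tau> \<le> 0"
proof (rule ccontr)
  define h where "h t = F t + F1 t" for t
  assume "\<not> ?thesis"
  then have h\<tau>: "0 < h \<tau>" by (simp add: h_def)
  have contF: "continuous_on {0..} F" and contF1: "continuous_on {0..} F1"
    using DERIV_continuous_on[of "{0..}" F F1] DERIV_continuous_on[of "{0..}" F1 F2] F F1 by auto
  then have conth: "continuous_on {0..} h"
    unfolding h_def[abs_def] by (intro continuous_intros)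
  have "(h \<longlongrightarrow> 0 + 0) at_top"
    unfolding h_def[abs_def] by (intro tendsto_intros limF limF1)
  then have "\<forall>\<^sub>F t in at_top. h t < h \<tau>"
    using h\<tau> by (intro order_tendstoD) auto
  then obtain T0 where T0: "\<And>t. T0 \<le> t \<Longrightarrow> h t < h \<tau>"
    by (auto simp: eventually_at_top_linorder)
  define T where "T = max T0 \<tau>"
  have T: "\<tau> \<le> T" by (simp add: T_def)
  have "\<exists>m\<in>{0..T}. \<forall>t\<in>{0..T}. h t \<le> h m"
    using \<tau> T by (intro continuous_attains_sup continuous_on_subset[OF conth]) auto
  then obtain m where m: "m \<in> {0..T}" "\<And>t. t \<in> {0..T} \<Longrightarrow> h t \<le> h m" by blast
  \<comment> \<open>The last maximum point is the supremum of the compact set of all maximum points.\<close>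
  define K where "K = {0..T} \<inter> h -` {h m}"
  have "closed K"
    unfolding K_def by (intro continuous_closed_preimage continuous_on_subset[OF conth]) auto
  moreover have "bdd_above K" "K \<noteq> {}" using m by (auto simp: K_def)
  ultimately have "Sup K \<in> K" by (intro closed_contains_Sup)
  define t where "t = Sup K"
  have t: "0 \<le> t" "t \<le> T" "h t = h m"
    using \<open>Sup K \<in> K\<close> by (auto simp: K_def t_def)
  have hmax: "h r < h t" if r: "t < r" for r
  proof (cases "r \<le> T")
    case True
    then have "h r \<le> h m" using m(2)[of r] r t by auto
    moreover have "h r \<noteq> h m"
    proof
      assume "h r = h m"
      then have "r \<in> K" using True r t by (auto simp: K_def)
      then have "r \<le> t" unfolding t_def by (intro cSup_upper \<open>bdd_above K\<close>)
      then show False using r by simp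
    qed
    ultimately show ?thesis using t by simp
  next
    case False
    then have "h r < h \<tau>" by (intro T0) (simp add: T_def)
    also have "\<dots> \<le> h m" using m(2)[of \<tau>] \<tau> T by auto
    finally show ?thesis using t by simp
  qed
  define Y where "Y s = F (t + s) - exp (- s) * F t - h t * (1 - exp (- s))" for s
  define Y' where "Y' s = F1 (t + s) - exp (- s) * F1 t" for s
  have shift: "((\<lambda>s. G (t + s)) has_real_derivative G' (t + s)) (at s within {0..})"
    if "0 \<le> s" and G: "\<And>r. 0 \<le> r \<Longrightarrow> (G has_real_derivative G' r) (at r within {0..})" for G G' s
  proof -
    have "(G has_real_derivative G' (t + s)) (at (t + s) within (\<lambda>s. t + s) ` {0..})"
      by (rule DERIV_subset[OF G]) (use that t in auto)
    then have "((G \<circ> (\<lambda>s. t + s)) has_real_derivative G' (t + s) * 1) (at s within {0..})"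
      by (rule DERIV_image_chain) (auto intro!: derivative_eq_intros)
    then show ?thesis by (simp add: o_def)
  qed
  have Y_deriv: "(Y has_real_derivative Y' s) (at s within {0..})" if s: "0 \<le> s" for s
  proof -
    have ex: "((\<lambda>s::real. exp (- s)) has_real_derivative - exp (- s)) (at s within {0..})"
      by (auto intro!: derivative_eq_intros)
    have "(Y has_real_derivative F1 (t + s) - (- exp (- s)) * F t - h t * (0 - (- exp (- s)))) (at s within {0..})"
      unfolding Y_def[abs_def]
      by (intro DERIV_diff DERIV_cmult DERIV_cmult_right DERIV_const ex shift[OF s F])
    then show ?thesis by (simp add: Y'_def h_def algebra_simps)
  qed
  have Y_contl: "continuous_on {0..} Y" by (rule DERIV_continuous_on[OF Y_deriv]) simp
  have Y'_cont: "continuous_on {0..} Y'"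
    unfolding Y'_def[abs_def]
    by (intro continuous_intros continuous_on_compose2[OF contF1]) (use t in auto)
  have at_eq: "at s within {0..} = at s" if "0 < s" for s :: real
    using that by (intro at_within_interior) (simp add: interior_real_atLeast)
  have Y_neg: "Y s < 0" if s: "0 < s" for s
  proof -
    \<comment> \<open>The derivative of \<open>exp s * Y s\<close> is \<open>exp s * (Y s + Y' s)\<close>.\<close>
    have "exp s * Y s < exp 0 * Y 0"
    proof (rule DERIV_neg_imp_decreasing_open[OF s])
      fix r assume r: "0 < r" "r < s"
      have "((\<lambda>s. exp s * Y s) has_real_derivative exp r * (Y r + Y' r)) (at r)"
        using Y_deriv[of r] r by (auto intro!: derivative_eq_intros simp: at_eq algebra_simps)
      moreover have "Y r + Y' r = h (t + r) - h t"
        by (simp add: Y_def Y'_def h_def algebra_simps)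
      then have "exp r * (Y r + Y' r) < 0"
        using hmax[of "t + r"] r by (simp add: mult_pos_neg)
      ultimately show "\<exists>y. ((\<lambda>s. exp s * Y s) has_real_derivative y) (at r) \<and> y < 0" by blast
    qed (intro continuous_intros continuous_on_subset[OF Y_contl], auto)
    then show ?thesis by (simp add: Y_def mult_less_0_iff)
  qed
  have B: "0 \<le> B" using B1[of 0] by auto
  have F1_lip: "\<bar>F1 (t + s) - F1 t\<bar> \<le> B * s" if "0 \<le> s" for s
    using field_differentiable_bound[of "{0..}" F1 F2 B "t + s" t] F1 B2 t that by auto
  have exp_le: "\<bar>1 - exp (- s)\<bar> \<le> s" if "0 \<le> s" for s :: real
    using exp_ge_add_one_self[of "- s"] that by auto
  have Y'_lip: "\<bar>Y' s\<bar> \<le> 2 * B * s" if s: "0 \<le> s" for s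
  proof -
    have "\<bar>(1 - exp (- s)) * F1 t\<bar> \<le> s * B"
      unfolding abs_mult by (intro mult_mono exp_le B1 t s) auto
    moreover have "Y' s = (F1 (t + s) - F1 t) + (1 - exp (- s)) * F1 t"
      by (simp add: Y'_def algebra_simps)
    ultimately have "\<bar>Y' s\<bar> \<le> B * s + s * B" using F1_lip[OF s] by linarith
    then show ?thesis by simp
  qed
  have Y'_bd: "\<bar>Y' s\<bar> \<le> 2 * B" if s: "0 \<le> s" for s
  proof -
    have "\<bar>exp (- s) * F1 t\<bar> \<le> 1 * B"
      unfolding abs_mult by (intro mult_mono B1 t) (use s in auto)
    then show ?thesis using B1[of "t + s"] s t unfolding Y'_def by linarith
  qed
  have Y_sq: "\<bar>Y s\<bar> \<le> 2 * B * s\<^sup>2" if s: "0 \<le> s" for s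
  proof -
    have "norm (Y s - Y 0) \<le> (2 * B * s) * norm (s - 0)"
    proof (rule field_differentiable_bound[of "{0..s}"])
      show "(Y has_field_derivative Y' r) (at r within {0..s})" if "r \<in> {0..s}" for r
        using that by (intro DERIV_subset[OF Y_deriv]) auto
      show "norm (Y' r) \<le> 2 * B * s" if "r \<in> {0..s}" for r
      proof -
        have "2 * B * r \<le> 2 * B * s" using that B by (intro mult_left_mono) auto
        then show ?thesis using Y'_lip[of r] that by simp
      qed
    qed (use s in auto)
    then show ?thesis using s by (simp add: Y_def power2_eq_square mult.assoc)
  qed
  have pY'_int: "integrable lborel (\<lambda>s. p s *\<^sub>R Y' s)"
  proof (rule integrable_times_density)
    show "(\<lambda>s. indicator {0..} s *\<^sub>R Y' s) \<in> borel_measurable borel"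
      by (rule borel_measurable_continuous_on_indicator[OF _ Y'_cont]) simp
    show "norm (Y' s) \<le> (2 * B) * min 1 s" if "0 \<le> s" for s
      using Y'_lip[OF that] Y'_bd[OF that] by (auto simp: min_def)
  qed
  have pY'_zero: "(LINT s|lborel. p s *\<^sub>R Y' s) = 0"
    using eqn[OF t(1)] by (simp add: Y'_def)
  have "\<exists>m\<in>{a..b}. \<forall>s\<in>{a..b}. Y s \<le> Y m"
    using ab by (intro continuous_attains_sup continuous_on_subset[OF Y_contl]) auto
  then obtain \<eta> where \<eta>: "0 < \<eta>" "\<And>s. s \<in> {a..b} \<Longrightarrow> \<eta> \<le> - Y s"
    using Y_neg ab by (metis atLeastAtMost_iff neg_0_less_iff_less neg_le_iff_le order_less_le_trans)
  \<comment> \<open>A lower bound for \<open>\<integral> p' Y\<close> over \<open>[a, b]\<close>, with \<open>- Y \<ge> \<eta>\<close> there.\<close>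
  define \<kappa> where "\<kappa> = \<eta> * (p a - p b)"
  have \<kappa>: "0 < \<kappa>" using \<eta> ab by (simp add: \<kappa>_def)
  have p_cont: "continuous_on {0<..} p"
    by (rule DERIV_continuous_on[where D=p']) (auto intro: DERIV_subset p_deriv has_field_derivative_at_within)
  have main: "(LINT s|lborel. indicator {e..S} s *\<^sub>R (p s *\<^sub>R Y' s)) \<le> 2 * B * (p e * e\<^sup>2) - \<kappa>"
    if e: "0 < e" "e \<le> a" "b \<le> S" for e S
  proof -
    have sub: "{e..S} \<subseteq> {0<..}" "{e..S} \<subseteq> {0..}" using e by auto
    have eS: "e \<le> S" using e ab by simp
    have c1: "continuous_on {e..S} (\<lambda>s. p' s * Y s)" and c2: "continuous_on {e..S} (\<lambda>s. p s *\<^sub>R Y' s)"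
      using sub
      by (auto intro!: continuous_intros continuous_on_subset[OF p'_continuous] continuous_on_subset[OF p_cont]
          continuous_on_subset[OF Y_contl] continuous_on_subset[OF Y'_cont])
    have i1: "integrable lborel (\<lambda>s. indicator {e..S} s *\<^sub>R (p' s * Y s))"
      and i2: "integrable lborel (\<lambda>s. indicator {e..S} s *\<^sub>R (p s *\<^sub>R Y' s))"
      by (rule borel_integrable_compact[OF _ c1], simp) (rule borel_integrable_compact[OF _ c2], simp)
    have "(LINT s|lborel. indicator {e..S} s *\<^sub>R (p' s * Y s + p s *\<^sub>R Y' s)) = p S * Y S - p e * Y e"
    proof (rule integral_FTC_Icc[OF eS])
      show "continuous_on {e..S} (\<lambda>s. p' s * Y s + p s *\<^sub>R Y' s)" by (intro continuous_on_add c1 c2)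
      fix s assume "e \<le> s" "s \<le> S"
      then have s: "0 < s" using e by simp
      have "((\<lambda>s. p s * Y s) has_real_derivative p' s * Y s + p s *\<^sub>R Y' s) (at s)"
        using DERIV_mult[OF p_deriv[OF s], of Y "Y' s"] Y_deriv[of s] s by (simp add: at_eq algebra_simps)
      then show "((\<lambda>s. p s * Y s) has_vector_derivative p' s * Y s + p s *\<^sub>R Y' s) (at s within {e..S})"
        by (auto simp: has_real_derivative_iff_has_vector_derivative intro: has_vector_derivative_at_within)
    qed
    then have eq: "(LINT s|lborel. indicator {e..S} s *\<^sub>R (p s *\<^sub>R Y' s)) =
        p S * Y S - p e * Y e - (LINT s|lborel. indicator {e..S} s *\<^sub>R (p' s * Y s))"
      using i1 i2 by (simp add: scaleR_add_right distrib_left)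
    have Ip': "(LINT s|lborel. indicator {a..b} s *\<^sub>R p' s) = p b - p a"
    proof (rule integral_FTC_Icc)
      show "continuous_on {a..b} p'" by (rule continuous_on_subset[OF p'_continuous]) (use ab in auto)
      show "(p has_vector_derivative p' s) (at s within {a..b})" if "a \<le> s" "s \<le> b" for s
        using p_deriv[of s] that ab
        by (auto simp: has_real_derivative_iff_has_vector_derivative intro: has_vector_derivative_at_within)
    qed (use ab in simp)
    have ip': "integrable lborel (\<lambda>s. indicator {a..b} s *\<^sub>R p' s)"
      by (rule borel_integrable_compact[OF _ continuous_on_subset[OF p'_continuous]]) (use ab in auto)
    have "\<kappa> = (LINT s|lborel. - \<eta> * (indicator {a..b} s *\<^sub>R p' s))"
      unfolding integral_mult_right_zero Ip' by (simp add: \<kappa>_def algebra_simps)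
    also have "\<dots> \<le> (LINT s|lborel. indicator {e..S} s *\<^sub>R (p' s * Y s))"
    proof (rule integral_mono[OF integrable_mult_right[OF ip'] i1])
      fix s
      show "- \<eta> * (indicator {a..b} s *\<^sub>R p' s) \<le> indicator {e..S} s *\<^sub>R (p' s * Y s)"
      proof (cases "s \<in> {a..b}")
        case True
        then have "s \<in> {e..S}" "0 < s" using e ab by auto
        moreover have "p' s * Y s \<ge> - \<eta> * p' s"
          using mult_right_mono_neg[of "Y s" "- \<eta>" "p' s"] \<eta>(2)[OF True] p'_nonpos[OF \<open>0 < s\<close>]
          by (simp add: mult.commute)
        ultimately show ?thesis using True by simp
      next
        case False
        have "0 \<le> p' s * Y s" if "s \<in> {e..S}"
          using p'_nonpos[of s] Y_neg[of s] that e by (intro mult_nonpos_nonpos) auto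
        then show ?thesis using False by (auto simp: indicator_def)
      qed
    qed
    finally have 1: "\<kappa> \<le> (LINT s|lborel. indicator {e..S} s *\<^sub>R (p' s * Y s))" .
    have 2: "p S * Y S \<le> 0"
      using Y_neg[of S] p_nonneg[of S] e ab by (intro mult_nonneg_nonpos) auto
    have "p e * (- Y e) \<le> p e * (2 * B * e\<^sup>2)"
      using Y_sq[of e] e by (intro mult_left_mono p_nonneg) auto
    then have 3: "- (p e * Y e) \<le> 2 * B * (p e * e\<^sup>2)" by (simp add: mult_ac)
    from 1 2 3 show ?thesis unfolding eq by linarith
  qed
  \<comment> \<open>Exhaust \<open>(0,\<infinity>)\<close> by \<open>[e n, n]\<close>.\<close>
  define e where "e n = inverse (real (Suc n))" for n
  have e: "0 < e n" "e n \<le> 1" for n by (auto simp: e_def field_simps)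
  have e0: "e \<longlonglongrightarrow> 0" unfolding e_def[abs_def] by (rule LIMSEQ_inverse_real_of_nat)
  have lim1: "(\<lambda>n. LINT s|lborel. indicator {e n..real n} s *\<^sub>R (p s *\<^sub>R Y' s)) \<longlonglongrightarrow> (LINT s|lborel. p s *\<^sub>R Y' s)"
  proof (rule integral_dominated_convergence)
    show "integrable lborel (\<lambda>s. norm (p s *\<^sub>R Y' s))" using pY'_int by simp
    show "AE s in lborel. (\<lambda>n. indicator {e n..real n} s *\<^sub>R (p s *\<^sub>R Y' s)) \<longlonglongrightarrow> p s *\<^sub>R Y' s"
    proof (rule AE_I2)
      fix s :: real
      show "(\<lambda>n. indicator {e n..real n} s *\<^sub>R (p s *\<^sub>R Y' s)) \<longlonglongrightarrow> p s *\<^sub>R Y' s"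
      proof (cases "0 < s")
        case True
        have "\<forall>\<^sub>F n in sequentially. e n < s" using e0 True by (intro order_tendstoD) auto
        moreover have "\<forall>\<^sub>F n in sequentially. s \<le> real n"
          using filterlim_real_sequentially by (simp add: filterlim_at_top)
        ultimately have "\<forall>\<^sub>F n in sequentially. p s *\<^sub>R Y' s = indicator {e n..real n} s *\<^sub>R (p s *\<^sub>R Y' s)"
          by eventually_elim auto
        then show ?thesis by (rule Lim_transform_eventually[OF tendsto_const])
      qed (simp add: p_nonpos)
    qed
    show "AE s in lborel. norm (indicator {e n..real n} s *\<^sub>R (p s *\<^sub>R Y' s)) \<le> norm (p s *\<^sub>R Y' s)" for n
      by (auto simp: indicator_def)
    show "(\<lambda>s. p s *\<^sub>R Y' s) \<in> borel_measurable lborel" using pY'_int by simp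
    then show "(\<lambda>s. indicator {e n..real n} s *\<^sub>R (p s *\<^sub>R Y' s)) \<in> borel_measurable lborel" for n
      by measurable
  qed
  have lim2: "(\<lambda>n. LINT s|lborel. indicator {..e n} s *\<^sub>R (min 1 s * p s)) \<longlonglongrightarrow> (LINT s::real|lborel. (0::real))"
  proof (rule integral_dominated_convergence)
    show "integrable lborel (\<lambda>s. norm (min 1 s * p s))" using p_integrable by (rule integrable_norm)
    show "AE s in lborel. (\<lambda>n. indicator {..e n} s *\<^sub>R (min 1 s * p s)) \<longlonglongrightarrow> 0"
    proof (rule AE_I2)
      fix s :: real
      show "(\<lambda>n. indicator {..e n} s *\<^sub>R (min 1 s * p s)) \<longlonglongrightarrow> 0"
      proof (cases "0 < s")
        case True
        have "\<forall>\<^sub>F n in sequentially. e n < s" using e0 True by (intro order_tendstoD) auto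
        then have "\<forall>\<^sub>F n in sequentially. 0 = indicator {..e n} s *\<^sub>R (min 1 s * p s)"
          by eventually_elim auto
        then show ?thesis by (rule Lim_transform_eventually[OF tendsto_const])
      qed (simp add: p_nonpos)
    qed
    show "AE s in lborel. norm (indicator {..e n} s *\<^sub>R (min 1 s * p s)) \<le> norm (min 1 s * p s)" for n
      by (auto simp: indicator_def)
  qed measurable
  have "(LINT s|lborel. p s *\<^sub>R Y' s) \<le> 2 * B * (4 * (LINT s::real|lborel. (0::real))) - \<kappa>"
  proof (rule tendsto_le[OF _ _ lim1])
    show "(\<lambda>n. 2 * B * (4 * (LINT s|lborel. indicator {..e n} s *\<^sub>R (min 1 s * p s))) - \<kappa>)
        \<longlonglongrightarrow> 2 * B * (4 * (LINT s::real|lborel. (0::real))) - \<kappa>"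
      by (intro tendsto_intros lim2)
    have "\<forall>\<^sub>F n in sequentially. e n < a" using e0 ab by (intro order_tendstoD) auto
    moreover have "\<forall>\<^sub>F n in sequentially. b \<le> real n"
      using filterlim_real_sequentially by (simp add: filterlim_at_top)
    ultimately show "\<forall>\<^sub>F n in sequentially. (LINT s|lborel. indicator {e n..real n} s *\<^sub>R (p s *\<^sub>R Y' s)) \<le>
        2 * B * (4 * (LINT s|lborel. indicator {..e n} s *\<^sub>R (min 1 s * p s))) - \<kappa>"
    proof eventually_elim
      case (elim n)
      have "2 * B * (p (e n) * (e n)\<^sup>2) \<le> 2 * B * (4 * (LINT s|lborel. indicator {..e n} s *\<^sub>R (min 1 s * p s)))"
        using B by (intro mult_left_mono density_near_zero e) auto
      then show ?case using main[of "e n" "real n"] elim e[of n] by linarith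
    qed
  qed simp
  then show False using pY'_zero \<kappa> by simp
qed

end

section \<open>The Levy representation of a complete Bernstein function\<close>

lemma min_le_one_minus_exp:
  fixes s :: real
  assumes s: "0 \<le> s"
  shows "min 1 s \<le> 2 * (1 - exp (- s))"
proof -
  have "exp (- s) * (1 + s) \<le> exp (- s) * exp s"
    by (intro mult_left_mono exp_ge_add_one_self) simp
  also have "\<dots> = 1" by (simp add: exp_minus)
  finally have 1: "exp (- s) \<le> 1 / (1 + s)"
    using s by (simp add: pos_le_divide_eq)
  show ?thesis
  proof (cases "s \<le> 1")
    case True
    then have "s * s \<le> s" using s by (simp add: mult_left_le)
    then have "1 \<le> (1 - s / 2) * (1 + s)"
      by (simp add: algebra_simps)
    then have "1 / (1 + s) \<le> 1 - s / 2"
      using s by (subst pos_divide_le_eq) simp_all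
    then show ?thesis using 1 True by simp
  next
    case False
    then have "exp (- s) \<le> 1 / 2" by (intro order_trans[OF 1]) simp
    then show ?thesis using False by simp
  qed
qed

text \<open>With \<open>t = \<bar>\<xi>\<bar>\<^sup>2\<close> this separates the variables of the multiplier of \<open>1 - P\<^sub>s\<close> into an integrable function of \<open>s\<close>
  (against \<open>p\<close>) and one of \<open>\<xi>\<close> (against the transform of a Schwartz function).\<close>

lemma one_minus_exp_le: "1 - exp (- (t * s)) \<le> (1 + t) * min 1 s" if "0 \<le> s" "0 \<le> t" for s t :: real
proof -
  have "1 - exp (- (t * s)) \<le> t * s"
    using exp_ge_add_one_self[of "- (t * s)"] by simp
  moreover have "t * s \<le> (1 + t) * s" using that by (intro mult_right_mono) auto
  moreover have "1 - exp (- (t * s)) \<le> (1 + t) * 1" using that exp_gt_zero[of "- (t * s)"] unfolding mult_1_right by linarith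
  ultimately show ?thesis by (auto simp: min_def)
qed

text \<open>Here \<open>p = - f'\<close> and \<open>c\<close> is the limit of \<open>f\<close> at infinity, so \<open>f s = c + \<integral>\<^sub>s p\<close>. Insert this into
  \<open>\<psi> t = t \<integral> exp (- t s) f s ds\<close> and exchange the two integrations, which is allowed as everything is non-negative; in
  particular this shows that \<open>(1 - exp (- t s)) p s\<close> is integrable. The signs of \<open>f'\<close> and \<open>f''\<close> make \<open>p\<close> non-negative and decreasing.

  The last property says that \<open>p\<close> cannot stay constant at a positive value, since \<open>f\<close> would become negative.\<close>

theorem complete_bernstein_levy:
  assumes "complete_bernstein \<psi>"
  obtains c p p' where "levy_density p p'"
    and "\<And>t. 0 < t \<Longrightarrow> \<psi> t = c + (LINT s|lborel. p s * (1 - exp (- (t * s))))"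
    and "\<And>a. 0 < a \<Longrightarrow> 0 < p a \<Longrightarrow> \<exists>b>a. p b < p a"
proof -
  obtain f where cm: "completely_monotone f"
    and lap: "\<And>t. 0 < t \<Longrightarrow> set_integrable lebesgue {0<..} (\<lambda>s. exp (- t * s) * f s)"
      "\<And>t. 0 < t \<Longrightarrow> \<psi> t = t * laplace_transform f t"
    using assms unfolding complete_bernstein_def by blast
  have D: "(deriv ^^ k) f field_differentiable (at t)" "0 \<le> (- 1) ^ k * (deriv ^^ k) f t" if "0 < t" for k t
    using cm that unfolding completely_monotone_def by auto
  have f_nonneg: "0 \<le> f t" if "0 < t" for t using D(2)[OF that, of 0] by simp
  have f_deriv: "(f has_real_derivative deriv f t) (at t)" if "0 < t" for t
    using D(1)[OF that, of 0] by (simp add: DERIV_deriv_iff_field_differentiable)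
  have f'_nonpos: "deriv f t \<le> 0" if "0 < t" for t using D(2)[OF that, of 1] by simp
  have f'_deriv: "(deriv f has_real_derivative deriv (deriv f) t) (at t)" if "0 < t" for t
    using D(1)[OF that, of 1] by (simp add: DERIV_deriv_iff_field_differentiable)
  have f''_nonneg: "0 \<le> deriv (deriv f) t" if "0 < t" for t
    using D(2)[OF that, of 2] by (simp add: numeral_2_eq_2)
  have f''_diff: "deriv (deriv f) field_differentiable (at t)" if "0 < t" for t
    using D(1)[OF that, of 2] by (simp add: numeral_2_eq_2)
  have f_cont: "continuous_on {0<..} f"
    by (rule DERIV_continuous_on[where D="deriv f"]) (auto intro: has_field_derivative_at_within f_deriv)
  have f'_cont: "continuous_on {0<..} (deriv f)"
    by (rule DERIV_continuous_on[where D="deriv (deriv f)"]) (auto intro: has_field_derivative_at_within f'_deriv)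
  have f_anti: "f s \<le> f r" if "0 < r" "r \<le> s" for r s
  proof (rule DERIV_nonpos_imp_nonincreasing[OF that(2)])
    fix x assume "r \<le> x"
    then have "0 < x" using that by simp
    then show "\<exists>y. (f has_real_derivative y) (at x) \<and> y \<le> 0"
      using f_deriv f'_nonpos by blast
  qed
  define p where "p s = indicator {0<..} s * (- deriv f s)" for s :: real
  have p_eq: "p s = - deriv f s" if "0 < s" for s using that by (simp add: p_def)
  have p_zero: "p s = 0" if "s \<le> 0" for s using that by (simp add: p_def)
  have p_nonneg: "0 \<le> p s" for s using f'_nonpos[of s] by (cases "0 < s") (auto simp: p_def)
  have [measurable]: "p \<in> borel_measurable borel"
    using borel_measurable_continuous_on_indicator[of "{0<..}" "\<lambda>s. - deriv f s"] f'_cont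
    by (auto simp: p_def[abs_def] intro!: continuous_intros)
  have p_deriv: "(p has_real_derivative - deriv (deriv f) s) (at s)" if "0 < s" for s
    by (rule has_field_derivative_transform_within_open[of "\<lambda>s. - deriv f s" _ _ "{0<..}"])
       (use that in \<open>auto intro!: derivative_eq_intros f'_deriv simp: p_eq\<close>)
  define c where "c = Inf (f ` {0<..})"
  have bdd: "bdd_below (f ` {0<..})" using f_nonneg by (intro bdd_belowI[of _ 0]) auto
  have c_le: "c \<le> f t" if "0 < t" for t
    unfolding c_def using that by (intro cInf_lower bdd) auto
  have c_nonneg: "0 \<le> c"
    unfolding c_def using f_nonneg by (intro cInf_greatest) auto
  have f_lim: "(f \<longlongrightarrow> c) at_top"
  proof (rule order_tendstoI)
    fix y assume y: "y < c"
    show "\<forall>\<^sub>F t in at_top. y < f t"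
      using eventually_gt_at_top[of 0] by eventually_elim (rule less_le_trans[OF y c_le])
  next
    fix y assume "c < y"
    then obtain r where r: "0 < r" "f r < y"
      unfolding c_def using cInf_lessD[of "f ` {0<..}" y] by auto
    show "\<forall>\<^sub>F t in at_top. f t < y"
      using eventually_ge_at_top[of r] by eventually_elim (rule le_less_trans[OF f_anti[OF r(1)] r(2)])
  qed
  have tail: "(\<integral>\<^sup>+x. ennreal (p x) * indicator {s..} x \<partial>lborel) = ennreal (f s - c)" if s: "0 < s" for s
  proof -
    have "(\<integral>\<^sup>+x. ennreal (p x) * indicator {s..} x \<partial>lborel) = - c - (- f s)"
    proof (rule nn_integral_FTC_atLeast)
      show "((\<lambda>x. - f x) has_real_derivative p x) (at x)" if "s \<le> x" for x
        using that s f_deriv[of x] by (auto intro!: derivative_eq_intros simp: p_eq)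
      show "((\<lambda>x. - f x) \<longlongrightarrow> - c) at_top" by (intro tendsto_intros f_lim)
    qed (auto simp: p_nonneg)
    then show ?thesis by simp
  qed
  have main: "has_bochner_integral lborel (\<lambda>s. p s * (1 - exp (- (t * s)))) (\<psi> t - c)" if t: "0 < t" for t
  proof -
    define g where "g s = indicator {0<..} s * (exp (- t * s) * f s)" for s
    have "continuous_on {0<..} (\<lambda>s. exp (- t * s) * f s)" by (intro continuous_intros f_cont)
    then have [measurable]: "g \<in> borel_measurable borel"
      using borel_measurable_continuous_on_indicator[of "{0<..}" "\<lambda>s. exp (- t * s) * f s"]
      by (simp add: g_def[abs_def])
    have g_nonneg: "0 \<le> g s" for s using f_nonneg[of s] by (cases "0 < s") (auto simp: g_def)
    have gi: "integrable lborel g" and gI: "\<psi> t = t * (LINT s|lborel. g s)"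
    proof -
      have g_eq: "(\<lambda>s. indicator {0<..} s *\<^sub>R (exp (- t * s) * f s)) = g"
        by (simp add: g_def fun_eq_iff)
      show "integrable lborel g"
        using lap(1)[OF t] integrable_completion[of g lborel] unfolding set_integrable_def g_eq by simp
      show "\<psi> t = t * (LINT s|lborel. g s)"
        using lap(2)[OF t] integral_completion[of g lborel]
        unfolding laplace_transform_def set_lebesgue_integral_def g_eq by simp
    qed
    \<comment> \<open>The integrand of the double integral over \<open>0 < s \<le> x\<close>.\<close>
    define K where "K s x = (if 0 < s \<and> s \<le> x then ennreal (exp (- t * s) * p x) else 0)" for s x :: real
    have [measurable]: "(\<lambda>(s, x). K s x) \<in> borel_measurable (lborel \<Otimes>\<^sub>M lborel)"
      unfolding K_def by measurable
    have K1: "(\<integral>\<^sup>+x. K s x \<partial>lborel) = ennreal (indicator {0<..} s * (exp (- t * s) * (f s - c)))" for s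
    proof (cases "0 < s")
      case True
      have "(\<integral>\<^sup>+x. K s x \<partial>lborel) = (\<integral>\<^sup>+x. ennreal (exp (- t * s)) * (ennreal (p x) * indicator {s..} x) \<partial>lborel)"
        using True by (intro nn_integral_cong) (auto simp: K_def ennreal_mult' indicator_def)
      also have "\<dots> = ennreal (exp (- t * s)) * ennreal (f s - c)"
        by (subst nn_integral_cmult) (simp_all add: tail[OF True])
      finally show ?thesis using True c_le[OF True] by (simp add: ennreal_mult')
    qed (simp add: K_def)
    have K2: "(\<integral>\<^sup>+s. K s x \<partial>lborel) = ennreal (p x * ((1 - exp (- (t * x))) / t))" for x
    proof (cases "0 < x")
      case True
      have "(\<integral>\<^sup>+s. K s x \<partial>lborel) = (\<integral>\<^sup>+s. ennreal (p x) * (ennreal (exp (- t * s)) * indicator {0..x} s) \<partial>lborel)"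
        using AE_lborel_singleton[of 0]
        by (intro nn_integral_cong_AE) (auto elim!: eventually_mono simp: K_def ennreal_mult' mult.commute indicator_def p_nonneg)
      also have "\<dots> = ennreal (p x) * (\<integral>\<^sup>+s. ennreal (exp (- t * s)) * indicator {0..x} s \<partial>lborel)"
        by (rule nn_integral_cmult) simp
      also have "(\<integral>\<^sup>+s. ennreal (exp (- t * s)) * indicator {0..x} s \<partial>lborel) = - exp (- t * x) / t - (- exp (- t * 0) / t)"
        by (rule nn_integral_FTC_Icc) (use t True in \<open>auto intro!: derivative_eq_intros\<close>)
      also have "- exp (- t * x) / t - (- exp (- t * 0) / t) = (1 - exp (- (t * x))) / t"
        by (simp add: diff_divide_distrib)
      finally show ?thesis unfolding ennreal_mult'[OF p_nonneg] .
    next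
      case False
      then show ?thesis by (auto simp: K_def p_zero intro!: nn_integral_zero' AE_I2)
    qed
    have exp_int: "(\<integral>\<^sup>+s. ennreal (indicator {0<..} s * (exp (- t * s) * c)) \<partial>lborel) = ennreal (c / t)"
    proof -
      have "(\<integral>\<^sup>+s. ennreal (indicator {0<..} s * (exp (- t * s) * c)) \<partial>lborel) =
          (\<integral>\<^sup>+s. ennreal (exp (- t * s) * c) * indicator {0..} s \<partial>lborel)"
        using AE_lborel_singleton[of 0]
        by (intro nn_integral_cong_AE) (auto elim!: eventually_mono simp: indicator_def)
      also have "\<dots> = 0 - (- exp (- t * 0) * c / t)"
      proof (rule nn_integral_FTC_atLeast)
        show "((\<lambda>s. - exp (- t * s) * c / t) has_real_derivative exp (- t * x) * c) (at x)" for x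
          using t by (auto intro!: derivative_eq_intros)
        have "filterlim (\<lambda>s. t * s) at_top at_top"
          using t by (intro filterlim_tendsto_pos_mult_at_top[OF tendsto_const]) (auto intro: filterlim_ident)
        then have "((\<lambda>s. exp (- (t * s))) \<longlongrightarrow> 0) at_top"
          by (intro filterlim_compose[OF exp_at_bot] filterlim_compose[OF filterlim_uminus_at_bot_at_top])
        then have "((\<lambda>s. - exp (- (t * s)) * c / t) \<longlongrightarrow> - 0 * c / t) at_top"
          using t by (intro tendsto_intros) auto
        then show "((\<lambda>s. - exp (- t * s) * c / t) \<longlongrightarrow> 0) at_top" by simp
      qed (use c_nonneg in auto)
      finally show ?thesis by simp
    qed
    have "ennreal (LINT s|lborel. g s) = (\<integral>\<^sup>+s. ennreal (g s) \<partial>lborel)"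
      using gi g_nonneg by (intro nn_integral_eq_integral[symmetric]) auto
    also have "\<dots> = (\<integral>\<^sup>+s. ennreal (indicator {0<..} s * (exp (- t * s) * c)) +
        ennreal (indicator {0<..} s * (exp (- t * s) * (f s - c))) \<partial>lborel)"
    proof (rule nn_integral_cong)
      fix s
      show "ennreal (g s) = ennreal (indicator {0<..} s * (exp (- t * s) * c)) +
        ennreal (indicator {0<..} s * (exp (- t * s) * (f s - c)))"
        using c_nonneg c_le[of s]
        by (cases "0 < s") (auto simp: g_def algebra_simps simp flip: ennreal_plus)
    qed
    also have "\<dots> = (\<integral>\<^sup>+s. ennreal (indicator {0<..} s * (exp (- t * s) * c)) \<partial>lborel) +
        (\<integral>\<^sup>+s. (\<integral>\<^sup>+x. K s x \<partial>lborel) \<partial>lborel)"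
      unfolding K1[symmetric] by (rule nn_integral_add) measurable
    also have "(\<integral>\<^sup>+s. (\<integral>\<^sup>+x. K s x \<partial>lborel) \<partial>lborel) = (\<integral>\<^sup>+x. (\<integral>\<^sup>+s. K s x \<partial>lborel) \<partial>lborel)"
      by (rule lborel_pair.Fubini'[symmetric]) measurable
    also have "\<dots> = (\<integral>\<^sup>+x. ennreal (p x * ((1 - exp (- (t * x))) / t)) \<partial>lborel)"
      by (simp only: K2)
    finally have sum: "ennreal (LINT s|lborel. g s) = ennreal (c / t) +
        (\<integral>\<^sup>+x. ennreal (p x * ((1 - exp (- (t * x))) / t)) \<partial>lborel)"
      unfolding exp_int .
    then have "(\<integral>\<^sup>+x. ennreal (p x * ((1 - exp (- (t * x))) / t)) \<partial>lborel) \<noteq> \<infinity>"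
      by (metis ennreal_add_eq_top ennreal_neq_top infinity_ennreal_def)
    then obtain y where y: "0 \<le> y" "(\<integral>\<^sup>+x. ennreal (p x * ((1 - exp (- (t * x))) / t)) \<partial>lborel) = ennreal y"
      by (cases "\<integral>\<^sup>+x. ennreal (p x * ((1 - exp (- (t * x))) / t)) \<partial>lborel") auto
    have "0 \<le> p x * ((1 - exp (- (t * x))) / t)" for x
      using t p_nonneg[of x] by (cases "0 < x") (auto simp: p_zero)
    then have "has_bochner_integral lborel (\<lambda>x. p x * ((1 - exp (- (t * x))) / t)) y"
      using y by (intro has_bochner_integral_nn_integral) auto
    then have "has_bochner_integral lborel (\<lambda>x. t * (p x * ((1 - exp (- (t * x))) / t))) (t * y)"
      by (rule has_bochner_integral_mult_right)
    moreover have "(LINT s|lborel. g s) = c / t + y"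
    proof -
      have "ennreal (LINT s|lborel. g s) = ennreal (c / t + y)"
        using sum y t c_nonneg by (simp add: ennreal_plus)
      then show ?thesis
        using y t c_nonneg g_nonneg by (subst (asm) ennreal_inj) auto
    qed
    then have "t * y = \<psi> t - c" using gI t by (simp add: field_simps)
    ultimately show ?thesis using t by simp
  qed
  have "levy_density p (\<lambda>s. - deriv (deriv f) s)"
  proof
    show "continuous_on {0<..} (\<lambda>s. - deriv (deriv f) s)"
      by (intro continuous_on_minus continuous_at_imp_continuous_on)
         (auto intro: field_differentiable_imp_continuous_at f''_diff)
    show "integrable lborel (\<lambda>s. min 1 s * p s)"
    proof (rule Bochner_Integration.integrable_bound)
      show "integrable lborel (\<lambda>s. 2 * (p s * (1 - exp (- (1 * s)))))"
        using main[of 1] by (intro integrable_mult_right) (auto simp: has_bochner_integral_iff)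
      have "\<bar>min 1 s * p s\<bar> \<le> 2 * (p s * (1 - exp (- (1 * s))))" for s
      proof (cases "0 < s")
        case True
        then show ?thesis
          using mult_right_mono[OF min_le_one_minus_exp[of s] p_nonneg[of s]] p_nonneg[of s]
          by (simp add: abs_mult mult_ac)
      qed (simp add: p_zero)
      then show "AE s in lborel. norm (min 1 s * p s) \<le> norm (2 * (p s * (1 - exp (- (1 * s)))))"
        by (auto intro!: AE_I2 order_trans[OF _ abs_ge_self])
    qed measurable
  qed (use p_nonneg p_zero p_deriv f''_nonneg in auto)
  moreover have "\<psi> t = c + (LINT s|lborel. p s * (1 - exp (- (t * s))))" if "0 < t" for t
    using main[OF that] by (simp add: has_bochner_integral_iff)
  moreover have "\<exists>b>a. p b < p a" if a: "0 < a" "0 < p a" for a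
  proof (rule ccontr)
    assume "\<not> ?thesis"
    then have ge: "p a \<le> p b" if "a < b" for b using that by (meson not_le)
    \<comment> \<open>At slope at most \<open>- p a\<close>, the graph of \<open>f\<close> falls below \<open>0\<close> within distance \<open>(f a + 1) / p a\<close>.\<close>
    define b where "b = a + (f a + 1) / p a"
    have ab: "a < b" using a f_nonneg[OF a(1)] by (simp add: b_def add_pos_nonneg add_nonneg_pos)
    obtain z where z: "a < z" "z < b" "f b - f a = (b - a) * deriv f z"
    proof -
      have "\<exists>z. a < z \<and> z < b \<and> f b - f a = (b - a) * deriv f z"
        by (rule MVT2[OF ab]) (use a in \<open>intro f_deriv, simp\<close>)
      then show thesis using that by blast
    qed
    have "(b - a) * deriv f z \<le> (b - a) * (- p a)"
      using ge[OF z(1)] ab a z by (intro mult_left_mono) (auto simp: p_eq)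
    also have "\<dots> = - (f a + 1)" using a by (simp add: b_def)
    finally have "f b < 0" using z by simp
    then show False using f_nonneg[of b] a ab by simp
  qed
  ultimately show thesis by (rule that)
qed

section \<open>The operator in terms of the heat semigroup\<close>

context levy_density
begin

lemma integrable_one_minus_exp:
  assumes "0 \<le> t"
  shows "integrable lborel (\<lambda>s. p s * (1 - exp (- (t * s))))"
proof -
  have "integrable lborel (\<lambda>s. p s *\<^sub>R (1 - exp (- (t * s))))"
  proof (rule integrable_times_density[where C="1 + t"])
    fix s :: real assume s: "0 \<le> s"
    have "0 \<le> 1 - exp (- (t * s))" using s assms by simp
    then show "norm (1 - exp (- (t * s))) \<le> (1 + t) * min 1 s"
      using one_minus_exp_le[OF s assms] by simp
  qed measurable
  then show ?thesis by simp
qed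

text \<open>Insert the Levy representation of \<open>\<psi> (\<bar>\<xi>\<bar>\<^sup>2)\<close> into the Fourier integral and exchange the integrations.\<close>

lemma psi_laplacian_eq_heat:
  fixes \<phi> :: "real^'n::finite \<Rightarrow> complex"
  assumes \<psi>: "\<And>t. 0 < t \<Longrightarrow> \<psi> t = c + (LINT s|lborel. p s * (1 - exp (- (t * s))))"
    and \<phi>: "schwartz \<phi>"
  shows "psi_laplacian \<psi> \<phi> x = c *\<^sub>R \<phi> x + (LINT s|lborel. p s *\<^sub>R (\<phi> x - heat s \<phi> x))"
proof -
  note [measurable] = schwartz_measurable[OF \<phi>]
  define \<Psi> where "\<Psi> t = c + (LINT s|lborel. p s * (1 - exp (- (t * s))))" for t
  have [measurable]: "\<Psi> \<in> borel_measurable borel" unfolding \<Psi>_def[abs_def] by measurable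
  define C where "C = complex_of_real (1 / (2 * pi) ^ CARD('n))"
  define e where "e \<xi> = cis (x \<bullet> \<xi>) * fourier \<phi> \<xi>" for \<xi>
  have [measurable]: "e \<in> borel_measurable borel" unfolding e_def by measurable
  have e_int: "integrable lborel e"
    unfolding e_def[abs_def] by (rule integrable_cis_mult[OF integrable_fourier(2)[OF \<phi>]]) measurable
  have heat_e: "heat s \<phi> x = C * (LINT \<xi>|lborel. exp (- (s * (norm \<xi>)\<^sup>2)) *\<^sub>R e \<xi>)" for s
    unfolding heat_lborel[OF schwartz_measurable[OF \<phi>]] C_def e_def scaleR_conv_of_real
    by (simp add: mult.left_commute)
  have phi_e: "\<phi> x = C * (LINT \<xi>|lborel. e \<xi>)"
    using heat_e[of 0] by (simp add: fourier_inversion[OF \<phi>])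
  have heat_i: "integrable lborel (\<lambda>\<xi>. exp (- (s * (norm \<xi>)\<^sup>2)) *\<^sub>R e \<xi>)" if "0 \<le> s" for s
    by (rule Bochner_Integration.integrable_bound[OF e_int]) (use that in \<open>auto intro!: AE_I2 mult_left_le_one_le\<close>)
  define k where "k s \<xi> = (p s * (1 - exp (- (s * (norm \<xi>)\<^sup>2)))) *\<^sub>R e \<xi>" for s \<xi>
  have k_int: "integrable (lborel \<Otimes>\<^sub>M lborel) (case_prod k)"
  proof (rule integrable_if_product_majorant[OF _ p_integrable integrable_fourier(1)[OF \<phi>]])
    show "case_prod k \<in> borel_measurable (lborel \<Otimes>\<^sub>M lborel)"
      unfolding k_def by measurable
    show "norm (k s \<xi>) \<le> (min 1 s * p s) * ((1 + (norm \<xi>)\<^sup>2) * norm (fourier \<phi> \<xi>))" for s \<xi>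
    proof (cases "0 \<le> s")
      case True
      have "0 \<le> 1 - exp (- (s * (norm \<xi>)\<^sup>2))" using True by simp
      moreover have "1 - exp (- (s * (norm \<xi>)\<^sup>2)) \<le> (1 + (norm \<xi>)\<^sup>2) * min 1 s"
        using one_minus_exp_le[OF True, of "(norm \<xi>)\<^sup>2"] by (simp add: mult.commute)
      ultimately have "p s * \<bar>1 - exp (- (s * (norm \<xi>)\<^sup>2))\<bar> * norm (e \<xi>) \<le> p s * ((1 + (norm \<xi>)\<^sup>2) * min 1 s) * norm (e \<xi>)"
        using p_nonneg by (intro mult_right_mono mult_left_mono) auto
      then show ?thesis
        using p_nonneg[of s] by (simp add: k_def e_def norm_mult abs_mult mult_ac)
    qed (simp add: k_def p_nonpos)
  qed
  \<comment> \<open>The value \<open>\<psi> 0\<close> is arbitrary, but it is used at the single point \<open>\<xi> = 0\<close> only.\<close>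
  define w where "w \<xi> = (if \<xi> = 0 then complex_of_real (\<psi> 0) * fourier \<phi> 0
      else complex_of_real (\<Psi> ((norm \<xi>)\<^sup>2)) * fourier \<phi> \<xi>)" for \<xi>
  have [measurable]: "w \<in> borel_measurable borel" unfolding w_def by measurable
  have "psi_laplacian \<psi> \<phi> x = inverse_fourier w x"
    unfolding psi_laplacian_def
    by (rule arg_cong[where f="\<lambda>g. inverse_fourier g x"]) (auto simp: \<psi> \<Psi>_def w_def)
  also have "\<dots> = C * (LINT \<xi>|lborel. cis (x \<bullet> \<xi>) * w \<xi>)"
    unfolding C_def by (rule inverse_fourier_lborel) measurable
  also have "(LINT \<xi>|lborel. cis (x \<bullet> \<xi>) * w \<xi>) = (LINT \<xi>|lborel. c *\<^sub>R e \<xi> + (LINT s|lborel. k s \<xi>))"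
  proof (rule integral_cong_AE)
    show "AE \<xi> in lborel. cis (x \<bullet> \<xi>) * w \<xi> = c *\<^sub>R e \<xi> + (LINT s|lborel. k s \<xi>)"
      using AE_lborel_singleton[of 0]
    proof eventually_elim
      case (elim \<xi>)
      have "(LINT s|lborel. k s \<xi>) = (LINT s|lborel. p s * (1 - exp (- ((norm \<xi>)\<^sup>2 * s)))) *\<^sub>R e \<xi>"
        unfolding k_def using integrable_one_minus_exp[of "(norm \<xi>)\<^sup>2"] by (simp add: mult.commute)
      then have "c *\<^sub>R e \<xi> + (LINT s|lborel. k s \<xi>) = \<Psi> ((norm \<xi>)\<^sup>2) *\<^sub>R e \<xi>"
        by (simp add: \<Psi>_def scaleR_add_left)
      then show ?case using elim by (simp add: w_def e_def scaleR_conv_of_real)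
    qed
    show "(\<lambda>\<xi>. c *\<^sub>R e \<xi> + (LINT s|lborel. k s \<xi>)) \<in> borel_measurable lborel"
      unfolding k_def by measurable
  qed measurable
  also have "\<dots> = c *\<^sub>R (LINT \<xi>|lborel. e \<xi>) + (LINT \<xi>|lborel. (LINT s|lborel. k s \<xi>))"
    using e_int lborel_pair.integrable_snd[OF k_int] by simp
  also have "(LINT \<xi>|lborel. (LINT s|lborel. k s \<xi>)) = (LINT s|lborel. (LINT \<xi>|lborel. k s \<xi>))"
    by (rule lborel_pair.Fubini_integral[OF k_int])
  also have "C * (c *\<^sub>R (LINT \<xi>|lborel. e \<xi>) + \<dots>) = c *\<^sub>R \<phi> x + (LINT s|lborel. C * (LINT \<xi>|lborel. k s \<xi>))"
    unfolding phi_e distrib_left integral_mult_right_zero by simp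
  also have "(\<lambda>s. C * (LINT \<xi>|lborel. k s \<xi>)) = (\<lambda>s. p s *\<^sub>R (\<phi> x - heat s \<phi> x))"
  proof
    fix s
    show "C * (LINT \<xi>|lborel. k s \<xi>) = p s *\<^sub>R (\<phi> x - heat s \<phi> x)"
    proof (cases "0 \<le> s")
      case True
      have "(LINT \<xi>|lborel. k s \<xi>) = (LINT \<xi>|lborel. p s *\<^sub>R (e \<xi> - exp (- (s * (norm \<xi>)\<^sup>2)) *\<^sub>R e \<xi>))"
        by (intro Bochner_Integration.integral_cong) (simp_all add: k_def algebra_simps)
      also have "\<dots> = p s *\<^sub>R ((LINT \<xi>|lborel. e \<xi>) - (LINT \<xi>|lborel. exp (- (s * (norm \<xi>)\<^sup>2)) *\<^sub>R e \<xi>))"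
        using e_int heat_i[OF True] by simp
      finally show ?thesis by (simp add: phi_e heat_e right_diff_distrib)
    qed (simp add: k_def p_nonpos)
  qed
  finally show ?thesis .
qed

end

locale levy_pairing = vanishing_function u M + levy_density p p'
  for u :: "real^'n::finite \<Rightarrow> complex" and M and p p' +
  fixes \<psi> :: "real \<Rightarrow> real" and c :: real
  assumes \<psi>: "\<And>t. 0 < t \<Longrightarrow> \<psi> t = c + (LINT s|lborel. p s * (1 - exp (- (t * s))))"
begin

lemma psi_laplacian_measurable:
  assumes \<phi>: "schwartz \<phi>"
  shows "psi_laplacian \<psi> \<phi> \<in> borel_measurable borel"
proof -
  note [measurable] = schwartz_measurable[OF \<phi>]
  show ?thesis
    using psi_laplacian_eq_heat[OF \<psi> \<phi>, THEN ext[where f="psi_laplacian \<psi> \<phi>"]] by simp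
qed

text \<open>For large \<open>s\<close> both terms are bounded by contractivity; for small \<open>s\<close> the heat equation bounds the difference by
  \<open>s\<close> times the \<open>L\<^sup>1\<close> norm of \<open>\<Delta>\<phi>\<close>. Together they match the integrability of \<open>min 1 s * p s\<close>.\<close>

lemma L1_difference_bound:
  assumes \<phi>: "schwartz \<phi>"
  obtains D where "0 \<le> D" "\<And>r s. 0 \<le> r \<Longrightarrow> 0 \<le> s \<Longrightarrow> (LINT x|lborel. norm (heat r \<phi> x - heat (r + s) \<phi> x)) \<le> D * min 1 s"
proof
  define A where "A = L1_norm \<phi>"
  define B where "B = L1_norm (laplacian \<phi>)"
  have AB: "0 \<le> A" "0 \<le> B" by (auto simp: A_def B_def)
  then show "0 \<le> 2 * A + B" by simp
  fix r s :: real assume r: "0 \<le> r" and s: "0 \<le> s"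
  have i: "integrable lborel (heat r \<phi>)" "integrable lborel (heat (r + s) \<phi>)"
    using heat_L1_contraction(1)[OF \<phi>] r s by auto
  have "(LINT x|lborel. norm (heat r \<phi> x - heat (r + s) \<phi> x)) \<le> (LINT x|lborel. norm (heat r \<phi> x) + norm (heat (r + s) \<phi> x))"
    using i by (intro integral_mono norm_triangle_ineq4) auto
  also have "\<dots> \<le> A + A"
    using i heat_L1_contraction(2)[OF \<phi>, of r] heat_L1_contraction(2)[OF \<phi>, of "r + s"] r s by (simp add: A_def)
  finally have 1: "(LINT x|lborel. norm (heat r \<phi> x - heat (r + s) \<phi> x)) \<le> 2 * A" by simp
  have "(LINT x|lborel. norm (heat (r + s) \<phi> x - heat r \<phi> x)) \<le> (r + s - r) * B"
    unfolding B_def using r s by (intro heat_L1_difference[OF \<phi>]) auto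
  then have 2: "(LINT x|lborel. norm (heat r \<phi> x - heat (r + s) \<phi> x)) \<le> s * B"
    by (simp add: norm_minus_commute)
  have 3: "0 \<le> s * B" "0 \<le> s * A" using AB s by auto
  show "(LINT x|lborel. norm (heat r \<phi> x - heat (r + s) \<phi> x)) \<le> (2 * A + B) * min 1 s"
    using 1 2 3 AB by (auto simp: min_def algebra_simps)
qed

lemma integrable_pairing_difference:
  assumes \<phi>: "schwartz \<phi>" and r: "0 \<le> r"
  shows "integrable lborel (\<lambda>s. p s *\<^sub>R (pairing \<phi> r - pairing \<phi> (r + s)))"
proof -
  obtain D where D: "0 \<le> D" "\<And>s. 0 \<le> s \<Longrightarrow> (LINT x|lborel. norm (heat r \<phi> x - heat (r + s) \<phi> x)) \<le> D * min 1 s"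
    using L1_difference_bound[OF \<phi>] r by metis
  show ?thesis
  proof (rule integrable_times_density[where C="M * D"])
    have "continuous_on {0..} (\<lambda>s. pairing \<phi> r - pairing \<phi> (r + s))"
      by (intro continuous_intros continuous_on_compose2[OF pairing_continuous[OF \<phi>]]) (use r in auto)
    then show "(\<lambda>s. indicator {0..} s *\<^sub>R (pairing \<phi> r - pairing \<phi> (r + s))) \<in> borel_measurable borel"
      by (rule borel_measurable_continuous_on_indicator[rotated]) simp
    fix s :: real assume s: "0 \<le> s"
    have i: "integrable lborel (heat r \<phi>)" "integrable lborel (heat (r + s) \<phi>)"
      using heat_L1_contraction(1)[OF \<phi>] r s by auto
    have "pairing \<phi> r - pairing \<phi> (r + s) = (LINT x|lborel. u x * (heat r \<phi> x - heat (r + s) \<phi> x))"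
      unfolding pairing_def using i
      by (subst Bochner_Integration.integral_diff[symmetric]) (auto intro: integrable_u_mult simp: right_diff_distrib)
    also have "norm \<dots> \<le> M * (LINT x|lborel. norm (heat r \<phi> x - heat (r + s) \<phi> x))"
      using i by (intro norm_integral_u_mult_le) auto
    also have "\<dots> \<le> M * (D * min 1 s)" by (intro mult_left_mono D s M_nonneg)
    finally show "norm (pairing \<phi> r - pairing \<phi> (r + s)) \<le> M * D * min 1 s" by simp
  qed
qed

lemma psi_laplacian_distr_eq_pairing:
  assumes \<phi>: "schwartz \<phi>"
  shows "psi_laplacian_distr \<psi> u \<phi> = c *\<^sub>R pairing \<phi> 0 + (LINT s|lborel. p s *\<^sub>R (pairing \<phi> 0 - pairing \<phi> s))"
proof -
  note [measurable] = schwartz_measurable[OF \<phi>] psi_laplacian_measurable[OF \<phi>]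
  define k where "k s x = p s *\<^sub>R (u x * (\<phi> x - heat s \<phi> x))" for s x
  obtain D where D: "0 \<le> D" "\<And>r s. 0 \<le> r \<Longrightarrow> 0 \<le> s \<Longrightarrow> (LINT x|lborel. norm (heat r \<phi> x - heat (r + s) \<phi> x)) \<le> D * min 1 s"
    using L1_difference_bound[OF \<phi>] by metis
  have di: "integrable lborel (\<lambda>x. \<phi> x - heat s \<phi> x)" if "0 \<le> s" for s
    using heat_L1_contraction(1)[OF \<phi> that] schwartz_integrable[OF \<phi>] by auto
  have ki: "integrable lborel (k s)" for s
    unfolding k_def[abs_def] using di[of s] integrable_u_mult[of "\<lambda>x. \<phi> x - heat s \<phi> x"]
    by (cases "0 \<le> s") (auto simp: p_nonpos)
  have kb: "(LINT x|lborel. norm (k s x)) \<le> (M * D) * (min 1 s * p s)" for s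
  proof (cases "0 \<le> s")
    case True
    have "(LINT x|lborel. norm (k s x)) \<le> (LINT x|lborel. p s * (M * norm (\<phi> x - heat s \<phi> x)))"
    proof (rule integral_mono)
      show "integrable lborel (\<lambda>x. p s * (M * norm (\<phi> x - heat s \<phi> x)))"
        by (intro integrable_mult_right integrable_norm di True)
      have "p s * (norm (u x) * norm (\<phi> x - heat s \<phi> x)) \<le> p s * (M * norm (\<phi> x - heat s \<phi> x))" for x
        by (intro mult_left_mono mult_right_mono u_bound p_nonneg) auto
      then show "norm (k s x) \<le> p s * (M * norm (\<phi> x - heat s \<phi> x))" for x
        by (simp add: k_def norm_mult p_nonneg)
    qed (rule integrable_norm[OF ki])
    also have "\<dots> = p s * (M * (LINT x|lborel. norm (heat 0 \<phi> x - heat (0 + s) \<phi> x)))"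
      by (simp add: fourier_inversion[OF \<phi>])
    also have "\<dots> \<le> p s * (M * (D * min 1 s))"
      by (intro mult_left_mono D p_nonneg M_nonneg True) auto
    finally show ?thesis by (simp add: mult_ac)
  qed (simp add: k_def p_nonpos)
  have k_int: "integrable (lborel \<Otimes>\<^sub>M lborel) (case_prod k)"
  proof (rule integrable_if_slices[OF _ ki integrable_mult_right[OF p_integrable] kb])
    show "case_prod k \<in> borel_measurable (lborel \<Otimes>\<^sub>M lborel)"
      unfolding k_def by measurable
  qed
  have "psi_laplacian_distr \<psi> u \<phi> = (LINT x|lborel. u x * psi_laplacian \<psi> \<phi> x)"
    unfolding psi_laplacian_distr_def distribution_of_def by (rule integral_completion) measurable
  also have "\<dots> = (LINT x|lborel. c *\<^sub>R (u x * \<phi> x) + (LINT s|lborel. k s x))"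
  proof (rule Bochner_Integration.integral_cong[OF refl])
    fix x
    have "(LINT s|lborel. k s x) = (LINT s|lborel. u x * (p s *\<^sub>R (\<phi> x - heat s \<phi> x)))"
      by (simp add: k_def)
    also have "\<dots> = u x * (LINT s|lborel. p s *\<^sub>R (\<phi> x - heat s \<phi> x))"
      by (rule integral_mult_right_zero)
    finally show "u x * psi_laplacian \<psi> \<phi> x = c *\<^sub>R (u x * \<phi> x) + (LINT s|lborel. k s x)"
      by (simp add: psi_laplacian_eq_heat[OF \<psi> \<phi>] distrib_left)
  qed
  also have "\<dots> = c *\<^sub>R pairing \<phi> 0 + (LINT x|lborel. (LINT s|lborel. k s x))"
    using integrable_u_mult[OF schwartz_integrable[OF \<phi>]] lborel_pair.integrable_snd[OF k_int]
    by (simp add: pairing_0[OF \<phi>])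
  also have "(LINT x|lborel. (LINT s|lborel. k s x)) = (LINT s|lborel. (LINT x|lborel. k s x))"
    by (rule lborel_pair.Fubini_integral[OF k_int])
  also have "(\<lambda>s. LINT x|lborel. k s x) = (\<lambda>s. p s *\<^sub>R (pairing \<phi> 0 - pairing \<phi> s))"
  proof
    fix s
    show "(LINT x|lborel. k s x) = p s *\<^sub>R (pairing \<phi> 0 - pairing \<phi> s)"
    proof (cases "0 \<le> s")
      case True
      have i: "integrable lborel (\<lambda>x. u x * \<phi> x)" "integrable lborel (\<lambda>x. u x * heat s \<phi> x)"
        by (intro integrable_u_mult schwartz_integrable \<phi> heat_L1_contraction True)+
      have "(LINT x|lborel. k s x) = (LINT x|lborel. p s *\<^sub>R (u x * \<phi> x - u x * heat s \<phi> x))"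
        by (simp add: k_def right_diff_distrib)
      also have "\<dots> = p s *\<^sub>R ((LINT x|lborel. u x * \<phi> x) - (LINT x|lborel. u x * heat s \<phi> x))"
        using i by simp
      finally show ?thesis unfolding pairing_0[OF \<phi>] pairing_def[of \<phi> s] .
    qed (simp add: k_def p_nonpos)
  qed
  finally show ?thesis .
qed

lemma solves_psi_eigen_if_heat_eigenfunction:
  assumes heat_eigenfunction
  shows "solves_psi_eigen \<psi> u"
  unfolding solves_psi_eigen_def
proof (intro allI impI)
  fix \<phi> :: "real^'n \<Rightarrow> complex" assume \<phi>: "schwartz \<phi>"
  have "p s *\<^sub>R (pairing \<phi> 0 - pairing \<phi> s) = (p s * (1 - exp (- (1 * s)))) *\<^sub>R pairing \<phi> 0" for s
  proof (cases "0 \<le> s")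
    case True
    then have "pairing \<phi> s = exp (- s) *\<^sub>R pairing \<phi> 0"
      using assms \<phi> unfolding heat_eigenfunction_def by blast
    then show ?thesis by (simp add: algebra_simps)
  qed (simp add: p_nonpos)
  then have "psi_laplacian_distr \<psi> u \<phi> = c *\<^sub>R pairing \<phi> 0 + (LINT s|lborel. p s * (1 - exp (- (1 * s)))) *\<^sub>R pairing \<phi> 0"
    using integrable_one_minus_exp[of 1] unfolding psi_laplacian_distr_eq_pairing[OF \<phi>] by simp
  also have "\<dots> = \<psi> 1 *\<^sub>R pairing \<phi> 0"
    unfolding \<psi>[OF zero_less_one] by (simp add: scaleR_add_left)
  finally show "psi_laplacian_distr \<psi> u \<phi> = complex_of_real (\<psi> 1) * distribution_of u \<phi>"
    by (simp add: distribution_of_eq_pairing[OF \<phi>] scaleR_conv_of_real)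
qed

text \<open>The eigenvalue equation along a heat orbit of test functions: \<open>\<phi>r\<close> stands for \<open>P\<^sub>r \<phi>\<close>, which has to be a Schwartz
  function itself. Since \<open>\<psi> 1 = c + \<integral> (1 - exp (- s)) p s ds\<close>, the constant \<open>c\<close> cancels.\<close>

lemma pairing_orbit_equation:
  assumes H: "solves_psi_eigen \<psi> u"
    and \<phi>: "schwartz \<phi>" and \<phi>r: "schwartz \<phi>r" and r: "0 \<le> r"
    and orbit: "\<And>s. 0 \<le> s \<Longrightarrow> pairing \<phi>r s = pairing \<phi> (r + s)"
  shows "integrable lborel (\<lambda>s. p s *\<^sub>R (pairing \<phi> (r + s) - exp (- s) *\<^sub>R pairing \<phi> r))"
    and "(LINT s|lborel. p s *\<^sub>R (pairing \<phi> (r + s) - exp (- s) *\<^sub>R pairing \<phi> r)) = 0"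
proof -
  define G where "G = pairing \<phi>"
  have i1: "integrable lborel (\<lambda>s. p s *\<^sub>R (G r - G (r + s)))"
    unfolding G_def by (rule integrable_pairing_difference[OF \<phi> r])
  have i2: "integrable lborel (\<lambda>s. (p s * (1 - exp (- (1 * s)))) *\<^sub>R G r)"
    using integrable_one_minus_exp[of 1] by simp
  have eq: "p s *\<^sub>R (G (r + s) - exp (- s) *\<^sub>R G r) = (p s * (1 - exp (- (1 * s)))) *\<^sub>R G r - p s *\<^sub>R (G r - G (r + s))" for s
    by (simp add: algebra_simps)
  show "integrable lborel (\<lambda>s. p s *\<^sub>R (pairing \<phi> (r + s) - exp (- s) *\<^sub>R pairing \<phi> r))"
    unfolding G_def[symmetric] eq using i1 i2 by (rule Bochner_Integration.integrable_diff[rotated])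
  have diff: "p s *\<^sub>R (pairing \<phi>r 0 - pairing \<phi>r s) = p s *\<^sub>R (G r - G (r + s))" for s
    using orbit[of 0] orbit[of s] by (cases "0 \<le> s") (auto simp: G_def p_nonpos)
  have e1: "psi_laplacian_distr \<psi> u \<phi>r = c *\<^sub>R G r + (LINT s|lborel. p s *\<^sub>R (G r - G (r + s)))"
    unfolding psi_laplacian_distr_eq_pairing[OF \<phi>r] diff using orbit[of 0] by (simp add: G_def)
  have "psi_laplacian_distr \<psi> u \<phi>r = complex_of_real (\<psi> 1) * pairing \<phi>r 0"
    using H \<phi>r unfolding solves_psi_eigen_def distribution_of_eq_pairing[OF \<phi>r, symmetric] by blast
  then have e2: "psi_laplacian_distr \<psi> u \<phi>r = \<psi> 1 *\<^sub>R G r"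
    using orbit[of 0] by (simp add: G_def scaleR_conv_of_real)
  have e3: "\<psi> 1 *\<^sub>R G r = c *\<^sub>R G r + (LINT s|lborel. (p s * (1 - exp (- (1 * s)))) *\<^sub>R G r)"
    using integrable_one_minus_exp[of 1] unfolding \<psi>[OF zero_less_one] by (simp add: scaleR_add_left)
  have e4: "(LINT s|lborel. p s *\<^sub>R (G r - G (r + s))) = (LINT s|lborel. (p s * (1 - exp (- (1 * s)))) *\<^sub>R G r)"
    using e1 unfolding e2 e3 by (rule add_left_imp_eq[symmetric])
  show "(LINT s|lborel. p s *\<^sub>R (pairing \<phi> (r + s) - exp (- s) *\<^sub>R pairing \<phi> r)) = 0"
    unfolding G_def[symmetric] eq Bochner_Integration.integral_diff[OF i2 i1] e4 by simp
qed

text \<open>The maximum principle for a Gaussian orbit \<open>F\<close>, whose derivative is the orbit of the Laplacian of the Gaussian. It is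
  applied to the images of \<open>F\<close> under \<open>Re\<close>, \<open>Im\<close> and their negatives, which together give \<open>F' = - F\<close>.\<close>

lemma heat_eigenfunction_if_solves_psi_eigen:
  assumes H: "solves_psi_eigen \<psi> u" and ab: "0 < a" "a < b" "p b < p a"
  shows heat_eigenfunction
proof (rule heat_eigenfunction_if_gauss)
  fix t s :: real and x :: "real^'n" assume t: "0 < t" and s: "0 \<le> s"
  define \<phi> where "\<phi> = gauss t x"
  note S0 = schwartz_gauss[OF t, of x, folded \<phi>_def]
  note S1 = schwartz_laplacian[OF S0]
  note S2 = schwartz_laplacian[OF S1]
  have le: "L (pairing \<phi> \<tau>) + L (pairing (laplacian \<phi>) \<tau>) \<le> 0"
    if L: "bounded_linear L" and Ln: "\<And>z. \<bar>L z\<bar> \<le> norm z" and \<tau>: "0 \<le> \<tau>" for L :: "complex \<Rightarrow> real" and \<tau>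
  proof (rule maximum_principle[OF _ _ _ _ _ _ _ ab \<tau>])
    interpret bounded_linear L by (rule L)
    fix r :: real assume r: "0 \<le> r"
    show "((\<lambda>r. L (pairing \<phi> r)) has_real_derivative L (pairing (laplacian \<phi>) r)) (at r within {0..})"
      unfolding has_real_derivative_iff_has_vector_derivative
      by (rule has_vector_derivative[OF pairing_derivative[OF S0 r]])
    show "((\<lambda>r. L (pairing (laplacian \<phi>) r)) has_real_derivative L (pairing (laplacian (laplacian \<phi>)) r)) (at r within {0..})"
      unfolding has_real_derivative_iff_has_vector_derivative
      by (rule has_vector_derivative[OF pairing_derivative[OF S1 r]])
    have nn: "0 \<le> M * L1_norm (laplacian \<phi>)" "0 \<le> M * L1_norm (laplacian (laplacian \<phi>))"
      using M_nonneg by (auto intro!: mult_nonneg_nonneg)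
    show "\<bar>L (pairing (laplacian \<phi>) r)\<bar> \<le> M * L1_norm (laplacian \<phi>) + M * L1_norm (laplacian (laplacian \<phi>))"
      using Ln[of "pairing (laplacian \<phi>) r"] pairing_bound[OF S1 r] nn by linarith
    show "\<bar>L (pairing (laplacian (laplacian \<phi>)) r)\<bar> \<le> M * L1_norm (laplacian \<phi>) + M * L1_norm (laplacian (laplacian \<phi>))"
      using Ln[of "pairing (laplacian (laplacian \<phi>)) r"] pairing_bound[OF S2 r] nn by linarith
    have tr: "0 < t + r" using t r by simp
    have orbit: "pairing (laplacian (gauss (t + r) x)) q = pairing (laplacian \<phi>) (r + q)" if "0 \<le> q" for q
      using pairing_laplacian_gauss[OF tr that] pairing_laplacian_gauss[OF t, of "r + q"] r that
      by (simp add: \<phi>_def add.assoc)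
    note Sr = schwartz_laplacian[OF schwartz_gauss[OF tr]]
    have eqn1: "integrable lborel (\<lambda>q. p q *\<^sub>R (pairing (laplacian \<phi>) (r + q) - exp (- q) *\<^sub>R pairing (laplacian \<phi>) r))"
      by (rule pairing_orbit_equation(1)[OF H S1 Sr r]) (rule orbit)
    have eqn2: "(LINT q|lborel. p q *\<^sub>R (pairing (laplacian \<phi>) (r + q) - exp (- q) *\<^sub>R pairing (laplacian \<phi>) r)) = 0"
      by (rule pairing_orbit_equation(2)[OF H S1 Sr r]) (rule orbit)
    have "L (LINT q|lborel. p q *\<^sub>R (pairing (laplacian \<phi>) (r + q) - exp (- q) *\<^sub>R pairing (laplacian \<phi>) r)) =
        (LINT q|lborel. L (p q *\<^sub>R (pairing (laplacian \<phi>) (r + q) - exp (- q) *\<^sub>R pairing (laplacian \<phi>) r)))"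
      by (rule integral_bounded_linear[OF L eqn1, symmetric])
    then show "(LINT q|lborel. p q *\<^sub>R (L (pairing (laplacian \<phi>) (r + q)) - exp (- q) * L (pairing (laplacian \<phi>) r))) = 0"
      unfolding eqn2 by (simp add: scaleR diff zero)
  next
    show "((\<lambda>r. L (pairing \<phi> r)) \<longlongrightarrow> 0) at_top"
      using bounded_linear.tendsto[OF L pairing_tendsto_zero[OF S0]] linear_simps(3)[OF L] by simp
    show "((\<lambda>r. L (pairing (laplacian \<phi>) r)) \<longlongrightarrow> 0) at_top"
      using bounded_linear.tendsto[OF L pairing_tendsto_zero[OF S1]] linear_simps(3)[OF L] by simp
  qed
  have "pairing \<phi> s = exp (- s) *\<^sub>R pairing \<phi> 0"
  proof (rule pairing_eq_exp_if_derivative[OF S0 _ s])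
    fix q :: real assume q: "0 \<le> q"
    have 1: "Re (pairing \<phi> q) + Re (pairing (laplacian \<phi>) q) \<le> 0"
      by (rule le[OF bounded_linear_Re abs_Re_le_cmod q])
    have 2: "Im (pairing \<phi> q) + Im (pairing (laplacian \<phi>) q) \<le> 0"
      by (rule le[OF bounded_linear_Im abs_Im_le_cmod q])
    have 3: "- Re (pairing \<phi> q) + - Re (pairing (laplacian \<phi>) q) \<le> 0"
      by (rule le[OF bounded_linear_minus[OF bounded_linear_Re] _ q]) (simp add: abs_Re_le_cmod)
    have 4: "- Im (pairing \<phi> q) + - Im (pairing (laplacian \<phi>) q) \<le> 0"
      by (rule le[OF bounded_linear_minus[OF bounded_linear_Im] _ q]) (simp add: abs_Im_le_cmod)
    from 1 2 3 4 show "pairing (laplacian \<phi>) q = - pairing \<phi> q"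
      by (simp add: complex_eq_iff)
  qed
  then show "pairing (gauss t x) s = exp (- s) *\<^sub>R pairing (gauss t x) 0"
    by (simp add: \<phi>_def)
qed

theorem solves_psi_eigen_iff_helmholtz:
  assumes "0 < a" "a < b" "p b < p a"
  shows "solves_psi_eigen \<psi> u \<longleftrightarrow> solves_helmholtz u"
proof
  assume "solves_psi_eigen \<psi> u"
  then have heat_eigenfunction by (rule heat_eigenfunction_if_solves_psi_eigen[OF _ assms])
  then show "solves_helmholtz u" by (simp only: solves_helmholtz_iff)
next
  assume "solves_helmholtz u"
  then have heat_eigenfunction by (simp only: solves_helmholtz_iff)
  then show "solves_psi_eigen \<psi> u" by (rule solves_psi_eigen_if_heat_eigenfunction)
qed

end

section \<open>Krein strings and constant symbols\<close>

text \<open>Let \<open>\<psi> = c\<close> on \<open>(0,\<infinity>)\<close>. Then for every \<open>\<mu> > 0\<close> the string equation has a non-increasing solution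
  \<open>\<phi> \<ge> 0\<close> with \<open>\<phi> 0 = 1\<close> and initial slope \<open>- c\<close>. From \<open>\<phi> \<le> 1\<close> and the mean value theorem, \<open>0 \<le> \<phi> s \<le> 1 + s (- c + \<mu> \<integral> A)\<close>, the integral being over
  \<open>[0, s]\<close>; letting \<open>\<mu> \<rightarrow> 0\<close> and then \<open>s \<rightarrow> \<infinity>\<close> gives \<open>c \<le> 0\<close>. It is here that the string has infinite length. But then the
  slope is never negative, so the non-increasing solution is constant, and the equation says that \<open>\<integral> A \<le> 0\<close> on every
  interval. But the integral of \<open>A\<close> over \<open>[0, \<sigma>]\<close>, with \<open>\<sigma>\<close> the integral of \<open>1/a\<close> over \<open>[0, 1]\<close>, equals that of the
  positive weight \<open>a\<close> over \<open>[0, 1]\<close>.\<close>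

lemma associated_weight_not_constant:
  assumes w: "associated_weight \<psi> a" and const: "\<And>t. 0 < t \<Longrightarrow> \<psi> t = c"
  shows False
proof -
  obtain A where a_pos: "AE t in lebesgue. 0 < t \<longrightarrow> 0 < a t"
    and a_int: "L1_loc_half_line a"
    and K: "krein_corresponds \<psi> A"
    and A_eq: "\<And>t. 0 \<le> t \<Longrightarrow> integral {0..integral {0..t} (\<lambda>\<tau>. inverse (a \<tau>))} A = integral {0..t} a"
    using w unfolding associated_weight_def Let_def by blast
  have A_nonneg: "AE s in lebesgue. 0 \<le> s \<longrightarrow> 0 \<le> A s" and A_int: "L1_loc_half_line A"
    using K unfolding krein_corresponds_def by auto
  define N where "N = {s. \<not> (0 \<le> s \<longrightarrow> 0 \<le> A s)}"
  have N: "negligible N"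
    using A_nonneg unfolding N_def eventually_ae_filter_negligible by (auto intro: negligible_subset)
  \<comment> \<open>A representative of \<open>A\<close> that is non-negative everywhere; all integrals are unchanged.\<close>
  define B where "B s = max 0 (A s)" for s
  have B_eq: "integral {0..s} (\<lambda>r. A r * g r) = integral {0..s} (\<lambda>r. B r * g r)" for s g
    by (rule integral_spike[OF N]) (auto simp: N_def B_def)
  have B_eq1: "integral {0..s} A = integral {0..s} B" for s
    using B_eq[of s "\<lambda>_. 1"] by simp
  have B_nonneg: "0 \<le> B s" for s by (simp add: B_def)
  have B_int: "B integrable_on {0..s}" if "0 \<le> s" for s
  proof -
    have "A integrable_on {0..s}"
      using A_int that unfolding L1_loc_half_line_def by (blast intro: set_lebesgue_integral_eq_integral(1))
    then show ?thesis by (rule integrable_spike[OF _ N]) (auto simp: N_def B_def)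
  qed
  have IB_nonneg: "0 \<le> integral {0..s} B" for s
    by (cases "B integrable_on {0..s}") (auto intro: integral_nonneg B_nonneg simp: not_integrable_integral)
  have sol: "\<exists>\<phi> \<phi>'. string_solution A \<mu> \<phi> \<phi>' \<and> \<phi> 0 = 1 \<and> (\<forall>s\<ge>0. 0 \<le> \<phi> s) \<and> antimono_on {0..} \<phi> \<and> \<phi>' 0 = - c"
    if "0 < \<mu>" for \<mu>
    using K that const[OF that] unfolding krein_corresponds_def by metis
  have bound: "c \<le> 1 / s + \<mu> * integral {0..s} B" if \<mu>: "0 < \<mu>" and s: "0 < s" for \<mu> s
  proof -
    obtain \<phi> \<phi>' where \<phi>: "string_solution A \<mu> \<phi> \<phi>'" "\<phi> 0 = 1" "\<And>s. 0 \<le> s \<Longrightarrow> 0 \<le> \<phi> s"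
      "antimono_on {0..} \<phi>" "\<phi>' 0 = - c" using sol[OF \<mu>] by blast
    have der: "(\<phi> has_real_derivative \<phi>' r) (at r within {0..})" if "0 \<le> r" for r
      using \<phi>(1) that unfolding string_solution_def by blast
    have \<phi>': "\<phi>' r = - c + \<mu> * integral {0..r} (\<lambda>r. B r * \<phi> r)" if "0 \<le> r" for r
      using \<phi>(1) that unfolding string_solution_def \<phi>(5) B_eq by blast
    have le1: "\<phi> r \<le> 1" if "0 \<le> r" for r
      using monotone_onD[OF \<phi>(4), of 0 r] that \<phi>(2) by auto
    obtain \<xi> where \<xi>: "0 < \<xi>" "\<xi> < s" "\<phi> s - \<phi> 0 = (s - 0) * \<phi>' \<xi>"
    proof -
      have "\<exists>\<xi>. 0 < \<xi> \<and> \<xi> < s \<and> \<phi> s - \<phi> 0 = \<phi>' \<xi> * (s - 0)"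
      proof -
        have "continuous_on {0..} \<phi>" by (rule DERIV_continuous_on[OF der]) simp
        then have "continuous_on {0..s} \<phi>" by (rule continuous_on_subset) auto
        moreover have "(\<phi> has_real_derivative \<phi>' r) (at r)" if "0 < r" "r < s" for r
          using der[of r] that at_within_interior[of r "{0..}"] by (simp add: interior_real_atLeast)
        ultimately show ?thesis
          using mvt_simple[OF s, of \<phi> "\<lambda>r h. \<phi>' r * h"] mvt[OF s, of \<phi> "\<lambda>r h. \<phi>' r * h"]
          by (auto simp: has_field_derivative_def)
      qed
      then show thesis using that by (auto simp: mult.commute)
    qed
    have "integral {0..\<xi>} (\<lambda>r. B r * \<phi> r) \<le> integral {0..\<xi>} B"
    proof (cases "(\<lambda>r. B r * \<phi> r) integrable_on {0..\<xi>}")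
      case True
      then show ?thesis
        using \<xi> le1 B_nonneg by (intro integral_le B_int) (auto intro!: mult_left_le)
    qed (simp add: not_integrable_integral IB_nonneg)
    also have "\<dots> \<le> integral {0..s} B"
      using \<xi> s by (intro integral_subset_le B_int) (auto simp: B_nonneg)
    finally have "\<mu> * integral {0..\<xi>} (\<lambda>r. B r * \<phi> r) \<le> \<mu> * integral {0..s} B"
      using \<mu> by (intro mult_left_mono) auto
    then have "\<phi>' \<xi> \<le> - c + \<mu> * integral {0..s} B"
      using \<phi>'[of \<xi>] \<xi> by simp
    then have "s * \<phi>' \<xi> \<le> s * (- c + \<mu> * integral {0..s} B)"
      using s by (intro mult_left_mono) auto
    moreover have "- 1 \<le> s * \<phi>' \<xi>" using \<xi>(3) \<phi>(2) \<phi>(3)[of s] s by simp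
    ultimately have "s * c \<le> s * (1 / s + \<mu> * integral {0..s} B)"
      using s by (simp add: algebra_simps)
    then show ?thesis using s by (rule mult_left_le_imp_le)
  qed
  have "c \<le> 1 / s" if s: "0 < s" for s
  proof (rule field_le_epsilon)
    fix e :: real assume e: "0 < e"
    \<comment> \<open>Any \<open>\<mu> > 0\<close> with \<open>\<mu> * integral {0..s} B \<le> e\<close> would do.\<close>
    define \<mu> where "\<mu> = e / (integral {0..s} B + 1)"
    have "0 < \<mu>" "\<mu> * integral {0..s} B \<le> e"
      using e IB_nonneg[of s] by (auto simp: \<mu>_def field_simps)
    then show "c \<le> 1 / s + e" using bound[OF _ s, of \<mu>] by linarith
  qed
  then have c_le: "c \<le> e" if "0 < e" for e
    using that by (metis divide_divide_eq_right mult_1 div_by_1 zero_less_divide_1_iff)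
  have c_nonpos: "c \<le> 0" by (rule field_le_epsilon) (simp add: c_le)
  obtain \<phi> \<phi>' where \<phi>: "string_solution A 1 \<phi> \<phi>'" "\<phi> 0 = 1" "\<And>s. 0 \<le> s \<Longrightarrow> 0 \<le> \<phi> s"
      "antimono_on {0..} \<phi>" "\<phi>' 0 = - c" using sol[of 1] by auto
  have der: "(\<phi> has_real_derivative \<phi>' r) (at r within {0..})" if "0 \<le> r" for r
    using \<phi>(1) that unfolding string_solution_def by blast
  have \<phi>': "\<phi>' r = - c + integral {0..r} (\<lambda>r. B r * \<phi> r)" if "0 \<le> r" for r
    using \<phi>(1) that unfolding string_solution_def \<phi>(5) B_eq by simp
  have IBp: "0 \<le> integral {0..r} (\<lambda>r. B r * \<phi> r)" for r
    by (cases "(\<lambda>r. B r * \<phi> r) integrable_on {0..r}")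
       (auto intro!: integral_nonneg mult_nonneg_nonneg B_nonneg \<phi>(3) simp: not_integrable_integral)
  have ge: "1 \<le> \<phi> r" if r: "0 \<le> r" for r
  proof (cases "r = 0")
    case False
    have "\<exists>\<xi>\<in>{0..r}. \<phi> r - \<phi> 0 = \<phi>' \<xi> * (r - 0)"
    proof -
      have "(\<phi> has_derivative (\<lambda>h. \<phi>' q * h)) (at q within {0..r})" if "0 \<le> q" "q \<le> r" for q
        using DERIV_subset[OF der[OF that(1)], of "{0..r}"] by (auto simp: has_field_derivative_def)
      then show ?thesis using mvt_very_simple[of 0 r \<phi> "\<lambda>q h. \<phi>' q * h"] r by auto
    qed
    then obtain \<xi> where "\<xi> \<in> {0..r}" "\<phi> r - 1 = \<phi>' \<xi> * r" using \<phi>(2) by auto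
    moreover from this have "0 \<le> \<phi>' \<xi>" using \<phi>'[of \<xi>] IBp[of \<xi>] c_nonpos by simp
    ultimately have "0 \<le> \<phi> r - 1" using r by simp
    then show ?thesis by simp
  qed (simp add: \<phi>(2))
  have one: "\<phi> r = 1" if "0 \<le> r" for r
    using ge[OF that] monotone_onD[OF \<phi>(4), of 0 r] that \<phi>(2) by auto
  have "\<phi>' r = 0" if r: "0 < r" for r
  proof -
    have "((\<lambda>r. 1) has_real_derivative \<phi>' r) (at r within {0..})"
      by (rule has_field_derivative_transform_within[OF der, of _ 1]) (use r one in auto)
    moreover have "at r within {0..} = at r"
      using r by (intro at_within_interior) (simp add: interior_real_atLeast)
    ultimately have "((\<lambda>r. 1) has_real_derivative \<phi>' r) (at r)" by simp
    then show ?thesis using DERIV_const by (rule DERIV_unique)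
  qed
  then have "integral {0..r} (\<lambda>r. B r * \<phi> r) = c" if "0 < r" for r
    using \<phi>'[of r] that by simp
  moreover have "integral {0..r} (\<lambda>r. B r * \<phi> r) = integral {0..r} A" for r
    unfolding B_eq1 by (rule integral_cong) (simp add: one)
  ultimately have "integral {0..r} A \<le> 0" if "0 < r" for r using c_nonpos that by simp
  then have IA: "integral {0..r} A \<le> 0" for r
    by (cases "0 < r"; cases "r = 0") auto
  have a_set: "set_integrable lebesgue {0..1} a"
    using a_int unfolding L1_loc_half_line_def by auto
  have "(LINT x|lebesgue. indicator {0..1} x *\<^sub>R a x) = integral {0..1} a"
    using set_lebesgue_integral_eq_integral(2)[OF a_set] by (simp add: set_lebesgue_integral_def)
  also have "\<dots> \<le> 0" using A_eq[of 1] IA[of "integral {0..1} (\<lambda>\<tau>. inverse (a \<tau>))"] by simp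
  finally have le0: "(LINT x|lebesgue. indicator {0..1} x *\<^sub>R a x) \<le> 0" .
  have n0: "AE x in lebesgue. x \<noteq> (0::real)"
    by (intro AE_completion AE_lborel_singleton)
  have nn: "AE x in lebesgue. 0 \<le> indicator {0..1} x *\<^sub>R a x"
    using a_pos n0 by eventually_elim (auto simp: indicator_def)
  have "(LINT x|lebesgue. indicator {0..1} x *\<^sub>R a x) = 0"
    using le0 integral_nonneg_AE[OF nn] by linarith
  then have "AE x in lebesgue. indicator {0..1} x *\<^sub>R a x = 0"
    using integral_nonneg_eq_0_iff_AE[OF _ nn] a_set unfolding set_integrable_def by simp
  then have "AE x in lebesgue. x \<notin> {0..1::real}"
    using a_pos n0 by eventually_elim (auto simp: indicator_def split: if_splits)
  then have "AE x in lborel. x \<notin> {0..1::real}" by (simp add: AE_completion_iff)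
  then have "{0..1::real} \<in> null_sets lborel" by (subst AE_iff_null_sets) auto
  then show False by (auto dest: null_setsD1)
qed

section \<open>Eigenfunctions of the operator and of the Laplacian\<close>

lemma bounded_borel_representative:
  fixes u :: "real^'n::finite \<Rightarrow> complex"
  assumes "L_infinity u" "vanishes_at_infinity u"
  obtains v M where "vanishing_function v M" "AE x in lebesgue. u x = v x"
proof -
  have um: "u \<in> borel_measurable lebesgue" using assms(1) by (simp add: L_infinity_def)
  obtain C where C: "AE x in lebesgue. norm (u x) \<le> C" using assms(1) by (auto simp: L_infinity_def)
  have "(\<lambda>x. Re (u x)) \<in> borel_measurable (completion lborel)" "(\<lambda>x. Im (u x)) \<in> borel_measurable (completion lborel)"
    using um by measurable
  from this[THEN completion_ex_borel_measurable_real]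
  obtain f g where f: "f \<in> borel_measurable lborel" "AE x in lborel. Re (u x) = f x"
    and g: "g \<in> borel_measurable lborel" "AE x in lborel. Im (u x) = g x"
    by blast
  have [measurable]: "f \<in> borel_measurable borel" "g \<in> borel_measurable borel" using f g by auto
  define w where "w x = Complex (f x) (g x)" for x
  have w_eq: "w x = complex_of_real (f x) + \<i> * complex_of_real (g x)" for x by (simp add: w_def complex_eq_iff)
  have [measurable]: "w \<in> borel_measurable borel" unfolding w_eq[abs_def] by measurable
  define v where "v x = (if norm (w x) \<le> \<bar>C\<bar> then w x else 0)" for x
  have [measurable]: "v \<in> borel_measurable borel" unfolding v_def[abs_def] by measurable
  have uw: "AE x in lebesgue. u x = w x"
    using AE_completion[OF f(2)] AE_completion[OF g(2)] by eventually_elim (simp add: w_def complex_eq_iff)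
  have uv: "AE x in lebesgue. u x = v x"
    using uw C by eventually_elim (auto simp: v_def)
  have "vanishing_function v \<bar>C\<bar>"
  proof
    show "norm (v x) \<le> \<bar>C\<bar>" for x by (simp add: v_def)
    fix \<epsilon> :: real assume "0 < \<epsilon>"
    then obtain r where "AE x in lebesgue. r \<le> norm x \<longrightarrow> norm (u x) < \<epsilon>"
      using assms(2) by (auto simp: vanishes_at_infinity_def)
    then have "AE x in lebesgue. r \<le> norm x \<longrightarrow> norm (v x) < \<epsilon>"
      using uv by eventually_elim simp
    then show "\<exists>r. AE x in lborel. r \<le> norm x \<longrightarrow> norm (v x) < \<epsilon>"
      unfolding AE_completion_iff by blast
  qed measurable
  then show thesis using uv by (rule that)
qed

lemma distribution_of_cong_AE:
  fixes u v :: "real^'n::finite \<Rightarrow> complex"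
  assumes "AE x in lebesgue. u x = v x" "u \<in> borel_measurable lebesgue" "v \<in> borel_measurable lebesgue"
    and "\<phi> \<in> borel_measurable borel"
  shows "distribution_of u \<phi> = distribution_of v \<phi>"
proof -
  have [measurable]: "\<phi> \<in> borel_measurable lebesgue" using assms(4) by (intro measurable_completion) simp
  note [measurable] = assms(2,3)
  show ?thesis
    unfolding distribution_of_def
    by (rule integral_cong_AE) (use assms(1) in \<open>auto elim: eventually_mono\<close>)
qed

theorem theorem1p4:
  fixes \<psi> a :: "real \<Rightarrow> real" and \<alpha> :: real and u :: "real^'n::finite \<Rightarrow> complex"
  assumes "CARD('n) \<ge> 2"
    and "complete_bernstein \<psi>"
    and "associated_weight \<psi> a"
    and "A2_weight a"
    and "- 1 < \<alpha>" and "\<alpha> < 1" and "power_like_at_infinity a \<alpha>"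
    and "L_infinity u"
    and "vanishes_at_infinity u"
  shows "solves_psi_eigen \<psi> u \<longleftrightarrow> solves_helmholtz u"
proof -
  obtain c p p' where p: "levy_density p p'"
    and \<psi>: "\<And>t. 0 < t \<Longrightarrow> \<psi> t = c + (LINT s|lborel. p s * (1 - exp (- (t * s))))"
    and decr: "\<And>a. 0 < a \<Longrightarrow> 0 < p a \<Longrightarrow> \<exists>b>a. p b < p a"
    by (rule complete_bernstein_levy[OF assms(2)]) (rule that; assumption)
  interpret levy_density p p' by (rule p)
  have "\<exists>q>0. 0 < p q"
  proof (rule ccontr)
    assume none: "\<not> (\<exists>q>0. 0 < p q)"
    have "p s = 0" for s
    proof (cases "0 < s")
      case True
      then have "\<not> 0 < p s" using none by blast
      then show ?thesis using p_nonneg[of s] by simp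
    qed (simp add: p_nonpos)
    then have "\<psi> t = c" if "0 < t" for t using \<psi>[OF that] by simp
    then show False by (rule associated_weight_not_constant[OF assms(3)])
  qed
  then obtain q where q: "0 < q" "0 < p q" by blast
  then obtain b where b: "q < b" "p b < p q" using decr by blast
  obtain v M where v: "vanishing_function v M" and uv: "AE x in lebesgue. u x = v x"
    using bounded_borel_representative[OF assms(8,9)] by blast
  interpret vanishing_function v M by (rule v)
  interpret levy_pairing v M p p' \<psi> c by standard (rule \<psi>)
  have um: "u \<in> borel_measurable lebesgue" using assms(8) by (simp add: L_infinity_def)
  have vm: "v \<in> borel_measurable lebesgue" by (intro measurable_completion) simp
  note cong = distribution_of_cong_AE[OF uv um vm]
  have c0: "distribution_of u \<phi> = distribution_of v \<phi>" if "schwartz \<phi>" for \<phi>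
    by (rule cong[OF schwartz_measurable[OF that]])
  have c1: "psi_laplacian_distr \<psi> u \<phi> = psi_laplacian_distr \<psi> v \<phi>" if "schwartz \<phi>" for \<phi>
    unfolding psi_laplacian_distr_def by (rule cong[OF psi_laplacian_measurable[OF that]])
  have c2: "neg_laplacian_distr u \<phi> = neg_laplacian_distr v \<phi>" if "schwartz \<phi>" for \<phi>
    unfolding neg_laplacian_distr_def
    by (rule cong[OF borel_measurable_uminus[OF schwartz_measurable[OF schwartz_laplacian[OF that]]]])
  have "solves_psi_eigen \<psi> u \<longleftrightarrow> solves_psi_eigen \<psi> v"
    unfolding solves_psi_eigen_def by (intro all_cong1 imp_cong refl) (simp only: c0 c1)
  also have "\<dots> \<longleftrightarrow> solves_helmholtz v"
    by (rule solves_psi_eigen_iff_helmholtz[OF q(1) b])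
  also have "\<dots> \<longleftrightarrow> solves_helmholtz u"
    unfolding solves_helmholtz_def by (intro all_cong1 imp_cong refl) (simp only: c0 c2)
  finally show ?thesis .
qed

end
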